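(* Let $\mu$ be a non-zero integer. Then there is a constant $C$ (an integration constant, independent of $x$, possibly depending on $\mu$) such that for all real $x>0$ $$P_{\mu}(x)=(-1)^{\mu}\left(-f_{\mu}(x)+\mu^2\int_x^{\infty}\frac{f_{\mu}(t)}{t}\,dt+(1-\mu^2)\,x\int_x^{\infty}\frac{f_{\mu}(t)}{t^2}\,dt+Cx\right).$$
   Context: $J_p(x)$ and $Y_p(x)$ are the Bessel functions of the first and second kind of order $p$. A hat denotes the derivative with respect to the order: for an integer $k$ and $x>0$, $\hat{J}_k(x)=\left.\frac{\partial}{\partial p}J_p(x)\right|_{p=k}$. For an integer $\mu$ and $x>0$ define $$P_{\mu}(x)=\sum_{n=1}^{\infty}n\left[\left(\hat{J}_{n-\mu}(x)J_{n}(x)+J_{n-\mu}(x)\hat{J}_{n}(x)\right)+(-1)^{\mu}\left(\hat{J}_{n+\mu}(x)J_{n}(x)+J_{n+\mu}(x)\hat{J}_{n}(x)\right)\right]$$ and $$f_{\mu}(x)=\frac{\pi}{4}\left(Y_{\mu}(x)J_0(x)+J_{\mu}(x)Y_0(x)\right).$$ *)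

theory Defs
  imports "HOL-Analysis.Analysis"
begin

(* Power series of the Bessel function of the first kind, for real order p and x > 0.
   The entire function rGamma = 1 / Gamma makes the terms with p + m + 1 in {0, -1, -2, ...}
   vanish, so the formula is also the right one at negative integer orders. *)
definition bessel_J :: "real \<Rightarrow> real \<Rightarrow> real" where
  "bessel_J p x =
     (\<Sum>m. (-1) ^ m * rGamma (p + real m + 1) / fact m * (x / 2) powr (2 * real m + p))"

(* At integer orders the quotient is 0 / 0 and is replaced by its limit in the order. *)
definition bessel_Y :: "real \<Rightarrow> real \<Rightarrow> real" where
  "bessel_Y p x =
     (let Q = (\<lambda>q. (bessel_J q x * cos (q * pi) - bessel_J (-q) x) / sin (q * pi))
      in if p \<in> \<int> then Lim (at p) Q else Q p)"

definition bessel_J_hat :: "int \<Rightarrow> real \<Rightarrow> real" where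
  "bessel_J_hat k x = deriv (\<lambda>p. bessel_J p x) (of_int k)"

abbreviation bessel_J_int :: "int \<Rightarrow> real \<Rightarrow> real" where
  "bessel_J_int k \<equiv> bessel_J (of_int k)"

abbreviation bessel_Y_int :: "int \<Rightarrow> real \<Rightarrow> real" where
  "bessel_Y_int k \<equiv> bessel_Y (of_int k)"

definition bessel_P_term :: "int \<Rightarrow> real \<Rightarrow> int \<Rightarrow> real" where
  "bessel_P_term \<mu> x n = of_int n *
     ((bessel_J_hat (n - \<mu>) x * bessel_J_int n x + bessel_J_int (n - \<mu>) x * bessel_J_hat n x)
      + (-1) powi \<mu> *
        (bessel_J_hat (n + \<mu>) x * bessel_J_int n x + bessel_J_int (n + \<mu>) x * bessel_J_hat n x))"

definition bessel_P :: "int \<Rightarrow> real \<Rightarrow> real" where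
  "bessel_P \<mu> x = (\<Sum>n. bessel_P_term \<mu> x (int (Suc n)))"

definition bessel_f :: "int \<Rightarrow> real \<Rightarrow> real" where
  "bessel_f \<mu> x = pi / 4 *
     (bessel_Y_int \<mu> x * bessel_J_int 0 x + bessel_J_int \<mu> x * bessel_Y_int 0 x)"

end

theory Submission
  imports Defs "HOL-Real_Asymp.Real_Asymp"
begin

text \<open>
  Write \<open>D = x d/dx\<close>. By the three-term recurrences and their derivatives in the order, \<open>D - 1\<close>
  maps the \<open>n\<close>-th summand of \<open>P\<close> to a difference of consecutive terms of a null sequence, so that
  \<open>(P/x)'\<close> is an elementary expression in the Bessel functions of orders \<open>0\<close>, \<open>1\<close> and \<open>\<mu>\<close>.
  Up to sign it equals \<open>(D f + G)/x\<^sup>2\<close>, where \<open>G\<close> is a combination of Wronskians of orders \<open>0\<close> and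
  \<open>\<mu>\<close> with \<open>D G = - \<mu>\<^sup>2 f\<close>. The formula follows by integration once \<open>G \<rightarrow> 0\<close> at infinity.

  The recurrences reduce \<open>G \<rightarrow> 0\<close> to \<open>x (J\<^sub>0 Y\<^sub>0 + J\<^sub>1 Y\<^sub>1) \<rightarrow> 0\<close>. This holds because
  \<open>\<pi> J\<^sub>0(x) = \<integral>\<^sub>0\<^sup>\<pi> cos (x sin t) dt\<close> and \<open>\<pi> Y\<^sub>0(x) = \<integral>\<^sub>0\<^sup>\<pi> sin (x sin t) dt - 2 \<integral>\<^sub>0\<^sup>\<infinity> e\<^sup>-\<^sup>t / \<surd>(x\<^sup>2 + t\<^sup>2) dt\<close>,
  which by one integration by parts yields \<open>Y\<^sub>0 = J\<^sub>1 + O(1/x)\<close> and \<open>Y\<^sub>1 = - J\<^sub>0 + O(1/x)\<close>.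
\<close>

section \<open>The reciprocal Gamma function on the real line\<close>

text \<open>The bounds \<open>J, Y = O(1 / sqrt x)\<close> only show that \<open>G\<close> is
  bounded, since its Wronskians carry a factor \<open>x\<close>; some phase information is
  unavoidable. The recurrences isolate what is needed: the relevant combinations of orders
  \<open>k\<close> and \<open>k + 2\<close> add up to decaying products, so all orders reduce to
  two, and one of these vanishes identically. The other needs no more than that
  \<open>(Y_0, Y_1)\<close> is \<open>(J_1, - J_0)\<close> to leading order, so no full asymptotic
  expansion is required.

  The integral representations are identified by uniqueness for the order-zero Bessel equation, with
  both sides compared at zero from the right. For \<open>Y_0\<close> the constant next to the
  logarithm must match as well: the Euler-Mascheroni constant enters as \<open>rGamma' 1\<close> on
  the series side and as minus the integral of \<open>exp (- t) * ln t\<close> on the other.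

  Derivatives in the order fall on the coefficients \<open>1 / Gamma\<close>. This function has no
  poles, so its functional equation can be differentiated on the whole line and negative integer
  orders need no separate treatment.\<close>

abbreviation rGamma' :: "real \<Rightarrow> real" where "rGamma' \<equiv> deriv rGamma"

lemma has_field_derivative_rGamma_deriv:
  "(rGamma has_field_derivative rGamma' t) (at t within A)"
proof -
  have "rGamma field_differentiable at t"
    using has_field_derivative_rGamma[of t UNIV] unfolding field_differentiable_def by blast
  then show ?thesis
    by (simp add: DERIV_deriv_iff_field_differentiable has_field_derivative_at_within)
qed

lemma has_field_derivative_rGamma_shift:
  "((\<lambda>t. rGamma (t + c)) has_field_derivative rGamma' (t + c)) (at t within A)"
  using has_field_derivative_rGamma_deriv[of "t + c" UNIV]
  by (simp add: DERIV_shift has_field_derivative_at_within)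

lemma rGamma'_plus1: "rGamma' t = rGamma (t + 1) + t * rGamma' (t + 1)"
proof -
  have "((\<lambda>t. t * rGamma (t + 1)) has_field_derivative (rGamma (t + 1) + t * rGamma' (t + 1))) (at t)"
    by (rule DERIV_mult'[OF DERIV_ident has_field_derivative_rGamma_shift, THEN DERIV_cong]) simp
  then show ?thesis
    using has_field_derivative_rGamma_deriv[of t UNIV] by (simp add: rGamma_plus1 DERIV_unique)
qed

text \<open>This value is the constant term of \<open>pi / 2 * Y_0(x) - ln (x / 2)\<close> at zero,
  which later singles out the integral representation of \<open>Y_0\<close>.\<close>

lemma rGamma'_1: "rGamma' 1 = euler_mascheroni"
proof -
  have "(1::real) \<notin> \<int>\<^sub>\<le>\<^sub>0" by simp
  from has_field_derivative_rGamma_no_nonpos_int[OF this, of UNIV] show ?thesis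
    by (simp add: DERIV_imp_deriv)
qed

text \<open>The function and its derivative are estimated together because the differentiated
  functional equation feeds \<open>rGamma\<close> back into \<open>rGamma'\<close>.\<close>

definition rGamma_size :: "real \<Rightarrow> real" where
  "rGamma_size t = \<bar>rGamma t\<bar> + \<bar>rGamma' t\<bar>"

lemma rGamma_size_nonneg: "0 \<le> rGamma_size t"
  by (simp add: rGamma_size_def)

text \<open>The factor 2 absorbs the extra \<open>rGamma (t + 1)\<close> in the equation for
  \<open>rGamma'\<close>: for \<open>t \<ge> 1\<close> it is at most
  \<open>t * rGamma (t + 1) = rGamma t\<close> in absolute value.\<close>

lemma rGamma_size_step:
  assumes "t \<ge> 1"
  shows "rGamma_size (t + 1) \<le> 2 * rGamma_size t / t"
proof -
  have "t * \<bar>rGamma (t + 1)\<bar> = \<bar>rGamma t\<bar>"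
    using assms rGamma_plus1[of t] by (metis abs_mult abs_of_nonneg order_trans zero_le_one)
  moreover have "t * \<bar>rGamma' (t + 1)\<bar> \<le> \<bar>rGamma' t\<bar> + \<bar>rGamma (t + 1)\<bar>"
  proof -
    have "t * \<bar>rGamma' (t + 1)\<bar> = \<bar>rGamma' t - rGamma (t + 1)\<bar>"
      using assms rGamma'_plus1[of t] by (simp add: abs_mult)
    then show ?thesis by linarith
  qed
  moreover have "\<bar>rGamma (t + 1)\<bar> \<le> t * \<bar>rGamma (t + 1)\<bar>"
    using assms by (simp add: mult_le_cancel_right1)
  ultimately have "t * rGamma_size (t + 1) \<le> 2 * rGamma_size t"
    unfolding rGamma_size_def distrib_left using abs_ge_zero[of "rGamma' t"] by linarith
  then show ?thesis using assms by (simp add: field_simps)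
qed

lemma rGamma_size_decay_from:
  assumes "t \<ge> 1" "rGamma_size t \<le> B"
  shows "rGamma_size (t + real n) \<le> B * 2 ^ n / fact n"
proof (induction n)
  case (Suc n)
  have "rGamma_size (t + real (Suc n)) \<le> 2 * rGamma_size (t + real n) / (t + real n)"
    using rGamma_size_step[of "t + real n"] assms by (simp add: add_ac)
  also have "\<dots> \<le> 2 * rGamma_size (t + real n) / (1 + real n)"
    using assms by (intro divide_left_mono) (auto simp: rGamma_size_nonneg)
  also have "\<dots> \<le> 2 * (B * 2 ^ n / fact n) / (1 + real n)"
    using Suc by (intro divide_right_mono) auto
  finally show ?case by (simp add: field_simps)
qed (use assms in simp)

lemma continuous_on_rGamma': "continuous_on {1..2::real} rGamma'"
proof -
  have "rGamma' t = - rGamma t * Digamma t" if "t \<in> {1..2}" for t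
  proof -
    have "t \<notin> \<int>\<^sub>\<le>\<^sub>0" using that by (auto elim!: nonpos_Ints_cases)
    from has_field_derivative_rGamma_no_nonpos_int[OF this, of UNIV] show ?thesis
      by (simp add: DERIV_imp_deriv)
  qed
  moreover have "continuous_on {1..2::real} (\<lambda>t. - rGamma t * Digamma t)"
    by (intro continuous_intros continuous_on_Polygamma) (auto elim!: nonpos_Ints_cases)
  ultimately show ?thesis using continuous_on_cong[OF refl] by (metis (no_types, lifting))
qed

lemma rGamma_size_decay:
  obtains B where "B \<ge> 0" "\<And>t n. t \<ge> 1 \<Longrightarrow> rGamma_size (t + real n) \<le> B * 2 ^ n / fact n"
proof -
  have "continuous_on {1..2} rGamma_size"
    unfolding rGamma_size_def[abs_def]
    by (intro continuous_intros continuous_on_rGamma')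
  then obtain B0 where B0: "\<And>t. t \<in> {1..2} \<Longrightarrow> rGamma_size t \<le> B0"
    using compact_continuous_image[of "{1..2}" rGamma_size] 
    by (metis (no_types, lifting) atLeastAtMost_iff bdd_above_def bounded_imp_bdd_above
        compact_Icc compact_imp_bounded imageI)
  \<comment> \<open>A bound on \<open>{1..2}\<close> reaches any \<open>t \<ge> 1\<close> by an
    integer shift \<open>n\<close> at the cost \<open>2 ^ n / fact n\<close>, which never exceeds
    \<open>exp 2\<close>.\<close>
  define B where "B = B0 * exp 2"
  have nn: "B0 \<ge> 0" using B0[of 1] rGamma_size_nonneg[of 1] by auto
  have *: "rGamma_size t \<le> B" if "t \<ge> 1" for t
  proof -
    define n where "n = nat \<lfloor>t - 1\<rfloor>"
    have n: "t - real n \<in> {1..2}" using that unfolding n_def by (simp add: le_floor_iff) linarith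
    have "rGamma_size t \<le> B0 * 2 ^ n / fact n"
      using rGamma_size_decay_from[of "t - real n" B0 n] n B0 by simp
    also have "2 ^ n / fact n \<le> exp (2::real)"
    proof -
      have "(\<Sum>i\<in>{n}. 2 ^ i /\<^sub>R fact i) \<le> (exp 2 :: real)"
        unfolding exp_def by (rule sum_le_suminf[OF summable_exp_generic]) auto
      then show ?thesis by (simp add: field_simps)
    qed
    then have "B0 * 2 ^ n / fact n \<le> B" 
      using nn unfolding B_def times_divide_eq_right[symmetric] by (intro mult_left_mono) auto
    finally show ?thesis .
  qed
  show thesis
    by (rule that[of B]) (use nn rGamma_size_decay_from * in \<open>auto simp: B_def\<close>)
qed

text \<open>The weakest control that suffices for a series whose coefficients are sampled at
  \<open>p + m + 1\<close>. Boundedness on the whole line would be false: \<open>1 / Gamma\<close>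
  is unbounded towards minus infinity.\<close>

definition bounded_right :: "(real \<Rightarrow> real) \<Rightarrow> bool" where
  "bounded_right r \<longleftrightarrow> (\<forall>a. \<exists>B. \<forall>t\<ge>a. \<bar>r t\<bar> \<le> B)"

lemma bounded_rightE:
  assumes "bounded_right r"
  obtains B where "B \<ge> 0" "\<And>t. t \<ge> a \<Longrightarrow> \<bar>r t\<bar> \<le> B"
  using assms unfolding bounded_right_def by (meson abs_ge_zero order_refl order_trans)

text \<open>The functional equation carries a bound leftwards one unit at a time; passing from
  \<open>t + 1\<close> to \<open>t\<close> costs a factor \<open>\<bar>t\<bar> + 1\<close>.\<close>

lemma bounded_right_rGamma_size: "bounded_right rGamma_size"
proof -
  have ex: "\<exists>B. \<forall>t\<ge>1 - real N. rGamma_size t \<le> B" for N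
  proof (induction N)
    case 0
    obtain B where "\<And>t n. t \<ge> 1 \<Longrightarrow> rGamma_size (t + real n) \<le> B * 2 ^ n / fact n"
      using rGamma_size_decay by metis
    from this[of _ 0] show ?case by auto
  next
    case (Suc N)
    then obtain B where B: "\<And>t. t \<ge> 1 - real N \<Longrightarrow> rGamma_size t \<le> B" by auto
    have "rGamma_size t \<le> (real N + 2) * B" if t: "t \<ge> 1 - real (Suc N)" for t
    proof (cases "t \<ge> 1 - real N")
      case True
      have "B \<ge> 0" using B[OF True] rGamma_size_nonneg[of t] by linarith
      then have "B \<le> (real N + 2) * B" by (simp add: mult_le_cancel_right1)
      then show ?thesis using B[OF True] by linarith
    next
      case False
      have t1: "rGamma_size (t + 1) \<le> B" using t by (intro B) auto
      have at: "\<bar>t\<bar> \<le> real N + 1" using t False by auto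
      have "\<bar>rGamma t\<bar> = \<bar>t\<bar> * \<bar>rGamma (t + 1)\<bar>"
        by (metis rGamma_plus1 abs_mult)
      moreover have "\<bar>rGamma' t\<bar> \<le> \<bar>rGamma (t + 1)\<bar> + \<bar>t\<bar> * \<bar>rGamma' (t + 1)\<bar>"
        by (subst rGamma'_plus1) (metis abs_mult abs_triangle_ineq)
      ultimately have "rGamma_size t \<le> (\<bar>t\<bar> + 1) * rGamma_size (t + 1)"
        unfolding rGamma_size_def distrib_left distrib_right
        using abs_ge_zero[of "rGamma' (t + 1)"] by linarith
      also have "\<dots> \<le> (real N + 2) * B"
        using at t1 rGamma_size_nonneg by (intro mult_mono) auto
      finally show ?thesis .
    qed
    then show ?case by auto
  qed
  show ?thesis unfolding bounded_right_def
  proof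
    fix a
    obtain N where "1 - a \<le> real N" using real_arch_simple by blast
    then have "t \<ge> 1 - real N" if "t \<ge> a" for t using that by linarith
    then show "\<exists>B. \<forall>t\<ge>a. \<bar>rGamma_size t\<bar> \<le> B"
      using ex[of N] by (metis abs_of_nonneg rGamma_size_nonneg)
  qed
qed

lemma bounded_right_rGamma: "bounded_right rGamma"
  and bounded_right_rGamma': "bounded_right rGamma'"
proof -
  have "\<bar>rGamma t\<bar> \<le> \<bar>rGamma_size t\<bar>" "\<bar>rGamma' t\<bar> \<le> \<bar>rGamma_size t\<bar>" for t
    by (auto simp: rGamma_size_def)
  then show "bounded_right rGamma" "bounded_right rGamma'"
    using bounded_right_rGamma_size unfolding bounded_right_def by (meson order_trans)+
qed

section \<open>Power series in the argument and derivatives in the order\<close>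

text \<open>The coefficient function is a parameter so that \<open>rGamma\<close> (for
  \<open>J\<close>) and \<open>rGamma'\<close> (for the derivative in the order) share one theory.
  With the power \<open>(x / 2) powr p\<close> split off, the series is entire in
  \<open>z = x^2 / 4\<close>.\<close>

definition bessel_ser :: "(real \<Rightarrow> real) \<Rightarrow> real \<Rightarrow> real \<Rightarrow> real" where
  "bessel_ser r p z = (\<Sum>m. (-1) ^ m * r (p + real m + 1) / fact m * z ^ m)"

lemma summable_pow_fact: "summable (\<lambda>m. B * \<bar>z\<bar> ^ m / fact m :: real)"
  using summable_mult[OF summable_exp_generic[of "\<bar>z\<bar>"], of B] by (simp add: field_simps)

lemma bessel_ser_term_bound:
  fixes r :: "real \<Rightarrow> real" and p z :: real
  assumes "\<bar>r (p + real m + 1)\<bar> \<le> B"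
  shows "\<bar>(-1) ^ m * r (p + real m + 1) / fact m * z ^ m\<bar> \<le> B * \<bar>z\<bar> ^ m / fact m"
proof -
  have "\<bar>(-1) ^ m * r (p + real m + 1) / fact m * z ^ m\<bar> = \<bar>r (p + real m + 1)\<bar> * \<bar>z\<bar> ^ m / fact m"
    by (simp add: abs_mult power_abs abs_divide)
  also have "\<dots> \<le> B * \<bar>z\<bar> ^ m / fact m"
    using assms by (intro divide_right_mono mult_right_mono) auto
  finally show ?thesis .
qed

lemma summable_bessel_ser:
  assumes "bounded_right r"
  shows "summable (\<lambda>m. (-1) ^ m * r (p + real m + 1) / fact m * z ^ m)"
proof -
  obtain B where B: "\<And>t. t \<ge> p + 1 \<Longrightarrow> \<bar>r t\<bar> \<le> B"
    using bounded_rightE[OF assms, of "p + 1"] by blast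
  show ?thesis
    by (rule summable_comparison_test'[OF summable_pow_fact[of B z]])
      (use B in \<open>auto simp del: times_divide_eq_left times_divide_eq_right intro!: bessel_ser_term_bound\<close>)
qed

lemma has_field_derivative_bessel_ser:
  assumes "bounded_right r"
  shows "(bessel_ser r p has_field_derivative - bessel_ser r (p + 1) z) (at z)"
proof -
  let ?c = "\<lambda>m. (-1) ^ m * r (p + real m + 1) / fact m"
  have "((\<lambda>z. \<Sum>m. ?c m * z ^ m) has_field_derivative (\<Sum>m. diffs ?c m * z ^ m)) (at z)"
    by (intro termdiffs_strong_converges_everywhere summable_bessel_ser[OF assms])
  moreover have "(\<Sum>m. diffs ?c m * z ^ m) = - bessel_ser r (p + 1) z"
  proof -
    have "diffs ?c m = - ((-1) ^ m * r (p + 1 + real m + 1) / fact m)" for m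
    proof -
      have "r (p + real (Suc m) + 1) = r (p + 1 + real m + 1)" by (simp add: add_ac)
      then show ?thesis
        by (simp only: diffs_def fact_Suc power_Suc) (simp add: field_simps del: of_nat_Suc)
    qed
    then show ?thesis unfolding bessel_ser_def
      by (simp only: minus_mult_left[symmetric] suminf_minus[OF summable_bessel_ser[OF assms]])
  qed
  ultimately show ?thesis by (simp add: bessel_ser_def[abs_def])
qed

text \<open>The functional equation produces the weight \<open>p + m\<close>; the part with
  \<open>m\<close> shifts the summation index and becomes the series of order \<open>p + 1\<close>.
  The source \<open>q\<close> is 0 for \<open>rGamma\<close> and \<open>rGamma\<close> for
  \<open>rGamma'\<close>, hence the inhomogeneous recurrence for derivatives in the order.\<close>

lemma bessel_ser_recurrence:
  assumes r: "bounded_right r" and q: "bounded_right q"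
    and rq: "\<And>t. r t = q (t + 1) + t * r (t + 1)"
  shows "bessel_ser r (p - 1) z = p * bessel_ser r p z - z * bessel_ser r (p + 1) z + bessel_ser q p z"
proof -
  let ?c = "\<lambda>m. (-1) ^ m * r (p + real m + 1) / fact m * z ^ m"
  let ?d = "\<lambda>m. (-1) ^ m * q (p + real m + 1) / fact m * z ^ m"
  have mc: "summable (\<lambda>m. real m * ?c m)"  and mc2: "(\<Sum>m. real m * ?c m) = - z * bessel_ser r (p + 1) z"
  proof -
    let ?e = "\<lambda>m. - z * ((-1) ^ m * r (p + 1 + real m + 1) / fact m * z ^ m)"
    have e: "?e sums (- z * bessel_ser r (p + 1) z)"
      unfolding bessel_ser_def
      by (intro sums_mult summable_sums summable_bessel_ser r)
    have "?e m = real (Suc m) * ?c (Suc m)" for m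
    proof -
      have "r (p + real (Suc m) + 1) = r (p + 1 + real m + 1)" by (simp add: add_ac)
      then show ?thesis
        by (simp only: fact_Suc power_Suc) (simp add: field_simps del: of_nat_Suc)
    qed
    with e have "(\<lambda>m. real (Suc m) * ?c (Suc m)) sums (- z * bessel_ser r (p + 1) z)"
      by (simp only:)
    then have "(\<lambda>m. real m * ?c m) sums (- z * bessel_ser r (p + 1) z)"
      by (subst (asm) sums_Suc_iff) simp
    then show "summable (\<lambda>m. real m * ?c m)" "(\<Sum>m. real m * ?c m) = - z * bessel_ser r (p + 1) z"
      by (auto simp: sums_iff)
  qed
  have "bessel_ser r (p - 1) z = (\<Sum>m. (p * ?c m + real m * ?c m) + ?d m)"
    unfolding bessel_ser_def
  proof (intro suminf_cong)
    fix m
    have "r (p - 1 + real m + 1) = q (p + real m + 1) + (p + real m) * r (p + real m + 1)"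
      using rq[of "p + real m"] by simp
    then show "(-1) ^ m * r (p - 1 + real m + 1) / fact m * z ^ m = (p * ?c m + real m * ?c m) + ?d m"
      by (simp add: field_simps)
  qed
  also have "\<dots> = p * bessel_ser r p z + (- z * bessel_ser r (p + 1) z) + bessel_ser q p z"
  proof (rule sums_unique[symmetric], intro sums_add sums_mult)
    show "?c sums bessel_ser r p z" "?d sums bessel_ser q p z"
      unfolding bessel_ser_def by (intro summable_sums summable_bessel_ser r q)+
    show "(\<lambda>m. real m * ?c m) sums (- z * bessel_ser r (p + 1) z)"
      using mc mc2 by (simp only: sums_iff)
  qed
  finally show ?thesis by simp
qed

lemma has_field_derivative_bessel_ser_order:
  "((\<lambda>p. bessel_ser rGamma p z) has_field_derivative bessel_ser rGamma' p z) (at p)"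
proof -
  let ?f = "\<lambda>m p. (-1) ^ m * rGamma (p + real m + 1) / fact m * z ^ m"
  let ?f' = "\<lambda>m p. (-1) ^ m * rGamma' (p + real m + 1) / fact m * z ^ m"
  \<comment> \<open>For orders \<open>q\<close> within distance 1 of \<open>p\<close>, all sample
    points \<open>q + m + 1\<close> lie to the right of \<open>p\<close>, so one \<open>B\<close>
    majorises the differentiated series on the whole ball.\<close>
  obtain B where B: "\<And>t. t \<ge> p \<Longrightarrow> \<bar>rGamma' t\<bar> \<le> B"
    using bounded_rightE[OF bounded_right_rGamma', of p] by blast
  have "((\<lambda>p. \<Sum>m. ?f m p) has_field_derivative (\<Sum>m. ?f' m p)) (at p)"
  proof (rule has_field_derivative_series'(2)[where S = "ball p 1" and ?x0.0 = p])
    show "(?f m has_field_derivative ?f' m q) (at q within ball p 1)" for m q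
    proof -
      have "((\<lambda>q. (-1) ^ m / fact m * z ^ m * rGamma (q + (real m + 1))) has_field_derivative
          (-1) ^ m / fact m * z ^ m * rGamma' (q + (real m + 1))) (at q within ball p 1)"
        by (intro DERIV_cmult has_field_derivative_rGamma_shift)
      then show ?thesis by (simp add: add_ac mult_ac)
    qed
    show "uniformly_convergent_on (ball p 1) (\<lambda>n q. \<Sum>i<n. ?f' i q)"
    proof (rule Weierstrass_m_test'[OF _ summable_pow_fact[of B z]])
      fix m q assume "q \<in> ball p 1"
      then have "q + real m + 1 \<ge> p" by (auto simp: dist_real_def)
      then show "norm (?f' m q) \<le> B * \<bar>z\<bar> ^ m / fact m"
        using bessel_ser_term_bound[OF B] by simp
    qed
    show "summable (\<lambda>m. ?f m p)"
      by (rule summable_bessel_ser[OF bounded_right_rGamma])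
  qed auto
  then show ?thesis by (simp add: bessel_ser_def)
qed

section \<open>Bessel functions of the first kind and their derivatives in the order\<close>

lemma bessel_J_eq:
  assumes "x > 0"
  shows "bessel_J p x = (x / 2) powr p * bessel_ser rGamma p (x\<^sup>2 / 4)"
proof -
  have *: "(x / 2) powr (2 * real m + p) = (x / 2) powr p * (x\<^sup>2 / 4) ^ m" for m
  proof -
    have "(x / 2) powr (2 * real m) = (x / 2) ^ (2 * m)"
      using assms by (metis divide_pos_pos of_nat_mult of_nat_numeral powr_realpow zero_less_numeral)
    also have "\<dots> = (x\<^sup>2 / 4) ^ m"
      by (simp add: power_mult power_divide)
    finally show ?thesis using assms by (simp add: powr_add)
  qed
  show ?thesis
    unfolding bessel_J_def bessel_ser_def *
    using suminf_mult[OF summable_bessel_ser[OF bounded_right_rGamma, of p "x\<^sup>2 / 4"], of "(x / 2) powr p"]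
    by (simp add: mult_ac)
qed

text \<open>The derivative in the order in closed form: the logarithm comes from
  \<open>(x / 2) powr p\<close>, the second series from the coefficients. It is set up for every
  real order, so that recurrences and derivatives in \<open>x\<close> can be read off from the
  series.\<close>

definition bessel_Jh :: "real \<Rightarrow> real \<Rightarrow> real" where
  "bessel_Jh p x = ln (x / 2) * bessel_J p x + (x / 2) powr p * bessel_ser rGamma' p (x\<^sup>2 / 4)"

lemma has_field_derivative_bessel_J_order:
  assumes "x > 0"
  shows "((\<lambda>p. bessel_J p x) has_field_derivative bessel_Jh p x) (at p)"
proof -
  have "((\<lambda>p. (x / 2) powr p * bessel_ser rGamma p (x\<^sup>2 / 4)) has_field_derivative bessel_Jh p x) (at p)"
    unfolding bessel_Jh_def bessel_J_eq[OF assms] using assms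
    by (auto intro!: derivative_eq_intros has_field_derivative_bessel_ser_order)
  then show ?thesis by (simp add: bessel_J_eq[OF assms])
qed

lemma bessel_J_hat_eq: "x > 0 \<Longrightarrow> bessel_J_hat k x = bessel_Jh (of_int k) x"
  unfolding bessel_J_hat_def by (intro DERIV_imp_deriv has_field_derivative_bessel_J_order)

lemma powr_half_deriv:
  fixes x :: real
  assumes "x > 0"
  shows "((\<lambda>x. (x / 2) powr p) has_field_derivative p / x * (x / 2) powr p) (at x)"
  using assms by (auto intro!: derivative_eq_intros simp: powr_diff field_simps)

lemma powr_half_plus1: "x > 0 \<Longrightarrow> (x / 2) powr (p + 1) = x / 2 * (x / 2) powr p" for x :: real
  by (simp add: powr_add)

lemma powr_half_minus1: "x > 0 \<Longrightarrow> (x / 2) powr (p - 1) = 2 / x * (x / 2) powr p" for x :: real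
  by (simp add: powr_diff)

lemma bessel_ser_sq_deriv:
  assumes "bounded_right r"
  shows "((\<lambda>x. bessel_ser r p (x\<^sup>2 / 4)) has_field_derivative - (x / 2) * bessel_ser r (p + 1) (x\<^sup>2 / 4)) (at x)"
  by (rule DERIV_chain2[OF has_field_derivative_bessel_ser[OF assms], THEN DERIV_cong])
    (auto intro!: derivative_eq_intros)

lemma has_field_derivative_bessel_J:
  assumes x: "x > 0"
  shows "(bessel_J p has_field_derivative p / x * bessel_J p x - bessel_J (p + 1) x) (at x)"
proof (rule has_field_derivative_transform_within_open[where S = "{0<..}"])
  show "((\<lambda>x. (x / 2) powr p * bessel_ser rGamma p (x\<^sup>2 / 4)) has_field_derivative
      p / x * bessel_J p x - bessel_J (p + 1) x) (at x)"
    by (rule DERIV_mult'[OF powr_half_deriv[OF x] bessel_ser_sq_deriv[OF bounded_right_rGamma], THEN DERIV_cong])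
      (unfold bessel_J_eq[OF x] powr_half_plus1[OF x], simp add: field_simps)
qed (use x in \<open>auto simp: bessel_J_eq\<close>)

lemma has_field_derivative_bessel_Jh:
  assumes x: "x > 0"
  shows "(bessel_Jh p has_field_derivative
    p / x * bessel_Jh p x + bessel_J p x / x - bessel_Jh (p + 1) x) (at x)"
proof -
  have 1: "((\<lambda>x. ln (x / 2) * bessel_J p x) has_field_derivative
      (bessel_J p x / x + ln (x / 2) * (p / x * bessel_J p x - bessel_J (p + 1) x))) (at x)"
    using x by (auto intro!: derivative_eq_intros has_field_derivative_bessel_J)
  have 2: "((\<lambda>x. (x / 2) powr p * bessel_ser rGamma' p (x\<^sup>2 / 4)) has_field_derivative
      p / x * ((x / 2) powr p * bessel_ser rGamma' p (x\<^sup>2 / 4))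
      - (x / 2) powr (p + 1) * bessel_ser rGamma' (p + 1) (x\<^sup>2 / 4)) (at x)"
    by (rule DERIV_mult'[OF powr_half_deriv[OF x] bessel_ser_sq_deriv[OF bounded_right_rGamma'], THEN DERIV_cong])
      (unfold powr_half_plus1[OF x], simp add: field_simps)
  show ?thesis unfolding bessel_Jh_def[abs_def]
    by (rule DERIV_add[OF 1 2, THEN DERIV_cong]) (simp add: algebra_simps)
qed

lemma bessel_J_recurrence:
  assumes x: "x > 0"
  shows "bessel_J (p - 1) x = 2 * p / x * bessel_J p x - bessel_J (p + 1) x"
proof -
  have "bounded_right (\<lambda>_. 0)" by (auto simp: bounded_right_def)
  from bessel_ser_recurrence[OF bounded_right_rGamma this, of p "x\<^sup>2 / 4"]
  have *: "bessel_ser rGamma (p - 1) (x\<^sup>2 / 4) =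
      p * bessel_ser rGamma p (x\<^sup>2 / 4) - x\<^sup>2 / 4 * bessel_ser rGamma (p + 1) (x\<^sup>2 / 4)"
    by (simp add: rGamma_plus1 bessel_ser_def[of "\<lambda>_. 0"])
  show ?thesis
    unfolding bessel_J_eq[OF x] powr_half_plus1[OF x] powr_half_minus1[OF x] *
    using x by (simp add: field_simps power2_eq_square)
qed

lemma bessel_Jh_recurrence:
  assumes x: "x > 0"
  shows "bessel_Jh (p - 1) x = 2 * p / x * bessel_Jh p x - bessel_Jh (p + 1) x + 2 / x * bessel_J p x"
proof -
  have *: "bessel_ser rGamma' (p - 1) (x\<^sup>2 / 4) = p * bessel_ser rGamma' p (x\<^sup>2 / 4)
      - x\<^sup>2 / 4 * bessel_ser rGamma' (p + 1) (x\<^sup>2 / 4) + bessel_ser rGamma p (x\<^sup>2 / 4)"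
    by (rule bessel_ser_recurrence[OF bounded_right_rGamma' bounded_right_rGamma rGamma'_plus1])
  have "(x / 2) powr (p - 1) * bessel_ser rGamma' (p - 1) (x\<^sup>2 / 4) =
      2 * p / x * ((x / 2) powr p * bessel_ser rGamma' p (x\<^sup>2 / 4))
      - (x / 2) powr (p + 1) * bessel_ser rGamma' (p + 1) (x\<^sup>2 / 4) + 2 / x * bessel_J p x"
    unfolding * bessel_J_eq[OF x] powr_half_plus1[OF x] powr_half_minus1[OF x]
    using x by (simp add: field_simps power2_eq_square)
  then show ?thesis unfolding bessel_Jh_def bessel_J_recurrence[OF x, of p]
    by (simp add: algebra_simps)
qed

text \<open>Both sides obey the same three-term recurrence in \<open>n\<close>; the recurrence at
  order 0, where the middle term drops out, is the case \<open>n = 1\<close>.\<close>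

lemma bessel_J_int_minus:
  assumes x: "x > 0"
  shows "bessel_J_int (- int n) x = (-1) ^ n * bessel_J_int (int n) x"
proof (induction n rule: induct_nat_012)
  case 0
  show ?case by simp
next
  case 1
  show ?case using bessel_J_recurrence[OF x, of 0] by simp
next
  case (ge2 n)
  have r1: "bessel_J (- real n - 2) x = 2 * (- 1 - real n) / x * bessel_J (- 1 - real n) x - bessel_J (- real n) x"
    using bessel_J_recurrence[OF x, of "- 1 - real n"] by (simp add: algebra_simps)
  have r2: "bessel_J (real n + 2) x = 2 * (real n + 1) / x * bessel_J (real n + 1) x - bessel_J (real n) x"
    using bessel_J_recurrence[OF x, of "real n + 1"] by (simp add: algebra_simps)
  have ih: "bessel_J (- 1 - real n) x = -((-1) ^ n * bessel_J (real n + 1) x)"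
    "bessel_J (- real n) x = (-1) ^ n * bessel_J (real n) x"
    using ge2 by (simp_all add: algebra_simps)
  have "bessel_J (- real n - 2) x = (-1) ^ n * bessel_J (real n + 2) x"
    unfolding r1 r2 ih by (simp add: algebra_simps)
  then show ?case by (simp add: algebra_simps)
qed

section \<open>Decay in the order\<close>

lemma bessel_ser_decay:
  obtains B where "B \<ge> 0"
    "\<And>n z. \<bar>bessel_ser rGamma (real n) z\<bar> \<le> B * 2 ^ n / fact n * exp (2 * \<bar>z\<bar>)"
    "\<And>n z. \<bar>bessel_ser rGamma' (real n) z\<bar> \<le> B * 2 ^ n / fact n * exp (2 * \<bar>z\<bar>)"
proof -
  obtain B where B0: "B \<ge> 0" and B: "\<And>t n. t \<ge> 1 \<Longrightarrow> rGamma_size (t + real n) \<le> B * 2 ^ n / fact n"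
    using rGamma_size_decay by blast
  have *: "\<bar>bessel_ser r (real n) z\<bar> \<le> B * 2 ^ n / fact n * exp (2 * \<bar>z\<bar>)"
    if r: "\<And>t. \<bar>r t\<bar> \<le> rGamma_size t" for r n z
  proof -
    let ?g = "\<lambda>m. B * 2 ^ n / fact n * ((2 * \<bar>z\<bar>) ^ m /\<^sub>R fact m)"
    have g: "summable ?g" by (intro summable_mult summable_exp_generic)
    have "\<bar>(-1) ^ m * r (real n + real m + 1) / fact m * z ^ m\<bar> \<le> ?g m" for m
    proof -
      have "\<bar>r (real n + real m + 1)\<bar> \<le> B * 2 ^ (n + m) / fact (n + m)"
        using r[of "real n + real m + 1"] B[of 1 "n + m"] by (simp add: add_ac)
      \<comment> \<open>Only \<open>fact n\<close> is kept: the series already has its own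
        \<open>fact m\<close>, which together with \<open>2 ^ m\<close> sums to
        \<open>exp (2 * \<bar>z\<bar>)\<close>.\<close>
      also have "\<dots> \<le> B * 2 ^ (n + m) / fact n"
        using B0 by (intro divide_left_mono) (auto simp: fact_mono)
      finally have "\<bar>r (real n + real m + 1)\<bar> \<le> B * 2 ^ (n + m) / fact n" .
      from bessel_ser_term_bound[of r "real n" m, OF this, of z]
      show ?thesis by (simp add: power_add power_mult_distrib field_simps)
    qed
    then have "norm (bessel_ser r (real n) z) \<le> suminf ?g"
      unfolding bessel_ser_def by (intro norm_suminf_le[OF _ g]) (auto simp del: abs_mult)
    also have "suminf ?g = B * 2 ^ n / fact n * exp (2 * \<bar>z\<bar>)"
      unfolding exp_def by (rule suminf_mult[OF summable_exp_generic])
    finally show ?thesis by simp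
  qed
  show thesis
    by (rule that[OF B0 * *]) (auto simp: rGamma_size_def)
qed

text \<open>Factorial decay is weakened to a geometric rate, uniform on the interval, which is still
  enough against the linear weight \<open>n\<close> of the series. A positive left end keeps the
  logarithm in \<open>bessel_Jh\<close> bounded.\<close>

lemma bessel_decay:
  assumes a: "0 < a"
  obtains K where "K \<ge> 0"
    "\<And>n x. x \<in> {a..b} \<Longrightarrow> \<bar>bessel_J_int (int n) x\<bar> \<le> K / 2 ^ n"
    "\<And>n x. x \<in> {a..b} \<Longrightarrow> \<bar>bessel_J_hat (int n) x\<bar> \<le> K / 2 ^ n"
proof -
  obtain B where B0: "B \<ge> 0" and
    B: "\<And>n z. \<bar>bessel_ser rGamma (real n) z\<bar> \<le> B * 2 ^ n / fact n * exp (2 * \<bar>z\<bar>)"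
    "\<And>n z. \<bar>bessel_ser rGamma' (real n) z\<bar> \<le> B * 2 ^ n / fact n * exp (2 * \<bar>z\<bar>)"
    using bessel_ser_decay by blast
  define K where "K = B * exp (b\<^sup>2 / 2) * exp (2 * b)"
  define c where "c = \<bar>ln (a / 2)\<bar> + \<bar>ln (b / 2)\<bar>"
  have K0: "K \<ge> 0" using B0 by (simp add: K_def)
  have c0: "c \<ge> 0" by (simp add: c_def)
  have *: "\<bar>(x / 2) powr (real n) * y\<bar> \<le> K / 2 ^ n"
    if x: "x \<in> {a..b}" and y: "\<bar>y\<bar> \<le> B * 2 ^ n / fact n * exp (2 * \<bar>x\<^sup>2 / 4\<bar>)" for x y n
  proof -
    have x0: "x > 0" using x a by auto
    have "\<bar>(x / 2) powr (real n) * y\<bar> = (x / 2) ^ n * \<bar>y\<bar>"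
      using x0 by (simp add: abs_mult powr_realpow)
    also have "\<dots> \<le> (b / 2) ^ n * (B * 2 ^ n / fact n * exp (b\<^sup>2 / 2))"
    proof (intro mult_mono power_mono order_trans[OF y] mult_left_mono)
      have "x\<^sup>2 \<le> b\<^sup>2" using x x0 by (intro power_mono) auto
      then show "exp (2 * \<bar>x\<^sup>2 / 4\<bar>) \<le> exp (b\<^sup>2 / 2)" by simp
    qed (use x x0 B0 in auto)
    \<comment> \<open>Writing \<open>b ^ n\<close> as \<open>(2 * b) ^ n / 2 ^ n\<close> sets the
      geometric factor aside; the rest is a single term of the series of
      \<open>exp (2 * b)\<close>.\<close>
    also have "\<dots> = B * exp (b\<^sup>2 / 2) * ((2 * b) ^ n / fact n) / 2 ^ n"
      by (simp add: power_divide power_mult_distrib)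
    also have "\<dots> \<le> B * exp (b\<^sup>2 / 2) * exp (2 * b) / 2 ^ n"
    proof (intro divide_right_mono mult_left_mono)
      have "(\<Sum>i\<in>{n}. (2 * b) ^ i /\<^sub>R fact i) \<le> exp (2 * b)"
        unfolding exp_def using x x0 by (intro sum_le_suminf[OF summable_exp_generic]) auto
      then show "(2 * b) ^ n / fact n \<le> exp (2 * b)" by (simp add: field_simps)
    qed (use B0 in auto)
    finally show ?thesis by (simp add: K_def)
  qed
  show thesis
  proof (rule that[of "(c + 1) * K"])
    show "(c + 1) * K \<ge> 0" using K0 c0 by simp
    fix n x assume x: "x \<in> {a..b}"
    then have x0: "x > 0" using a by auto
    have J: "\<bar>bessel_J (real n) x\<bar> \<le> K / 2 ^ n"
      unfolding bessel_J_eq[OF x0] by (rule *[OF x B(1)])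
    also have "\<dots> \<le> (c + 1) * K / 2 ^ n"
      using K0 c0 by (intro divide_right_mono) (auto simp: algebra_simps)
    finally show "\<bar>bessel_J_int (int n) x\<bar> \<le> (c + 1) * K / 2 ^ n" by simp
    have "ln (a / 2) \<le> ln (x / 2)" "ln (x / 2) \<le> ln (b / 2)"
      using x a by auto
    then have ln: "\<bar>ln (x / 2)\<bar> \<le> c" unfolding c_def by linarith
    have "\<bar>bessel_Jh (real n) x\<bar> \<le> \<bar>ln (x / 2)\<bar> * \<bar>bessel_J (real n) x\<bar> + K / 2 ^ n"
      unfolding bessel_Jh_def using *[OF x B(2)]
      by (intro order_trans[OF abs_triangle_ineq] add_mono) (auto simp: abs_mult)
    also have "\<dots> \<le> c * (K / 2 ^ n) + K / 2 ^ n"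
      using ln J c0 by (intro add_mono mult_mono) auto
    finally show "\<bar>bessel_J_hat (int n) x\<bar> \<le> (c + 1) * K / 2 ^ n"
      by (simp add: bessel_J_hat_eq[OF x0] algebra_simps add_divide_distrib)
  qed
qed

lemma bessel_J_minus_of_int:
  assumes "x > 0"
  shows "bessel_J_int (- k) x = (-1) powi k * bessel_J_int k x"
proof (cases "k \<ge> 0")
  case True
  then show ?thesis using bessel_J_int_minus[OF assms, of "nat k"] by (simp add: power_int_def)
next
  case False
  then have "bessel_J_int k x = (-1) ^ nat (-k) * bessel_J_int (- k) x"
    using bessel_J_int_minus[OF assms, of "nat (- k)"] by simp
  moreover have "(-1) powi k = ((-1) ^ nat (-k) :: real)"
    using False by (simp add: power_int_def)
  ultimately show ?thesis
    by (simp add: mult.assoc[symmetric] flip: power_add)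
qed

section \<open>Integer orders\<close>

lemma minus_one_powi: "(-1::real) powi k = (if even k then 1 else -1)"
  by (cases "k \<ge> 0") (auto simp: power_int_def even_nat_iff)

text \<open>L'Hospital in the order: numerator and denominator both vanish at the integer
  \<open>k\<close>, so the limit is the quotient of their derivatives there. All later facts about
  \<open>bessel_Y_int\<close> come from this formula.\<close>

lemma bessel_Y_int_eq:
  assumes x: "x > 0"
  shows "bessel_Y_int k x = (bessel_J_hat k x + (-1) powi k * bessel_J_hat (- k) x) / pi"
proof -
  let ?s = "(-1::real) powi k"
  define N where "N = (\<lambda>q. bessel_J q x * cos (q * pi) - bessel_J (- q) x)"
  define D where "D = (\<lambda>q::real. sin (q * pi))"
  have cos: "cos (of_int k * pi) = ?s"
    by (simp add: minus_one_powi cos_npi_int mult.commute)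
  have sin: "sin (of_int k * pi) = 0"
    using sin_npi_int[of k] by (simp add: mult.commute)
  have ss: "?s * ?s = 1" by (simp add: minus_one_powi)
  have "((\<lambda>q. bessel_J (- q) x) has_field_derivative bessel_Jh (- of_int k) x * -1) (at (of_int k))"
    by (rule DERIV_chain2[OF has_field_derivative_bessel_J_order[OF x]]) (auto intro!: derivative_eq_intros)
  then have N: "(N has_field_derivative ?s * bessel_J_hat k x + bessel_J_hat (- k) x) (at (of_int k))"
    unfolding N_def bessel_J_hat_eq[OF x]
    by (auto intro!: derivative_eq_intros has_field_derivative_bessel_J_order[OF x] simp: cos sin)
  have D: "(D has_field_derivative pi * ?s) (at (of_int k))"
    unfolding D_def by (auto intro!: derivative_eq_intros simp: cos)
  have N0: "N (of_int k) = 0"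
    using bessel_J_minus_of_int[OF x, of k] by (simp add: N_def cos)
  have D0: "D (of_int k) = 0" by (simp add: D_def sin)
  have "((\<lambda>q. ((N q - N (of_int k)) / (q - of_int k)) / ((D q - D (of_int k)) / (q - of_int k)))
      \<longlongrightarrow> (?s * bessel_J_hat k x + bessel_J_hat (- k) x) / (pi * ?s)) (at (of_int k))"
    using N D unfolding has_field_derivative_iff
    by (intro tendsto_divide) (auto simp: minus_one_powi)
  then have "((\<lambda>q. N q / D q) \<longlongrightarrow> (?s * bessel_J_hat k x + bessel_J_hat (- k) x) / (pi * ?s)) (at (of_int k))"
    by (rule Lim_transform_eventually) (auto simp: eventually_at_filter N0 D0)
  moreover have "(?s * bessel_J_hat k x + bessel_J_hat (- k) x) / (pi * ?s)
      = (bessel_J_hat k x + ?s * bessel_J_hat (- k) x) / pi"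
    by (simp add: minus_one_powi field_simps)
  ultimately have "((\<lambda>q. N q / D q) \<longlongrightarrow> (bessel_J_hat k x + ?s * bessel_J_hat (- k) x) / pi) (at (of_int k))"
    by simp
  then have "Lim (at (of_int k)) (\<lambda>q. N q / D q) = (bessel_J_hat k x + ?s * bessel_J_hat (- k) x) / pi"
    by (intro tendsto_Lim) auto
  then show ?thesis by (simp add: bessel_Y_def N_def D_def)
qed

lemma bessel_J_int_recurrence:
  "x > 0 \<Longrightarrow> bessel_J_int (k - 1) x = 2 * of_int k / x * bessel_J_int k x - bessel_J_int (k + 1) x"
  using bessel_J_recurrence[of x "of_int k"] by simp

lemma bessel_J_hat_recurrence:
  "x > 0 \<Longrightarrow> bessel_J_hat (k - 1) x =
    2 * of_int k / x * bessel_J_hat k x - bessel_J_hat (k + 1) x + 2 / x * bessel_J_int k x"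
  using bessel_Jh_recurrence[of x "of_int k"] by (simp add: bessel_J_hat_eq)

lemma has_field_derivative_bessel_J_int:
  "x > 0 \<Longrightarrow> (bessel_J_int k has_field_derivative
    of_int k / x * bessel_J_int k x - bessel_J_int (k + 1) x) (at x)"
  using has_field_derivative_bessel_J[of x "of_int k"] by simp

lemma has_field_derivative_bessel_J_hat:
  assumes x: "x > 0"
  shows "(bessel_J_hat k has_field_derivative
    of_int k / x * bessel_J_hat k x + bessel_J_int k x / x - bessel_J_hat (k + 1) x) (at x)"
proof (rule has_field_derivative_transform_within_open[where S = "{0<..}"])
  show "(bessel_Jh (of_int k) has_field_derivative
    of_int k / x * bessel_J_hat k x + bessel_J_int k x / x - bessel_J_hat (k + 1) x) (at x)"
    using has_field_derivative_bessel_Jh[OF x, of "of_int k"] by (simp add: bessel_J_hat_eq[OF x])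
qed (use x in \<open>auto simp: bessel_J_hat_eq\<close>)

lemma bessel_Y_int_minus:
  assumes "x > 0"
  shows "bessel_Y_int (- k) x = (-1) powi k * bessel_Y_int k x"
  unfolding bessel_Y_int_eq[OF assms] by (cases "even k") (simp_all add: minus_one_powi minus_divide_left)

text \<open>The source terms \<open>2 / x * J\<close> in the recurrences at \<open>k\<close> and
  \<open>- k\<close> cancel, because \<open>J\<close> of order \<open>- k\<close> is
  \<open>(-1) powi k\<close> times \<open>J\<close> of order \<open>k\<close>. So \<open>Y\<close>
  satisfies the homogeneous recurrence.\<close>

lemma bessel_Y_int_recurrence:
  assumes x: "x > 0"
  shows "bessel_Y_int (k - 1) x = 2 * of_int k / x * bessel_Y_int k x - bessel_Y_int (k + 1) x"
proof -
  have 1: "bessel_J_hat (- k - 1) x =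
      - 2 * of_int k / x * bessel_J_hat (- k) x - bessel_J_hat (- k + 1) x + 2 / x * bessel_J_int (- k) x"
    using bessel_J_hat_recurrence[OF x, of "- k"] by simp
  have m: "- (k - 1) = - k + 1" "- (k + 1) = - k - 1" by auto
  have s: "(-1::real) powi (k - 1) = - ((-1) powi k)" "(-1::real) powi (k + 1) = - ((-1) powi k)"
    "(-1::real) powi k * (-1) powi k = 1"
    by (auto simp: minus_one_powi)
  have "bessel_J_hat (k - 1) x - (-1) powi k * bessel_J_hat (- k + 1) x =
      2 * of_int k / x * (bessel_J_hat k x + (-1) powi k * bessel_J_hat (- k) x)
      - (bessel_J_hat (k + 1) x - (-1) powi k * bessel_J_hat (- k - 1) x)
      + 2 / x * bessel_J_int k x * (1 - (-1) powi k * (-1) powi k)"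
    unfolding 1 bessel_J_hat_recurrence[OF x] bessel_J_minus_of_int[OF x] by (simp add: algebra_simps)
  from arg_cong[OF this, of "\<lambda>t. t / pi"] show ?thesis
    unfolding bessel_Y_int_eq[OF x] m s(1,2)
    by (simp add: s(3) diff_divide_distrib add_divide_distrib distrib_left)
qed

text \<open>Here too the extra terms \<open>J / x\<close> cancel: one from each of the two
  derivatives, against the doubled source in the recurrence at \<open>- k\<close>.\<close>

lemma has_field_derivative_bessel_Y_int:
  assumes x: "x > 0"
  shows "(bessel_Y_int k has_field_derivative
    of_int k / x * bessel_Y_int k x - bessel_Y_int (k + 1) x) (at x)"
proof (rule has_field_derivative_transform_within_open[where S = "{0<..}"])
  let ?f = "\<lambda>x. (bessel_J_hat k x + (-1) powi k * bessel_J_hat (- k) x) / pi"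
  have s: "(-1::real) powi (k + 1) = - ((-1) powi k)" "(-1::real) powi k * (-1) powi k = 1"
    by (auto simp: minus_one_powi)
  have m: "- (k + 1) = - k - 1" by auto
  have *: "bessel_J_hat (- k + 1) x = - 2 * of_int k / x * bessel_J_hat (- k) x - bessel_J_hat (- k - 1) x
      + 2 / x * ((-1) powi k * bessel_J_int k x)"
    using bessel_J_hat_recurrence[OF x, of "- k"] bessel_J_minus_of_int[OF x, of k] by simp
  have "(?f has_field_derivative
      ((of_int k / x * bessel_J_hat k x + bessel_J_int k x / x - bessel_J_hat (k + 1) x)
        + (-1) powi k * (of_int (- k) / x * bessel_J_hat (- k) x + (-1) powi k * bessel_J_int k x / x
          - bessel_J_hat (- k + 1) x)) / pi) (at x)"
    using has_field_derivative_bessel_J_hat[OF x, of "- k"] unfolding bessel_J_minus_of_int[OF x, of k]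
    by (intro DERIV_cdivide DERIV_add DERIV_cmult has_field_derivative_bessel_J_hat[OF x])
  moreover have "((of_int k / x * bessel_J_hat k x + bessel_J_int k x / x - bessel_J_hat (k + 1) x)
        + (-1) powi k * (of_int (- k) / x * bessel_J_hat (- k) x + (-1) powi k * bessel_J_int k x / x
          - bessel_J_hat (- k + 1) x)) / pi
     = of_int k / x * bessel_Y_int k x - bessel_Y_int (k + 1) x
       + (1 - (-1) powi k * (-1) powi k) * bessel_J_int k x / x / pi"
    unfolding bessel_Y_int_eq[OF x] m s(1) * using x by (simp add: field_simps)
  ultimately show "(?f has_field_derivative of_int k / x * bessel_Y_int k x - bessel_Y_int (k + 1) x) (at x)"
    by (simp add: s(2))
qed (use x in \<open>auto simp: bessel_Y_int_eq\<close>)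

section \<open>Telescoping of the series\<close>

text \<open>The derivative of the product of \<open>J\<close> at orders \<open>m\<close> and
  \<open>n\<close> under a simultaneous shift of both orders.\<close>

definition bessel_A :: "int \<Rightarrow> int \<Rightarrow> real \<Rightarrow> real" where
  "bessel_A m n x = bessel_J_hat m x * bessel_J_int n x + bessel_J_int m x * bessel_J_hat n x"

text \<open>Telescoping potential: \<open>x\<^sup>2 (n A(n - v, n)/x)' = V(n) - V(n + 1)\<close>. The last summand comes from
  \<open>J(n) J(n - v)\<close>, which is itself a difference when \<open>v \<noteq> 0\<close>.\<close>
definition bessel_V :: "int \<Rightarrow> int \<Rightarrow> real \<Rightarrow> real" where
  "bessel_V v n x = x / 2 * (of_int (n - 1) * bessel_A (n - v) (n - 1) x + of_int n * bessel_A (n - v - 1) n x)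
     + x / (2 * of_int v) * (bessel_J_int (n - 1) x * bessel_J_int (n - v) x
                             - bessel_J_int n x * bessel_J_int (n - v - 1) x)"

text \<open>Dictionary: \<open>j, jm, jp\<close> are \<open>J\<close> at orders
  \<open>n, n - 1, n + 1\<close>, and \<open>g, gm, gp\<close> are the derivatives in the order;
  \<open>i, im, ip\<close> and \<open>h, hm, hp\<close> are the same at \<open>n - v\<close>.
  Eliminating the lowered orders leaves an identity of rational functions.\<close>

lemma bessel_V_identity:
  fixes x n v :: real
  assumes "x \<noteq> 0" "v \<noteq> 0"
    and jm: "jm = 2 * n / x * j - jp" and im: "im = 2 * (n - v) / x * i - ip"
    and gm: "gm = 2 * n / x * g - gp + 2 / x * j" and hm: "hm = 2 * (n - v) / x * h - hp + 2 / x * i"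
  shows "n * (((n - v) / x * h + i / x - hp) * j + h * (n / x * j - jp)
        + (((n - v) / x * i - ip) * g + i * (n / x * g + j / x - gp))) * x
      - n * (h * j + i * g)
    = (x / 2 * ((n - 1) * (h * jm + i * gm) + n * (hm * j + im * g)) + x / (2 * v) * (jm * i - j * im))
      - (x / 2 * (n * (hp * j + ip * g) + (n + 1) * (h * jp + i * gp)) + x / (2 * v) * (j * ip - jp * i))"
  unfolding jm im gm hm using assms(1,2) by (simp add: field_simps)

lemma has_field_derivative_bessel_A_term:
  assumes x: "x > 0" and v: "v \<noteq> 0"
  shows "((\<lambda>x. of_int n * bessel_A (n - v) n x / x) has_field_derivative
    (bessel_V v n x - bessel_V v (n + 1) x) / x\<^sup>2) (at x)"
proof -
  let ?D = "of_int n * (((of_int n - of_int v) / x * bessel_J_hat (n - v) x + bessel_J_int (n - v) x / x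
          - bessel_J_hat (n - v + 1) x) * bessel_J_int n x
        + bessel_J_hat (n - v) x * (of_int n / x * bessel_J_int n x - bessel_J_int (n + 1) x)
        + (((of_int n - of_int v) / x * bessel_J_int (n - v) x - bessel_J_int (n - v + 1) x) * bessel_J_hat n x
        + bessel_J_int (n - v) x * (of_int n / x * bessel_J_hat n x + bessel_J_int n x / x - bessel_J_hat (n + 1) x)))"
  note d = has_field_derivative_bessel_J_hat[OF x, of "n - v"] has_field_derivative_bessel_J_int[OF x, of n]
    has_field_derivative_bessel_J_int[OF x, of "n - v"] has_field_derivative_bessel_J_hat[OF x, of n]
  have "((\<lambda>x. of_int n * bessel_A (n - v) n x / x) has_field_derivative
      (?D * x - of_int n * bessel_A (n - v) n x) / (x * x)) (at x)"
    unfolding bessel_A_def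
    by (rule derivative_eq_intros refl d | use x in \<open>simp add: algebra_simps\<close>)+
  moreover have "?D * x - of_int n * bessel_A (n - v) n x = bessel_V v n x - bessel_V v (n + 1) x"
  proof -
    have e: "n + 1 - 1 = n" "n + 1 - v = n - v + 1" "n + 1 - v - 1 = n - v"
      "n - v + 1 - 1 = n - v"
      "real_of_int (n + 1) = of_int n + 1" "real_of_int (n - 1) = of_int n - 1" by auto
    show ?thesis
      unfolding bessel_V_def bessel_A_def e
      by (rule bessel_V_identity)
        (use x v bessel_J_int_recurrence[OF x, of "n - v"] bessel_J_hat_recurrence[OF x, of "n - v"]
          bessel_J_int_recurrence[OF x, of n] bessel_J_hat_recurrence[OF x, of n] in \<open>simp_all\<close>)
  qed
  ultimately show ?thesis by (simp add: power2_eq_square)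
qed

lemma summable_of_nat_half_power: "summable (\<lambda>n. c * (real (Suc n) / 2 ^ n))"
proof -
  have "(\<lambda>n. real (Suc n) * (1 / 2) ^ n) sums (1 / (1 - 1 / 2)\<^sup>2)"
    by (rule geometric_deriv_sums) simp
  then show ?thesis by (intro summable_mult) (simp add: sums_iff power_divide)
qed

lemma bessel_A_bound:
  assumes K: "\<And>n. \<bar>bessel_J_int (int n) x\<bar> \<le> K / 2 ^ n" "\<And>n. \<bar>bessel_J_hat (int n) x\<bar> \<le> K / 2 ^ n"
    and m: "0 \<le> m"
  shows "\<bar>bessel_A m (int n) x\<bar> \<le> 2 * K\<^sup>2 / 2 ^ n" "\<bar>bessel_J_int (int n) x * bessel_J_int m x\<bar> \<le> K\<^sup>2 / 2 ^ n"
proof -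
  have K0: "K \<ge> 0" using K(1)[of 0] by (simp add: order_trans[OF abs_ge_zero])
  have "K / 2 ^ nat m \<le> K / 1" using K0 by (intro divide_left_mono) auto
  then have m: "\<bar>bessel_J_int m x\<bar> \<le> K" "\<bar>bessel_J_hat m x\<bar> \<le> K"
    using K(1)[of "nat m"] K(2)[of "nat m"] m by auto
  have *: "\<bar>a * b\<bar> \<le> K\<^sup>2 / 2 ^ n" if "\<bar>a\<bar> \<le> K" "\<bar>b\<bar> \<le> K / 2 ^ n" for a b
    using mult_mono[OF that] K0 by (simp add: abs_mult power2_eq_square)
  show "\<bar>bessel_J_int (int n) x * bessel_J_int m x\<bar> \<le> K\<^sup>2 / 2 ^ n"
    using *[OF m(1) K(1)] by (simp add: mult.commute)
  show "\<bar>bessel_A m (int n) x\<bar> \<le> 2 * K\<^sup>2 / 2 ^ n"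
    using *[OF m(2) K(1)[of n]] *[OF m(1) K(2)[of n]] unfolding bessel_A_def by linarith
qed

lemma bessel_V_tendsto_uniform:
  assumes a: "0 < a"
  shows "uniform_limit {a..b} (\<lambda>N x. bessel_V v (int N + 1) x) (\<lambda>_. 0) sequentially"
proof -
  obtain K where K: "K \<ge> 0" "\<And>n x. x \<in> {a..b} \<Longrightarrow> \<bar>bessel_J_int (int n) x\<bar> \<le> K / 2 ^ n"
    "\<And>n x. x \<in> {a..b} \<Longrightarrow> \<bar>bessel_J_hat (int n) x\<bar> \<le> K / 2 ^ n"
    using bessel_decay[OF a] by metis
  \<comment> \<open>The \<open>3 * K\<^sup>2\<close> collects the two \<open>bessel_A\<close> terms,
    one of them already halved by the higher order \<open>N + 1\<close>; the
    \<open>2 * K\<^sup>2\<close> collects the two products of \<open>J\<close>.\<close>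
  define c where "c = b / 2 * (3 * K\<^sup>2) + \<bar>b / (2 * of_int v)\<bar> * (2 * K\<^sup>2)"
  \<comment> \<open>The decay estimate covers nonnegative orders only; \<open>N \<ge> v\<close>
    makes the shifted orders \<open>N - v\<close> and \<open>N + 1 - v\<close> nonnegative.\<close>
  have bound: "norm (bessel_V v (int N + 1) x) \<le> c * (real (Suc N) / 2 ^ N)"
    if x: "x \<in> {a..b}" and N: "int N \<ge> v" for x N
  proof -
    note A = bessel_A_bound[OF K(2)[OF x] K(3)[OF x]]
    have e: "int N + 1 - 1 = int N" "int N + 1 - v - 1 = int N - v" "int N + 1 = int (Suc N)" by auto
    have p: "K\<^sup>2 / 2 ^ Suc N \<le> K\<^sup>2 / 2 ^ N" by (intro divide_left_mono) auto
    have N': "0 \<le> int (Suc N) - v" "0 \<le> int N - v" using N by auto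
    have 1: "\<bar>of_int (int N) * bessel_A (int (Suc N) - v) (int N) x + of_int (int (Suc N)) * bessel_A (int N - v) (int (Suc N)) x\<bar>
        \<le> real (Suc N) * (2 * K\<^sup>2 / 2 ^ N) + real (Suc N) * (2 * K\<^sup>2 / 2 ^ Suc N)"
    proof -
      have "real N * \<bar>bessel_A (int (Suc N) - v) (int N) x\<bar> \<le> real (Suc N) * (2 * K\<^sup>2 / 2 ^ N)"
        by (rule mult_mono[OF _ A(1)[OF N'(1)]]) auto
      moreover have "real (Suc N) * \<bar>bessel_A (int N - v) (int (Suc N)) x\<bar> \<le> real (Suc N) * (2 * K\<^sup>2 / 2 ^ Suc N)"
        by (rule mult_left_mono[OF A(1)[OF N'(2)]]) auto
      ultimately show ?thesis
        unfolding of_int_of_nat_eq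
        by (intro order_trans[OF abs_triangle_ineq]) (simp only: abs_mult abs_of_nat add_mono)
    qed
    have 2: "\<bar>bessel_J_int (int N) x * bessel_J_int (int (Suc N) - v) x - bessel_J_int (int (Suc N)) x * bessel_J_int (int N - v) x\<bar>
        \<le> K\<^sup>2 / 2 ^ N + K\<^sup>2 / 2 ^ N"
      using A(2)[OF N'(1), of N] A(2)[OF N'(2), of "Suc N"] p
      by (intro order_trans[OF abs_triangle_ineq4] add_mono) linarith+
    have x0: "0 < x" "x \<le> b" using x a by auto
    have "\<bar>bessel_V v (int (Suc N)) x\<bar> \<le>
        b / 2 * (real (Suc N) * (2 * K\<^sup>2 / 2 ^ N) + real (Suc N) * (2 * K\<^sup>2 / 2 ^ Suc N))
        + \<bar>b / (2 * of_int v)\<bar> * (K\<^sup>2 / 2 ^ N + K\<^sup>2 / 2 ^ N)"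
      unfolding bessel_V_def e(1,2)[unfolded e(3)] abs_mult[of "x / 2"] abs_mult[of "x / (2 * of_int v)"]
      using x0 by (intro order_trans[OF abs_triangle_ineq] add_mono, unfold abs_mult[of "x / 2"] abs_mult[of "x / (2 * of_int v)"])
        (intro mult_mono 1 2; (auto simp: divide_right_mono)[1])+
    also have "\<dots> = b / 2 * (3 * K\<^sup>2) * (real (Suc N) / 2 ^ N) + \<bar>b / (2 * of_int v)\<bar> * (2 * K\<^sup>2) * (1 / 2 ^ N)"
      by (simp add: field_simps)
    also have "\<dots> \<le> b / 2 * (3 * K\<^sup>2) * (real (Suc N) / 2 ^ N) + \<bar>b / (2 * of_int v)\<bar> * (2 * K\<^sup>2) * (real (Suc N) / 2 ^ N)"
      by (intro add_left_mono mult_left_mono divide_right_mono) auto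
    also have "\<dots> = c * (real (Suc N) / 2 ^ N)" by (simp add: c_def algebra_simps)
    finally show ?thesis by (simp add: add.commute)
  qed
  have lim: "(\<lambda>N. c * (real (Suc N) / 2 ^ N)) \<longlonglongrightarrow> 0"
    by (rule summable_LIMSEQ_zero[OF summable_of_nat_half_power])
  show ?thesis
  proof (rule uniform_limitI)
    fix e :: real assume "e > 0"
    with lim have "\<forall>\<^sub>F N in sequentially. c * (real (Suc N) / 2 ^ N) < e" by (rule order_tendstoD)
    moreover have "\<forall>\<^sub>F N in sequentially. nat v \<le> N" by (rule eventually_ge_at_top)
    ultimately show "\<forall>\<^sub>F N in sequentially. \<forall>x\<in>{a..b}. dist (bessel_V v (int N + 1) x) 0 < e"
      by eventually_elim (auto simp: dist_real_def intro: order.strict_trans1[OF bound[unfolded real_norm_def]])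
  qed
qed

text \<open>One half of the summand of \<open>bessel_P\<close>: the halves with
  \<open>v = \<mu>\<close> and \<open>v = - \<mu>\<close> telescope separately. The shift to
  \<open>Suc n\<close> matches a sum that starts at 1.\<close>

definition bessel_U_term :: "int \<Rightarrow> real \<Rightarrow> nat \<Rightarrow> real" where
  "bessel_U_term v x n = of_int (int (Suc n)) * bessel_A (int (Suc n) - v) (int (Suc n)) x"

lemma summable_bessel_U:
  assumes x: "x > 0"
  shows "summable (bessel_U_term v x)"
proof -
  obtain K where K: "K \<ge> 0" "\<And>n x'. x' \<in> {x..x} \<Longrightarrow> \<bar>bessel_J_int (int n) x'\<bar> \<le> K / 2 ^ n"
    "\<And>n x'. x' \<in> {x..x} \<Longrightarrow> \<bar>bessel_J_hat (int n) x'\<bar> \<le> K / 2 ^ n"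
    using bessel_decay[OF x] by metis
  have K': "\<And>n. \<bar>bessel_J_int (int n) x\<bar> \<le> K / 2 ^ n" "\<And>n. \<bar>bessel_J_hat (int n) x\<bar> \<le> K / 2 ^ n"
    using K by auto
  show ?thesis
  proof (rule summable_comparison_test'[OF summable_of_nat_half_power[of "K\<^sup>2"], of "nat v"])
    fix n assume "nat v \<le> n"
    then have "0 \<le> int (Suc n) - v" by auto
    from bessel_A_bound(1)[OF K' this, of "Suc n"]
    have "real (Suc n) * \<bar>bessel_A (int (Suc n) - v) (int (Suc n)) x\<bar> \<le> real (Suc n) * (2 * K\<^sup>2 / 2 ^ Suc n)"
      by (intro mult_left_mono) auto
    then show "norm (bessel_U_term v x n) \<le> K\<^sup>2 * (real (Suc n) / 2 ^ n)"
      by (simp add: bessel_U_term_def abs_mult mult_ac)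
  qed
qed

text \<open>After termwise differentiation the partial sums collapse to a difference of two values
  of \<open>bessel_V\<close>. The far one tends to zero uniformly near \<open>x\<close>, which both
  justifies the differentiation and evaluates the result.\<close>

lemma has_field_derivative_bessel_U:
  assumes x: "x > 0" and v: "v \<noteq> 0"
  shows "((\<lambda>x. (\<Sum>n. bessel_U_term v x n) / x) has_field_derivative bessel_V v 1 x / x\<^sup>2) (at x)"
proof -
  let ?S = "{x / 2..x + 1}"
  let ?f = "\<lambda>n x. bessel_U_term v x n / x"
  let ?f' = "\<lambda>n x. (bessel_V v (int n + 1) x - bessel_V v (int n + 2) x) / x\<^sup>2"
  have tel: "(\<Sum>i<N. ?f' i y) = (bessel_V v 1 y - bessel_V v (int N + 1) y) / y\<^sup>2" for N y
    by (induction N) (auto simp: diff_divide_distrib add_ac)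
  have ul: "uniform_limit ?S (\<lambda>N y. \<Sum>i<N. ?f' i y) (\<lambda>y. bessel_V v 1 y / y\<^sup>2) sequentially"
  proof -
    have *: "uniform_limit ?S (\<lambda>N y. bessel_V v (int N + 1) y) (\<lambda>y. 0) sequentially"
      by (intro bessel_V_tendsto_uniform) (use x in auto)
    show ?thesis
    proof (rule uniform_limitI)
      fix e :: real assume e: "e > 0"
      \<comment> \<open>The tolerance is scaled by \<open>(x / 2)\<^sup>2\<close> because the
        potential is divided by \<open>y\<^sup>2\<close> and \<open>y \<ge> x / 2\<close> on the
        interval.\<close>
      with x have "e * (x / 2)\<^sup>2 > 0" by auto
      from uniform_limitD[OF * this]
      show "\<forall>\<^sub>F N in sequentially. \<forall>y\<in>?S. dist (\<Sum>i<N. ?f' i y) (bessel_V v 1 y / y\<^sup>2) < e"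
      proof eventually_elim
        case (elim N)
        show ?case
        proof
          fix y assume y: "y \<in> ?S"
          then have y0: "y > 0" using x by auto
          have "\<bar>bessel_V v (int N + 1) y\<bar> < e * (x / 2)\<^sup>2" using elim y by (auto simp: dist_real_def)
          also have "\<dots> \<le> e * y\<^sup>2" using e y x by (intro mult_left_mono power_mono) auto
          finally show "dist (\<Sum>i<N. ?f' i y) (bessel_V v 1 y / y\<^sup>2) < e"
            unfolding tel using y0
            by (simp add: dist_real_def diff_divide_distrib abs_mult pos_divide_less_eq)
        qed
      qed
    qed
  qed
  have x_in: "x \<in> ?S" "x \<in> interior ?S" using x by (auto simp: interior_atLeastAtMost_real)
  have "((\<lambda>x. \<Sum>n. ?f n x) has_field_derivative (\<Sum>n. ?f' n x)) (at x)"
  proof (rule has_field_derivative_series'(2)[of ?S ?f ?f' x])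
    show "(?f n has_field_derivative ?f' n y) (at y within ?S)" if "y \<in> ?S" for n y
    proof -
      have "y > 0" using that x by auto
      from has_field_derivative_bessel_A_term[OF this v, of "int n + 1"]
      show ?thesis by (simp add: bessel_U_term_def has_field_derivative_at_within add_ac)
    qed
    show "uniformly_convergent_on ?S (\<lambda>n x. \<Sum>i<n. ?f' i x)"
      using ul unfolding uniformly_convergent_on_def by blast
    show "summable (\<lambda>n. ?f n x)" by (intro summable_divide summable_bessel_U x)
  qed (use x_in in auto)
  moreover have "(\<Sum>n. ?f' n x) = bessel_V v 1 x / x\<^sup>2"
    using tendsto_uniform_limitI[OF ul x_in(1)] unfolding sums_def[symmetric]
    by (rule sums_unique[symmetric])
  moreover have "((\<lambda>x. (\<Sum>n. bessel_U_term v x n) / x) has_field_derivative D) (at x)"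
    if "((\<lambda>x. \<Sum>n. ?f n x) has_field_derivative D) (at x)" for D
    by (rule has_field_derivative_transform_within_open[where S = "{0<..}", OF that])
      (use x in \<open>auto simp: suminf_divide[OF summable_bessel_U]\<close>)
  ultimately show ?thesis by simp
qed

lemma bessel_P_term_eq:
  "bessel_P_term \<mu> x (int (Suc n)) = bessel_U_term \<mu> x n + (-1) powi \<mu> * bessel_U_term (- \<mu>) x n"
  by (simp add: bessel_P_term_def bessel_U_term_def bessel_A_def algebra_simps)

lemma summable_bessel_P:
  assumes "x > 0"
  shows "summable (\<lambda>n. bessel_P_term \<mu> x (int (Suc n)))"
  unfolding bessel_P_term_eq by (intro summable_add summable_mult summable_bessel_U assms)

lemma bessel_P_eq:
  assumes "x > 0"
  shows "bessel_P \<mu> x = (\<Sum>n. bessel_U_term \<mu> x n) + (-1) powi \<mu> * (\<Sum>n. bessel_U_term (- \<mu>) x n)"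
  unfolding bessel_P_def bessel_P_term_eq
  by (simp add: suminf_add[symmetric] suminf_mult summable_bessel_U[OF assms] summable_mult)

text \<open>The \<open>bessel_A\<close> parts combine to \<open>Y\<close> at order
  \<open>\<mu>\<close> and to twice the derivative in the order at 1. The latter differs from
  \<open>pi * Y_1\<close> by \<open>2 / x * J_0\<close>, and exactly this is supplied by the parts
  divided by \<open>\<mu>\<close>, through the three-term recurrence at
  \<open>\<mu>\<close>.\<close>

lemma bessel_V_1:
  assumes x: "x > 0" and v: "\<mu> \<noteq> 0"
  shows "(-1) powi \<mu> * bessel_V \<mu> 1 x + bessel_V (- \<mu>) 1 x =
    pi * x / 2 * (bessel_Y_int 1 x * bessel_J_int \<mu> x + bessel_J_int 1 x * bessel_Y_int \<mu> x)"
proof -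
  define s where "s = ((-1) powi \<mu> :: real)"
  have ss: "s * s = 1" by (simp add: s_def minus_one_powi)
  have Jm: "bessel_J_int (- \<mu>) x = s * bessel_J_int \<mu> x"
    unfolding s_def by (rule bessel_J_minus_of_int[OF x])
  have "(-1) powi (\<mu> - 1) = - s" by (simp add: s_def minus_one_powi)
  then have J1m: "bessel_J_int (1 - \<mu>) x = - s * bessel_J_int (\<mu> - 1) x"
    using bessel_J_minus_of_int[OF x, of "\<mu> - 1"] by simp
  have J1p: "bessel_J_int (\<mu> - 1) x = 2 * of_int \<mu> / x * bessel_J_int \<mu> x - bessel_J_int (\<mu> + 1) x"
    by (rule bessel_J_int_recurrence[OF x])
  have Y: "s * bessel_J_hat (- \<mu>) x = pi * bessel_Y_int \<mu> x - bessel_J_hat \<mu> x"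
    unfolding bessel_Y_int_eq[OF x] s_def by simp
  have Y1: "pi * bessel_Y_int 1 x = 2 * bessel_J_hat 1 x - 2 / x * bessel_J_int 0 x"
    unfolding bessel_Y_int_eq[OF x] using bessel_J_hat_recurrence[OF x, of 0] by simp
  have V: "bessel_V \<mu> 1 x = x / 2 * bessel_A (- \<mu>) 1 x
      + x / (2 * of_int \<mu>) * (bessel_J_int 0 x * bessel_J_int (1 - \<mu>) x - bessel_J_int 1 x * bessel_J_int (- \<mu>) x)"
    by (simp add: bessel_V_def)
  have V': "bessel_V (- \<mu>) 1 x = x / 2 * bessel_A \<mu> 1 x
      - x / (2 * of_int \<mu>) * (bessel_J_int 0 x * bessel_J_int (\<mu> + 1) x - bessel_J_int 1 x * bessel_J_int \<mu> x)"
    by (simp add: bessel_V_def add.commute)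
  have "s * bessel_V \<mu> 1 x + bessel_V (- \<mu>) 1 x =
    x / 2 * ((s * bessel_J_hat (- \<mu>) x) * bessel_J_int 1 x + (s * s) * bessel_J_int \<mu> x * bessel_J_hat 1 x
        + bessel_J_hat \<mu> x * bessel_J_int 1 x + bessel_J_int \<mu> x * bessel_J_hat 1 x)
    + x / (2 * of_int \<mu>) * (bessel_J_int 0 x * (- (s * s) * bessel_J_int (\<mu> - 1) x - bessel_J_int (\<mu> + 1) x)
        - bessel_J_int 1 x * ((s * s) * bessel_J_int \<mu> x - bessel_J_int \<mu> x))"
    unfolding V V' bessel_A_def Jm J1m by (simp add: algebra_simps)
  also have "\<dots> = x / 2 * (pi * bessel_Y_int \<mu> x * bessel_J_int 1 x
      + (2 * bessel_J_hat 1 x - 2 / x * bessel_J_int 0 x) * bessel_J_int \<mu> x)"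
    unfolding ss Y J1p using v x by (simp add: field_simps)
  also have "\<dots> = pi * x / 2 * (bessel_Y_int 1 x * bessel_J_int \<mu> x + bessel_J_int 1 x * bessel_Y_int \<mu> x)"
    unfolding Y1[symmetric] by (simp add: algebra_simps)
  finally show ?thesis by (simp add: s_def)
qed

lemma has_field_derivative_bessel_P:
  assumes x: "x > 0" and v: "\<mu> \<noteq> 0"
  shows "((\<lambda>x. (-1) powi \<mu> * bessel_P \<mu> x / x) has_field_derivative
    pi / (2 * x) * (bessel_Y_int 1 x * bessel_J_int \<mu> x + bessel_J_int 1 x * bessel_Y_int \<mu> x)) (at x)"
proof (rule has_field_derivative_transform_within_open[where S = "{0<..}"])
  have ss: "(-1) powi \<mu> * (-1) powi \<mu> = (1::real)" by (simp add: minus_one_powi)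
  let ?f = "\<lambda>x. (-1) powi \<mu> * ((\<Sum>n. bessel_U_term \<mu> x n) / x) + (\<Sum>n. bessel_U_term (- \<mu>) x n) / x"
  have "(?f has_field_derivative (-1) powi \<mu> * (bessel_V \<mu> 1 x / x\<^sup>2) + bessel_V (- \<mu>) 1 x / x\<^sup>2) (at x)"
    using v by (intro DERIV_add DERIV_cmult has_field_derivative_bessel_U[OF x]) auto
  moreover have "(-1) powi \<mu> * (bessel_V \<mu> 1 x / x\<^sup>2) + bessel_V (- \<mu>) 1 x / x\<^sup>2 =
    pi / (2 * x) * (bessel_Y_int 1 x * bessel_J_int \<mu> x + bessel_J_int 1 x * bessel_Y_int \<mu> x)"
    unfolding times_divide_eq_right add_divide_distrib[symmetric] bessel_V_1[OF x v]
    using x by (simp add: power2_eq_square)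
  ultimately show "(?f has_field_derivative
    pi / (2 * x) * (bessel_Y_int 1 x * bessel_J_int \<mu> x + bessel_J_int 1 x * bessel_Y_int \<mu> x)) (at x)"
    by (simp only:)
  show "?f y = (-1) powi \<mu> * bessel_P \<mu> y / y" if "y \<in> {0<..}" for y
    using that ss unfolding bessel_P_eq[OF that[unfolded greaterThan_iff]]
    by (simp add: algebra_simps add_divide_distrib mult.assoc[symmetric])
qed (use x in auto)

text \<open>This is \<open>- (pi / 4) * x * (W(J_0, Y_\<mu>) + W(Y_0, J_\<mu>))\<close> with
  \<open>W(u, v) = u v' - u' v\<close>. Derivatives are expressed by neighbouring orders:
  \<open>x Y_\<mu>' = x Y_(\<mu>-1) - \<mu> Y_\<mu>\<close>, likewise for \<open>J\<close>, and
  \<open>J_0' = - J_1\<close>, \<open>Y_0' = - Y_1\<close>.\<close>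

definition bessel_G :: "int \<Rightarrow> real \<Rightarrow> real" where
  "bessel_G \<mu> x = - (pi / 4) *
     ((x * bessel_Y_int (\<mu> - 1) x - of_int \<mu> * bessel_Y_int \<mu> x) * bessel_J_int 0 x
      + x * bessel_Y_int \<mu> x * bessel_J_int 1 x
      + (x * bessel_J_int (\<mu> - 1) x - of_int \<mu> * bessel_J_int \<mu> x) * bessel_Y_int 0 x
      + x * bessel_J_int \<mu> x * bessel_Y_int 1 x)"

text \<open>With \<open>D = x d/dx\<close>, the function \<open>c\<close> satisfies
  \<open>D^2 c = (m^2 - x^2) c\<close> and \<open>j0\<close> satisfies
  \<open>D^2 j0 = - x^2 j0\<close>. In the derivative of their Wronskian the terms with
  \<open>x^2\<close> cancel and only \<open>m^2\<close> survives.\<close>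

lemma bessel_G_part_deriv:
  fixes c cm j0 j1 :: "real \<Rightarrow> real"
  assumes x: "x \<noteq> 0"
    and cm: "(cm has_field_derivative (m - 1) / x * cm x - c x) (at x)"
    and c: "(c has_field_derivative cm x - m / x * c x) (at x)"
    and j0: "(j0 has_field_derivative - j1 x) (at x)"
    and j1: "(j1 has_field_derivative j0 x - j1 x / x) (at x)"
  shows "((\<lambda>x. (x * cm x - m * c x) * j0 x + x * c x * j1 x) has_field_derivative m\<^sup>2 / x * (c x * j0 x)) (at x)"
  by (rule derivative_eq_intros refl cm c j0 j1)+ (use x in \<open>simp add: field_simps power2_eq_square\<close>)

lemma has_field_derivative_bessel_J_int':
  assumes x: "x > 0"
  shows "(bessel_J_int k has_field_derivative bessel_J_int (k - 1) x - of_int k / x * bessel_J_int k x) (at x)"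
  by (rule DERIV_cong[OF has_field_derivative_bessel_J_int[OF x]])
    (unfold bessel_J_int_recurrence[OF x, of k], use x in \<open>simp add: field_simps\<close>)

lemma has_field_derivative_bessel_Y_int':
  assumes x: "x > 0"
  shows "(bessel_Y_int k has_field_derivative bessel_Y_int (k - 1) x - of_int k / x * bessel_Y_int k x) (at x)"
  by (rule DERIV_cong[OF has_field_derivative_bessel_Y_int[OF x]])
    (unfold bessel_Y_int_recurrence[OF x, of k], use x in \<open>simp add: field_simps\<close>)

lemma has_field_derivative_bessel_01:
  assumes x: "x > 0"
  shows "(bessel_J_int 0 has_field_derivative - bessel_J_int 1 x) (at x)"
    and "(bessel_J_int 1 has_field_derivative bessel_J_int 0 x - bessel_J_int 1 x / x) (at x)"
    and "(bessel_Y_int 0 has_field_derivative - bessel_Y_int 1 x) (at x)"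
    and "(bessel_Y_int 1 has_field_derivative bessel_Y_int 0 x - bessel_Y_int 1 x / x) (at x)"
  using has_field_derivative_bessel_J_int[OF x, of 0] has_field_derivative_bessel_J_int'[OF x, of 1]
    has_field_derivative_bessel_Y_int[OF x, of 0] has_field_derivative_bessel_Y_int'[OF x, of 1] by simp_all

lemma has_field_derivative_bessel_G:
  assumes x: "x > 0"
  shows "(bessel_G \<mu> has_field_derivative - ((of_int \<mu>)\<^sup>2 * (bessel_f \<mu> x / x))) (at x)"
proof -
  have Jm: "(bessel_J_int (\<mu> - 1) has_field_derivative
      (of_int \<mu> - 1) / x * bessel_J_int (\<mu> - 1) x - bessel_J_int \<mu> x) (at x)"
    using has_field_derivative_bessel_J_int[OF x, of "\<mu> - 1"] by simp
  have Ym: "(bessel_Y_int (\<mu> - 1) has_field_derivative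
      (of_int \<mu> - 1) / x * bessel_Y_int (\<mu> - 1) x - bessel_Y_int \<mu> x) (at x)"
    using has_field_derivative_bessel_Y_int[OF x, of "\<mu> - 1"] by simp
  note d = has_field_derivative_bessel_01[OF x]
  note 1 = bessel_G_part_deriv[OF _ Ym has_field_derivative_bessel_Y_int'[OF x] d(1,2)]
  note 2 = bessel_G_part_deriv[OF _ Jm has_field_derivative_bessel_J_int'[OF x] d(3,4)]
  show ?thesis
    unfolding bessel_G_def[abs_def] add.assoc
    by (rule DERIV_cmult[OF DERIV_add[OF 1 2, unfolded add.assoc], THEN DERIV_cong])
      (use x in \<open>auto simp: bessel_f_def field_simps\<close>)
qed

lemma has_field_derivative_bessel_f:
  assumes x: "x > 0"
  shows "(bessel_f \<mu> has_field_derivative pi / 4 *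
    ((bessel_Y_int (\<mu> - 1) x - of_int \<mu> / x * bessel_Y_int \<mu> x) * bessel_J_int 0 x
      - bessel_Y_int \<mu> x * bessel_J_int 1 x
     + (bessel_J_int (\<mu> - 1) x - of_int \<mu> / x * bessel_J_int \<mu> x) * bessel_Y_int 0 x
      - bessel_J_int \<mu> x * bessel_Y_int 1 x)) (at x)"
  unfolding bessel_f_def[abs_def]
  by (rule derivative_eq_intros refl has_field_derivative_bessel_01[OF x]
      has_field_derivative_bessel_Y_int'[OF x] has_field_derivative_bessel_J_int'[OF x])+
    (simp add: algebra_simps)

text \<open>The derivative of the signed \<open>P / x\<close> is \<open>- (x f' + G) / x^2\<close>.
  Adding \<open>(f - G) / x\<close> removes \<open>f'\<close> and \<open>G\<close>, and
  \<open>x G' = - \<mu>^2 f\<close> leaves a multiple of \<open>f / x^2\<close> alone.\<close>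

lemma has_field_derivative_bessel_Theta:
  assumes x: "x > 0" and v: "\<mu> \<noteq> 0"
  shows "((\<lambda>x. (-1) powi \<mu> * bessel_P \<mu> x / x + (bessel_f \<mu> x - bessel_G \<mu> x) / x) has_field_derivative
    - ((1 - (of_int \<mu>)\<^sup>2) * (bessel_f \<mu> x / x\<^sup>2))) (at x)"
  by (rule DERIV_add[OF has_field_derivative_bessel_P[OF x v]
        DERIV_divide[OF DERIV_diff[OF has_field_derivative_bessel_f[OF x] has_field_derivative_bessel_G[OF x]] DERIV_ident],
        THEN DERIV_cong])
    (use x in \<open>auto simp: bessel_f_def bessel_G_def power2_eq_square field_simps\<close>)

section \<open>Integrals over half-lines\<close>

lemma absolutely_integrable_continuous_dominated:
  fixes f g :: "real \<Rightarrow> real"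
  assumes "continuous_on S f" "S \<in> sets borel" "g integrable_on S" "\<And>t. t \<in> S \<Longrightarrow> \<bar>f t\<bar> \<le> g t"
  shows "f absolutely_integrable_on S"
proof (rule measurable_bounded_by_integrable_imp_absolutely_integrable)
  show "S \<in> sets lebesgue" using assms(2) by simp
  then show "f \<in> borel_measurable (lebesgue_on S)"
    using assms(1) by (rule continuous_imp_measurable_on_sets_lebesgue[rotated])
qed (use assms in auto)

text \<open>Bridge between two integrals: the calculus is done with gauge integrals, whereas the
  theorem speaks of Lebesgue integrals over \<open>lborel\<close>. Borel measurability of the
  integrand removes the completion of the measure.\<close>

lemma set_integrable_continuous_dominated:
  fixes f g :: "real \<Rightarrow> real"
  assumes "continuous_on S f" "S \<in> sets borel" "g integrable_on S" "\<And>t. t \<in> S \<Longrightarrow> \<bar>f t\<bar> \<le> g t"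
  shows "set_integrable lborel S f"
proof -
  have "set_integrable lebesgue S f"
    by (rule absolutely_integrable_continuous_dominated[OF assms])
  moreover have "(\<lambda>x. indicator S x *\<^sub>R f x) \<in> borel_measurable lborel"
    using borel_measurable_continuous_on_indicator[OF assms(2,1)] by simp
  ultimately show ?thesis
    unfolding set_integrable_def by (simp add: integrable_completion)
qed

text \<open>The fundamental theorem on \<open>{a..a + k}\<close>, followed by dominated convergence
  of the truncated integrands with majorant \<open>\<bar>f\<bar>\<close>.\<close>

lemma integral_FTC_to_infinity:
  fixes F f :: "real \<Rightarrow> real"
  assumes F: "\<And>t. t \<ge> a \<Longrightarrow> (F has_field_derivative f t) (at t within {a..})"
    and f: "f absolutely_integrable_on {a..}"
    and L: "(F \<longlongrightarrow> L) at_top"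
  shows "integral {a..} f = L - F a"
proof -
  define g where "g = (\<lambda>k t. if t \<in> {..a + real k} then f t else 0)"
  have fi: "(f has_integral F (a + real k) - F a) {a..a + real k}" for k
  proof (rule fundamental_theorem_of_calculus)
    fix t assume "t \<in> {a..a + real k}"
    then have "(F has_field_derivative f t) (at t within {a..a + real k})"
      by (intro DERIV_subset[OF F]) auto
    then show "(F has_vector_derivative f t) (at t within {a..a + real k})"
      by (simp add: has_real_derivative_iff_has_vector_derivative)
  qed auto
  have int: "{..a + real k} \<inter> {a..} = {a..a + real k}" for k by auto
  have g: "g k integrable_on {a..}" "integral {a..} (g k) = F (a + real k) - F a" for k
  proof -
    show "g k integrable_on {a..}"
      unfolding g_def using fi[of k] by (subst integrable_restrict_Int) (auto simp: int integrable_on_def)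
    show "integral {a..} (g k) = F (a + real k) - F a"
      unfolding g_def using fi[of k] by (subst integral_restrict_Int) (auto simp: int integral_unique)
  qed
  have "(\<lambda>k. integral {a..} (g k)) \<longlonglongrightarrow> integral {a..} f"
  proof (rule dominated_convergence(2)[where h = "\<lambda>t. \<bar>f t\<bar>"])
    show "(\<lambda>t. \<bar>f t\<bar>) integrable_on {a..}"
      using f by (simp add: absolutely_integrable_on_def)
    show "(\<lambda>k. g k t) \<longlonglongrightarrow> f t" if "t \<in> {a..}" for t
    proof (rule tendsto_eventually)
      have "\<forall>\<^sub>F k in sequentially. nat \<lceil>t - a\<rceil> \<le> k" by (rule eventually_ge_at_top)
      then show "\<forall>\<^sub>F k in sequentially. g k t = f t"
        by eventually_elim (auto simp: g_def nat_le_iff ceiling_le_iff)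
    qed
    show "g k integrable_on {a..}" for k by (rule g)
    show "norm (g k t) \<le> \<bar>f t\<bar>" for k t by (simp add: g_def)
  qed
  moreover have "(\<lambda>k. F (a + real k) - F a) \<longlonglongrightarrow> L - F a"
    by (intro tendsto_diff tendsto_const filterlim_compose[OF L]
        filterlim_tendsto_add_at_top[OF tendsto_const filterlim_real_sequentially])
  ultimately show ?thesis using LIMSEQ_unique by (simp add: g)
qed

lemma exp_minus_integrable: "(\<lambda>t. c * exp (- t)) integrable_on {0::real..}"
  using integrable_cmul[OF has_integral_integrable[OF has_integral_exp_minus_to_infinity[of 1 0]], of c] by simp

lemma exp_minus_integral: "integral {0::real..} (\<lambda>t. c * exp (- t)) = c"
  using integral_unique[OF has_integral_exp_minus_to_infinity[of 1 0]] by simp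

lemma laplace_absolutely_integrable:
  fixes f :: "real \<Rightarrow> real"
  assumes "continuous_on {0..} f" "\<And>t. t \<ge> 0 \<Longrightarrow> \<bar>f t\<bar> \<le> C"
  shows "(\<lambda>t. exp (- t) * f t) absolutely_integrable_on {0..}"
proof (rule absolutely_integrable_continuous_dominated[OF _ _ exp_minus_integrable[of C]])
  show "continuous_on {0..} (\<lambda>t. exp (- t) * f t)" by (intro continuous_intros assms)
qed (use assms(2) in \<open>auto simp: abs_mult\<close>)

lemma laplace_bound:
  fixes f :: "real \<Rightarrow> real"
  assumes "continuous_on {0..} f" "\<And>t. t \<ge> 0 \<Longrightarrow> \<bar>f t\<bar> \<le> C"
  shows "\<bar>integral {0..} (\<lambda>t. exp (- t) * f t)\<bar> \<le> C"
proof -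
  have "norm (integral {0..} (\<lambda>t. exp (- t) * f t)) \<le> integral {0..} (\<lambda>t. C * exp (- t))"
    using set_lebesgue_integral_eq_integral(1)[OF laplace_absolutely_integrable[OF assms]]
    by (intro integral_norm_bound_integral exp_minus_integrable) (auto simp: abs_mult assms(2))
  then show ?thesis by (simp only: exp_minus_integral real_norm_def)
qed

text \<open>Differentiation under an integral with weight \<open>exp (- t)\<close>: difference
  quotients along an arbitrary sequence are dominated by \<open>C * exp (- t)\<close>.\<close>

lemma has_field_derivative_laplace:
  fixes \<phi> \<psi> :: "real \<Rightarrow> real \<Rightarrow> real"
  assumes x: "x > a"
    and d: "\<And>y t. y > a \<Longrightarrow> t \<ge> 0 \<Longrightarrow> ((\<lambda>y. \<phi> y t) has_field_derivative \<psi> y t) (at y)"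
    and b: "\<And>y t. y > a \<Longrightarrow> t \<ge> 0 \<Longrightarrow> \<bar>\<psi> y t\<bar> \<le> C"
    and c: "\<And>y. y > a \<Longrightarrow> continuous_on {0..} (\<phi> y)"
    and cb: "\<And>y t. y > a \<Longrightarrow> t \<ge> 0 \<Longrightarrow> \<bar>\<phi> y t\<bar> \<le> B"
  shows "((\<lambda>y. integral {0..} (\<lambda>t. exp (- t) * \<phi> y t)) has_field_derivative
      integral {0..} (\<lambda>t. exp (- t) * \<psi> x t)) (at x)"
proof -
  let ?F = "\<lambda>y. integral {0..} (\<lambda>t. exp (- t) * \<phi> y t)"
  have i: "(\<lambda>t. exp (- t) * \<phi> y t) integrable_on {0..}" if "y > a" for y
    using set_lebesgue_integral_eq_integral(1)[OF laplace_absolutely_integrable[OF c cb]] that by blast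
  have "((\<lambda>y. (?F y - ?F x) / (y - x)) \<longlongrightarrow> integral {0..} (\<lambda>t. exp (- t) * \<psi> x t)) (at x within {a<..})"
    unfolding tendsto_at_iff_sequentially
  proof (intro allI impI)
    fix X assume X: "\<forall>i. X i \<in> {a<..} - {x}" and lim: "X \<longlonglongrightarrow> x"
    let ?q = "\<lambda>k t. exp (- t) * ((\<phi> (X k) t - \<phi> x t) / (X k - x))"
    have q: "?q k = (\<lambda>t. (exp (- t) * \<phi> (X k) t - exp (- t) * \<phi> x t) / (X k - x))" for k
      by (auto simp: fun_eq_iff right_diff_distrib)
    have "(\<lambda>k. integral {0..} (?q k)) \<longlonglongrightarrow> integral {0..} (\<lambda>t. exp (- t) * \<psi> x t)"
    proof (rule dominated_convergence(2)[OF _ exp_minus_integrable[of C]])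
      show "?q k integrable_on {0..}" for k
        unfolding q using X x by (intro integrable_on_divide integrable_diff i) auto
      fix t :: real assume t: "t \<in> {0..}"
      show "norm (?q k t) \<le> C * exp (- t)" for k
      proof -
        \<comment> \<open>Mean value inequality on the convex set \<open>{a<..}\<close>, on which
          the derivative is bounded by \<open>C\<close>.\<close>
        have "norm (\<phi> (X k) t - \<phi> x t) \<le> C * norm (X k - x)"
        proof (rule field_differentiable_bound[of "{a<..}" "\<lambda>y. \<phi> y t" "\<lambda>y. \<psi> y t"])
          show "((\<lambda>y. \<phi> y t) has_field_derivative \<psi> z t) (at z within {a<..})" if "z \<in> {a<..}" for z
            using d[of z t] that t by (auto intro: has_field_derivative_at_within)
        qed (use b t X x in auto)
        then have "\<bar>\<phi> (X k) t - \<phi> x t\<bar> / \<bar>X k - x\<bar> \<le> C"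
          using X[rule_format, of k] by (simp add: pos_divide_le_eq)
        from mult_left_mono[OF this, of "exp (- t)"] show ?thesis by (simp add: abs_mult mult.commute)
      qed
      have "((\<lambda>y. (\<phi> y t - \<phi> x t) / (y - x)) \<longlongrightarrow> \<psi> x t) (at x)"
        using d[OF x] t by (simp add: has_field_derivative_iff)
      moreover have "filterlim X (at x) sequentially"
        using X lim by (auto simp: filterlim_at)
      ultimately have "(\<lambda>k. (\<phi> (X k) t - \<phi> x t) / (X k - x)) \<longlonglongrightarrow> \<psi> x t"
        by (rule filterlim_compose)
      then show "(\<lambda>k. ?q k t) \<longlonglongrightarrow> exp (- t) * \<psi> x t" by (rule tendsto_mult_left)
    qed
    moreover have "integral {0..} (?q k) = (?F (X k) - ?F x) / (X k - x)" for k
      unfolding q using X x by (subst integral_divide, subst integral_diff) (auto intro: i)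
    ultimately show "((\<lambda>y. (?F y - ?F x) / (y - x)) \<circ> X) \<longlonglongrightarrow> integral {0..} (\<lambda>t. exp (- t) * \<psi> x t)"
      by (simp only: o_def)
  qed
  then have "(?F has_field_derivative integral {0..} (\<lambda>t. exp (- t) * \<psi> x t)) (at x within {a<..})"
    by (simp add: has_field_derivative_iff)
  then show ?thesis using x by (simp add: at_within_open[of x "{a<..}"])
qed

text \<open>This is \<open>pi / 2\<close> times the difference of the Struve function of order 0 and
  \<open>Y_0\<close>, after rescaling the Laplace integral so that the weight does not depend on
  \<open>x\<close>.\<close>

definition laplace_M0 :: "real \<Rightarrow> real" where
  "laplace_M0 x = integral {0..} (\<lambda>t. exp (- t) * (1 / sqrt (x\<^sup>2 + t\<^sup>2)))"

definition laplace_M1 :: "real \<Rightarrow> real" where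
  "laplace_M1 x = integral {0..} (\<lambda>t. exp (- t) * (x / sqrt (x\<^sup>2 + t\<^sup>2) ^ 3))"

lemma sqrt_sum_pos: "x > 0 \<Longrightarrow> sqrt (x\<^sup>2 + t\<^sup>2) > 0" for x t :: real
  by (simp add: add_pos_nonneg)

lemma laplace_M_integrand_bounds:
  fixes x t :: real
  assumes a: "0 < a" "a \<le> x"
  shows "\<bar>1 / sqrt (x\<^sup>2 + t\<^sup>2)\<bar> \<le> 1 / a"
    and "\<bar>x / sqrt (x\<^sup>2 + t\<^sup>2) ^ 3\<bar> \<le> 1 / a\<^sup>2"
    and "\<bar>1 / sqrt (x\<^sup>2 + t\<^sup>2) ^ 3 - 3 * x\<^sup>2 / sqrt (x\<^sup>2 + t\<^sup>2) ^ 5\<bar> \<le> 4 / a ^ 3"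
proof -
  let ?r = "sqrt (x\<^sup>2 + t\<^sup>2)"
  have r2: "x \<le> ?r" by (rule real_sqrt_sum_squares_ge1)
  have r1: "a \<le> ?r" by (rule order_trans[OF a(2) r2])
  have "0 < ?r" using a(1) r1 by (rule less_le_trans)
  note r = r1 r2 this
  have p: "1 / ?r ^ n \<le> 1 / a ^ n" for n
    by (intro divide_left_mono power_mono mult_pos_pos zero_less_power r a less_imp_le[OF a(1)] zero_le_one)
  show "\<bar>1 / ?r\<bar> \<le> 1 / a" using p[of 1] r(3) by (simp only: power_one_right abs_of_pos divide_pos_pos zero_less_one)
  have e: "?r / ?r ^ 3 = 1 / ?r ^ 2" "3 * ?r\<^sup>2 / ?r ^ 5 = 3 * (1 / ?r ^ 3)"
    using r(3) by (simp_all add: eval_nat_numeral del: real_sqrt_mult_self)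
  have "x / ?r ^ 3 \<le> ?r / ?r ^ 3" using r by (intro divide_right_mono) auto
  also note e(1)
  finally show "\<bar>x / ?r ^ 3\<bar> \<le> 1 / a\<^sup>2" using p[of 2] r a by simp
  have "3 * x\<^sup>2 / ?r ^ 5 \<le> 3 * ?r\<^sup>2 / ?r ^ 5"
    using r a by (intro divide_right_mono mult_left_mono power_mono) auto
  also note e(2)
  finally have "3 * x\<^sup>2 / ?r ^ 5 \<le> 3 / a ^ 3" using p[of 3] by simp
  moreover have "0 \<le> 3 * x\<^sup>2 / ?r ^ 5" "0 \<le> 1 / ?r ^ 3" using r by auto
  ultimately show "\<bar>1 / ?r ^ 3 - 3 * x\<^sup>2 / ?r ^ 5\<bar> \<le> 4 / a ^ 3"
    using p[of 3] by linarith
qed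

lemma inverse_power_sqrt_deriv:
  fixes x t :: real
  assumes "x > 0"
  shows "((\<lambda>y. 1 / sqrt (y\<^sup>2 + t\<^sup>2) ^ n) has_field_derivative - real n * x / sqrt (x\<^sup>2 + t\<^sup>2) ^ (n + 2)) (at x within A)"
    and "((\<lambda>t. 1 / sqrt (x\<^sup>2 + t\<^sup>2) ^ n) has_field_derivative - real n * t / sqrt (x\<^sup>2 + t\<^sup>2) ^ (n + 2)) (at t within A)"
proof -
  note r = sqrt_sum_pos[OF assms, of t]
  then have p: "x\<^sup>2 + t\<^sup>2 > 0" by simp
  have *: "((\<lambda>y. 1 / f y ^ n) has_field_derivative - real n * c / f z ^ (n + 2)) (at z within A)"
    if "(f has_field_derivative c / f z) (at z within A)" "f z > 0" for f c z
  proof (cases n)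
    case (Suc m)
    then show ?thesis
      using that(2)
      by (simp only: Suc) (rule DERIV_cong[OF DERIV_divide[OF DERIV_const DERIV_power_Suc[OF that(1)]]],
        auto simp: field_simps)
  qed simp
  show "((\<lambda>y. 1 / sqrt (y\<^sup>2 + t\<^sup>2) ^ n) has_field_derivative - real n * x / sqrt (x\<^sup>2 + t\<^sup>2) ^ (n + 2)) (at x within A)"
    by (rule *) (use r p in \<open>auto intro!: derivative_eq_intros simp: field_simps\<close>)
  show "((\<lambda>t. 1 / sqrt (x\<^sup>2 + t\<^sup>2) ^ n) has_field_derivative - real n * t / sqrt (x\<^sup>2 + t\<^sup>2) ^ (n + 2)) (at t within A)"
    by (rule *) (use r p in \<open>auto intro!: derivative_eq_intros simp: field_simps\<close>)
qed

lemma continuous_on_laplace_M_integrands: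
  fixes x :: real
  assumes "x > 0"
  shows "continuous_on A (\<lambda>t. 1 / sqrt (x\<^sup>2 + t\<^sup>2))"
    and "continuous_on A (\<lambda>t. x / sqrt (x\<^sup>2 + t\<^sup>2) ^ 3)"
    and "continuous_on A (\<lambda>t. 1 / sqrt (x\<^sup>2 + t\<^sup>2) ^ 3 - 3 * x\<^sup>2 / sqrt (x\<^sup>2 + t\<^sup>2) ^ 5)"
  using sqrt_sum_pos[OF assms, THEN less_imp_neq, symmetric]
  by (auto intro!: continuous_intros simp del: real_sqrt_eq_zero_cancel_iff)

lemma has_field_derivative_laplace_M0:
  assumes x: "x > 0"
  shows "(laplace_M0 has_field_derivative - laplace_M1 x) (at x)"
proof -
  have "(laplace_M0 has_field_derivative integral {0..} (\<lambda>t. exp (- t) * (- (x / sqrt (x\<^sup>2 + t\<^sup>2) ^ 3)))) (at x)"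
    unfolding laplace_M0_def[abs_def]
  proof (rule has_field_derivative_laplace[of "x / 2"])
    fix y t :: real assume y: "x / 2 < y" and "t \<ge> 0"
    then have y0: "y > 0" using x by auto
    show "((\<lambda>y. 1 / sqrt (y\<^sup>2 + t\<^sup>2)) has_field_derivative - (y / sqrt (y\<^sup>2 + t\<^sup>2) ^ 3)) (at y)"
      using inverse_power_sqrt_deriv(1)[OF y0, of t 1 UNIV] by (simp add: numeral_3_eq_3)
    show "\<bar>1 / sqrt (y\<^sup>2 + t\<^sup>2)\<bar> \<le> 1 / (x / 2)" "\<bar>- (y / sqrt (y\<^sup>2 + t\<^sup>2) ^ 3)\<bar> \<le> 1 / (x / 2)\<^sup>2"
      using laplace_M_integrand_bounds[of "x / 2" y t] x y by auto
  next
    fix y :: real assume "x / 2 < y"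
    then show "continuous_on {0..} (\<lambda>t. 1 / sqrt (y\<^sup>2 + t\<^sup>2))"
      using x by (intro continuous_on_laplace_M_integrands) auto
  qed (use x in auto)
  then show ?thesis by (simp add: laplace_M1_def)
qed

text \<open>With \<open>x\<close> as radius and \<open>t\<close> as height,
  \<open>1 / sqrt (x^2 + t^2)\<close> is harmonic in cylindrical coordinates. Its radial Laplacian
  is thus minus its second \<open>t\<close>-derivative, and integrating against
  \<open>exp (- t)\<close> returns \<open>laplace_M0\<close> up to the boundary term at
  \<open>t = 0\<close>, which is the \<open>1 / x\<close>.\<close>

lemma has_field_derivative_laplace_M1:
  assumes x: "x > 0"
  shows "(laplace_M1 has_field_derivative laplace_M0 x - laplace_M1 x / x - 1 / x) (at x)"
proof -
  let ?r = "\<lambda>t. sqrt (x\<^sup>2 + t\<^sup>2)"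
  let ?h = "\<lambda>t. 1 / ?r t ^ 3 - 3 * x\<^sup>2 / ?r t ^ 5"
  have r: "?r t > 0" for t by (rule sqrt_sum_pos[OF x])
  have "(laplace_M1 has_field_derivative integral {0..} (\<lambda>t. exp (- t) * ?h t)) (at x)"
    unfolding laplace_M1_def[abs_def]
  proof (rule has_field_derivative_laplace[of "x / 2"])
    fix y t :: real assume y: "x / 2 < y" and "t \<ge> 0"
    then have y0: "y > 0" using x by auto
    show "((\<lambda>y. y / sqrt (y\<^sup>2 + t\<^sup>2) ^ 3) has_field_derivative
        1 / sqrt (y\<^sup>2 + t\<^sup>2) ^ 3 - 3 * y\<^sup>2 / sqrt (y\<^sup>2 + t\<^sup>2) ^ 5) (at y)"
      using DERIV_mult'[OF DERIV_ident inverse_power_sqrt_deriv(1)[OF y0, of t 3 UNIV]]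
      by (simp add: power2_eq_square mult_ac)
    show "\<bar>y / sqrt (y\<^sup>2 + t\<^sup>2) ^ 3\<bar> \<le> 1 / (x / 2)\<^sup>2"
      "\<bar>1 / sqrt (y\<^sup>2 + t\<^sup>2) ^ 3 - 3 * y\<^sup>2 / sqrt (y\<^sup>2 + t\<^sup>2) ^ 5\<bar> \<le> 4 / (x / 2) ^ 3"
      using laplace_M_integrand_bounds[of "x / 2" y t] x y by auto
  next
    fix y :: real assume "x / 2 < y"
    then show "continuous_on {0..} (\<lambda>t. y / sqrt (y\<^sup>2 + t\<^sup>2) ^ 3)"
      using x by (intro continuous_on_laplace_M_integrands) auto
  qed (use x in auto)
  moreover have "integral {0..} (\<lambda>t. exp (- t) * ?h t) = laplace_M0 x - laplace_M1 x / x - 1 / x"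
  proof -
    have ai0: "(\<lambda>t. exp (- t) * (1 / ?r t)) absolutely_integrable_on {0..}"
      using laplace_M_integrand_bounds[of x x] x by (intro laplace_absolutely_integrable continuous_on_laplace_M_integrands) auto
    have ai1: "(\<lambda>t. exp (- t) * (x / ?r t ^ 3)) absolutely_integrable_on {0..}"
      using laplace_M_integrand_bounds[of x x] x by (intro laplace_absolutely_integrable continuous_on_laplace_M_integrands) auto
    have aih: "(\<lambda>t. exp (- t) * ?h t) absolutely_integrable_on {0..}"
      using laplace_M_integrand_bounds[of x x] x by (intro laplace_absolutely_integrable continuous_on_laplace_M_integrands) auto
    note i0 = set_lebesgue_integral_eq_integral(1)[OF ai0]
      and i1 = set_lebesgue_integral_eq_integral(1)[OF ai1]
      and ih = set_lebesgue_integral_eq_integral(1)[OF aih]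
    let ?G = "\<lambda>t. exp (- t) * (1 / ?r t - t / ?r t ^ 3)"
    let ?g = "\<lambda>t. exp (- t) * ?h t + exp (- t) * (x / ?r t ^ 3) / x - exp (- t) * (1 / ?r t)"
    \<comment> \<open>For \<open>r = 1 / sqrt (x\<^sup>2 + t\<^sup>2)\<close> the integrand is \<open>exp (- t) (r'' - r)\<close>, the derivative of \<open>exp (- t) (r + r')\<close>.\<close>
    have "integral {0..} ?g = 0 - ?G 0"
    proof (rule integral_FTC_to_infinity)
      fix t :: real
      note r = r[of t]
      have sq: "x\<^sup>2 = ?r t ^ 2 - t\<^sup>2" by simp
      show "(?G has_field_derivative ?g t) (at t within {0..})"
      proof -
        have "(?r t ^ 2 - x\<^sup>2) / ?r t ^ 5 = 1 / ?r t ^ 3 - x\<^sup>2 / ?r t ^ 5"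
          unfolding diff_divide_distrib using r by (simp add: eval_nat_numeral del: real_sqrt_mult_self)
        then have sq: "t\<^sup>2 / ?r t ^ 5 = 1 / ?r t ^ 3 - x\<^sup>2 / ?r t ^ 5" by simp
        have e: "((\<lambda>t. exp (- t)) has_field_derivative - exp (- t)) (at t within {0..})"
          by (auto intro!: derivative_eq_intros)
        have d1: "((\<lambda>t. 1 / ?r t) has_field_derivative - (t / ?r t ^ 3)) (at t within {0..})"
          using inverse_power_sqrt_deriv(2)[OF x, where n = 1] by (simp add: numeral_3_eq_3)
        have d3: "((\<lambda>t. t / ?r t ^ 3) has_field_derivative 1 / ?r t ^ 3 - 3 * (t\<^sup>2 / ?r t ^ 5)) (at t within {0..})"
          using DERIV_mult'[OF DERIV_ident inverse_power_sqrt_deriv(2)[OF x, where n = 3]]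
          by (simp add: power2_eq_square mult_ac)
        show ?thesis
          by (rule DERIV_mult'[OF e DERIV_diff[OF d1 d3], THEN DERIV_cong])
            (unfold sq, use x in \<open>simp add: algebra_simps\<close>)
      qed
    next
      show "?g absolutely_integrable_on {0..}"
        by (intro set_integral_diff(1) set_integral_add(1) set_integrable_divide ai0 ai1 aih)
      show "(?G \<longlongrightarrow> 0) at_top"
      proof (rule Lim_null_comparison)
        show "\<forall>\<^sub>F t in at_top. norm (?G t) \<le> (1 / x + 1 / x\<^sup>2) * exp (- t)"
        proof (rule always_eventually, rule allI)
          fix t
          have "\<bar>t\<bar> \<le> ?r t" by (rule real_sqrt_ge_abs2)
          then have "\<bar>t / ?r t ^ 3\<bar> \<le> ?r t / ?r t ^ 3"
            using r[of t] by (simp add: abs_divide divide_right_mono)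
          also have "\<dots> = \<bar>1 / ?r t\<bar>\<^sup>2" using r[of t]
            by (simp add: eval_nat_numeral del: real_sqrt_mult_self)
          also have "\<dots> \<le> (1 / x)\<^sup>2" using laplace_M_integrand_bounds(1)[of x x t] x by (intro power_mono) auto
          finally have "\<bar>1 / ?r t - t / ?r t ^ 3\<bar> \<le> 1 / x + 1 / x\<^sup>2"
            using laplace_M_integrand_bounds(1)[of x x t] x by (intro order_trans[OF abs_triangle_ineq4] add_mono) (auto simp: power_divide)
          then show "norm (?G t) \<le> (1 / x + 1 / x\<^sup>2) * exp (- t)"
            by (simp add: abs_mult)
        qed
        show "((\<lambda>t. (1 / x + 1 / x\<^sup>2) * exp (- t)) \<longlongrightarrow> 0) at_top"
          by (intro tendsto_mult_right_zero filterlim_compose[OF exp_at_bot filterlim_uminus_at_bot_at_top])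
      qed
    qed
    moreover have "integral {0..} ?g = integral {0..} (\<lambda>t. exp (- t) * ?h t) + laplace_M1 x / x - laplace_M0 x"
      unfolding laplace_M0_def laplace_M1_def integral_divide[symmetric]
      by (subst integral_diff, intro integrable_add integrable_on_divide ih i1, rule i0)
        (subst integral_add, rule ih, intro integrable_on_divide i1, rule refl)
    ultimately show ?thesis using x by simp
  qed
  ultimately show ?thesis by simp
qed

lemma laplace_M0_bound: "x > 0 \<Longrightarrow> \<bar>laplace_M0 x\<bar> \<le> 1 / x"
  unfolding laplace_M0_def using laplace_M_integrand_bounds(1)[of x x]
  by (intro laplace_bound continuous_on_laplace_M_integrands) auto

lemma laplace_M1_bound: "x > 0 \<Longrightarrow> \<bar>laplace_M1 x\<bar> \<le> 1 / x\<^sup>2"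
  unfolding laplace_M1_def using laplace_M_integrand_bounds(2)[of x x]
  by (intro laplace_bound continuous_on_laplace_M_integrands) auto


section \<open>The Laplace integral near zero\<close>

lemma Gamma_integrand_has_integral:
  fixes z :: real
  assumes "z > 0"
  shows "((\<lambda>t. exp (- t) * t powr (z - 1)) has_integral Gamma z) {0<..}"
proof -
  have "((\<lambda>t. exp (- t) * t powr (z - 1)) has_integral Gamma z) {0..}"
    using Gamma_integral_real[OF assms] by (simp add: exp_minus field_simps)
  then show ?thesis
    by (subst (asm) has_integral_spike_set_eq[where T = "{0<..}"])
      (auto intro: negligible_subset[of "{0}"])
qed

text \<open>A single majorant for both limits below: a combination of the Gamma integrands at 1, 2
  and 1/2 that dominates \<open>exp (- t) * \<bar>ln t\<bar>\<close> at both ends of the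
  half-line.\<close>

definition log_dominant :: "real \<Rightarrow> real" where
  "log_dominant t = exp (- t) * (1 + 3 * t + 2 * t powr (- 1 / 2))"

lemma log_dominant_integrable: "log_dominant integrable_on {0<..}"
proof -
  have *: "(\<lambda>t. exp (- t) * t powr (z - 1)) integrable_on {0<..}" if "z > 0" for z :: real
    using Gamma_integrand_has_integral[OF that] by (auto simp: integrable_on_def)
  have "(\<lambda>t. exp (- t) * t powr (1 - 1) + 3 * (exp (- t) * t powr (2 - 1))
      + 2 * (exp (- t) * t powr (1 / 2 - 1))) integrable_on {0::real<..}"
    by (intro integrable_add integrable_on_mult_right *) auto
  then show ?thesis
    by (rule integrable_eq) (auto simp: log_dominant_def algebra_simps)
qed

lemma abs_ln_le:
  fixes t :: real
  assumes "t > 0"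
  shows "\<bar>ln t\<bar> \<le> t + 2 * t powr (- 1 / 2)"
proof (cases "t \<ge> 1")
  case True
  then show ?thesis using ln_le_minus_one[OF assms] by (smt (verit) ln_ge_zero powr_ge_zero)
next
  case False
  have "- ln t = 2 * ln (t powr (- 1 / 2))" using assms by (simp add: ln_powr)
  also have "\<dots> \<le> 2 * t powr (- 1 / 2)"
    using assms ln_le_minus_one[of "t powr (- 1 / 2)"] by simp
  finally show ?thesis using False assms by (simp add: abs_if)
qed

text \<open>The integral is the derivative of \<open>Gamma\<close> at 1. It is reached through the
  difference quotients of \<open>Gamma\<close> with steps \<open>1 / (n + 1)\<close>, whose
  integrands converge to \<open>exp (- t) * ln t\<close>.\<close>

lemma integral_exp_minus_ln:
  "((\<lambda>t::real. exp (- t) * ln t) has_integral - euler_mascheroni) {0<..}"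
proof -
  define h where "h = (\<lambda>n. 1 / real (Suc n))"
  have h: "0 < h n" "h n \<le> 1" for n by (auto simp: h_def)
  have h0: "h \<longlonglongrightarrow> 0" unfolding h_def by (rule lim_1_over_n[THEN LIMSEQ_Suc])
  let ?f = "\<lambda>n t. exp (- t) * ((t powr h n - 1) / h n)"
  have fi: "(?f n has_integral (Gamma (1 + h n) - 1) / h n) {0<..}" for n
  proof -
    have "((\<lambda>t. (exp (- t) * t powr (1 + h n - 1) - exp (- t) * t powr (1 - 1)) / h n)
      has_integral (Gamma (1 + h n) - Gamma 1) / h n) {0<..}"
      using h[of n] by (intro has_integral_divide has_integral_diff Gamma_integrand_has_integral) auto
    then show ?thesis by (rule has_integral_eq[rotated, THEN has_integral_eq_rhs]) (auto simp: algebra_simps diff_divide_distrib)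
  qed
  have lim: "(\<lambda>n. ((t powr h n - 1) / h n)) \<longlonglongrightarrow> ln t" if t: "t > 0" for t :: real
  proof -
    have "((\<lambda>a. t powr a) has_field_derivative ln t) (at 0)"
      using t by (auto intro!: derivative_eq_intros)
    then have "((\<lambda>a. (t powr a - 1) / a) \<longlongrightarrow> ln t) (at 0)"
      using t by (simp add: has_field_derivative_iff)
    moreover have "filterlim h (at 0) sequentially"
      using h h0 by (auto simp: filterlim_at intro!: always_eventually) (metis less_irrefl)
    ultimately show ?thesis by (rule filterlim_compose)
  qed
  have dom: "norm (?f n t) \<le> log_dominant t" if "t \<in> {0<..}" for n t
  proof -
    have t: "t > 0" using that by simp
    have lower: "(t powr h n - 1) / h n \<ge> ln t"
    proof -
      have "1 + h n * ln t \<le> t powr h n"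
        using exp_ge_add_one_self[of "h n * ln t"] t by (simp add: powr_def)
      then show ?thesis using h(1)[of n] by (simp add: pos_le_divide_eq mult.commute)
    qed
    have upper: "(t powr h n - 1) / h n \<le> t"
    proof -
      \<comment> \<open>Weighted arithmetic-geometric mean of \<open>t\<close> and 1; this is where
        steps of length at most 1 are required.\<close>
      have "t powr h n \<le> 1 + h n * (t - 1)"
      proof -
        have "t powr h n * 1 powr (1 - h n) \<le> h n * t + (1 - h n) * 1"
          using h[of n] t by (intro Youngs_inequality_0) auto
        then show ?thesis by (simp add: algebra_simps)
      qed
      then have "t powr h n - 1 \<le> h n * t" using h(1)[of n] by (simp add: algebra_simps)
      then show ?thesis using h(1)[of n] by (simp add: pos_divide_le_eq mult.commute)
    qed
    have "\<bar>(t powr h n - 1) / h n\<bar> \<le> 1 + 3 * t + 2 * t powr (- 1 / 2)"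
      using lower upper abs_ln_le[OF t] t powr_ge_zero[of t "- 1 / 2"] by linarith
    from mult_left_mono[OF this, of "exp (- t)"] show ?thesis
      by (simp only: log_dominant_def real_norm_def abs_mult abs_exp_cancel exp_ge_zero)
  qed
  have 1: "(\<lambda>t::real. exp (- t) * ln t) integrable_on {0<..}"
  proof (rule dominated_convergence(1)[OF _ log_dominant_integrable])
    show "?f n integrable_on {0<..}" for n using fi[of n] by (auto simp: integrable_on_def)
    show "(\<lambda>n. ?f n t) \<longlonglongrightarrow> exp (- t) * ln t" if "t \<in> {0<..}" for t
      using lim that by (intro tendsto_mult_left) auto
  qed (rule dom)
  have 2: "(\<lambda>n. integral {0<..} (?f n)) \<longlonglongrightarrow> integral {0<..} (\<lambda>t::real. exp (- t) * ln t)"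
  proof (rule dominated_convergence(2)[OF _ log_dominant_integrable])
    show "?f n integrable_on {0<..}" for n using fi[of n] by (auto simp: integrable_on_def)
    show "(\<lambda>n. ?f n t) \<longlonglongrightarrow> exp (- t) * ln t" if "t \<in> {0<..}" for t
      using lim that by (intro tendsto_mult_left) auto
  qed (rule dom)
  have "(Gamma has_field_derivative Gamma 1 * Digamma 1) (at (1::real))"
    by (rule has_field_derivative_Gamma) simp
  then have "((\<lambda>a. (Gamma (1 + a) - 1) / a) \<longlongrightarrow> - euler_mascheroni) (at (0::real))"
    by (simp add: DERIV_def)
  moreover have "filterlim h (at 0) sequentially"
    using h h0 by (auto simp: filterlim_at intro!: always_eventually) (metis less_irrefl)
  ultimately have "(\<lambda>n. (Gamma (1 + h n) - 1) / h n) \<longlonglongrightarrow> - euler_mascheroni"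
    by (rule filterlim_compose)
  with 2[unfolded fi[THEN integral_unique]]
  have "integral {0<..} (\<lambda>t::real. exp (- t) * ln t) = - euler_mascheroni"
    by (rule LIMSEQ_unique)
  with 1 show ?thesis by (metis integrable_integral)
qed

text \<open>Isolates the logarithmic singularity at \<open>x = 0\<close>: integrating
  \<open>1 / sqrt (x^2 + t^2)\<close> to \<open>ln (t + sqrt (x^2 + t^2))\<close> gives an integrand
  that has a dominated limit. Working with the logarithm minus \<open>ln x\<close> makes the
  boundary term at \<open>t = 0\<close> vanish.\<close>

lemma laplace_M0_by_parts:
  assumes x: "x > 0"
  shows "((\<lambda>t. exp (- t) * ln (t + sqrt (x\<^sup>2 + t\<^sup>2))) has_integral laplace_M0 x + ln x) {0<..}"
proof -
  let ?r = "\<lambda>t. sqrt (x\<^sup>2 + t\<^sup>2)"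
  let ?L = "\<lambda>t. ln (t + ?r t)"
  have r: "?r t \<ge> x" "?r t > 0" for t
    by (rule real_sqrt_sum_squares_ge1) (rule sqrt_sum_pos[OF x])
  have pos: "t + ?r t > 0" if "t \<ge> 0" for t using r(2)[of t] that by linarith
  have ai0: "(\<lambda>t. exp (- t) * (1 / ?r t)) absolutely_integrable_on {0..}"
    using laplace_M_integrand_bounds[of x x] x by (intro laplace_absolutely_integrable continuous_on_laplace_M_integrands) auto
  have bG: "\<bar>exp (- t) * (?L t - ln x)\<bar> \<le> exp (- t / 2) * (4 / x)" if t: "t \<ge> 0" for t
  proof -
    have rt: "?r t \<le> x + t" using x t by (intro real_le_lsqrt) (auto simp: power2_eq_square algebra_simps)
    have "x \<le> t + ?r t" using r(1)[of t] t by linarith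
    then have "ln x \<le> ?L t" using x pos[OF t] by (subst ln_le_cancel_iff)
    moreover have "?L t - ln x \<le> 2 * t / x"
    proof -
      have "?L t - ln x = ln ((t + ?r t) / x)" using pos[OF t] x by (simp add: ln_div)
      also have "\<dots> \<le> (t + ?r t) / x - 1" using pos[OF t] x by (intro ln_le_minus_one) auto
      also have "\<dots> = (t + ?r t - x) / x" using x by (simp add: diff_divide_distrib)
      also have "\<dots> \<le> 2 * t / x" using rt x by (intro divide_right_mono) linarith+
      finally show ?thesis .
    qed
    ultimately have "\<bar>?L t - ln x\<bar> \<le> 2 * t / x" by linarith
    then have b: "\<bar>exp (- t) * (?L t - ln x)\<bar> \<le> exp (- t) * (2 * t / x)"
      unfolding abs_mult by (intro mult_mono) auto
    have "t / 2 \<le> exp (t / 2)" using exp_ge_add_one_self[of "t / 2"] by linarith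
    then have "exp (- t) * (2 * t / x) \<le> exp (- t) * (4 * exp (t / 2) / x)"
      using x by (intro mult_left_mono divide_right_mono) auto
    also have "exp (- t) * (4 * exp (t / 2) / x) = exp (- t / 2) * (4 / x)"
    proof -
      have "exp (- t) * exp (t / 2) = exp (- t / 2)" by (simp flip: exp_add)
      then show ?thesis by (metis (no_types, opaque_lifting) mult.assoc mult.commute times_divide_eq_right)
    qed
    finally show ?thesis using b by linarith
  qed
  have aiL: "(\<lambda>t. exp (- t) * (?L t - ln x)) absolutely_integrable_on {0..}"
  proof (rule absolutely_integrable_continuous_dominated)
    show "continuous_on {0..} (\<lambda>t. exp (- t) * (?L t - ln x))"
      using pos x by (intro continuous_intros) (force simp: less_imp_neq[THEN not_sym])+
    show "(\<lambda>t. exp (- t / 2) * (4 / x)) integrable_on {0..}"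
      using has_integral_exp_minus_to_infinity[of "1 / 2" 0]
      by (intro integrable_on_mult_left) (auto simp: integrable_on_def)
  qed (use bG in auto)
  let ?G = "\<lambda>t. exp (- t) * (?L t - ln x)"
  let ?g = "\<lambda>t. exp (- t) * (1 / ?r t) - ?G t"
  note i0 = set_lebesgue_integral_eq_integral(1)[OF ai0] and iL = set_lebesgue_integral_eq_integral(1)[OF aiL]
  have "integral {0..} ?g = 0 - ?G 0"
  proof (rule integral_FTC_to_infinity)
    show "?g absolutely_integrable_on {0..}" by (intro set_integral_diff(1) ai0 aiL)
    show "(?G has_field_derivative ?g t) (at t within {0..})" if t: "t \<ge> 0" for t
    proof -
      have q: "x\<^sup>2 + t\<^sup>2 > 0" using r(2)[of t] by simp
      have "(?L has_field_derivative 1 / ?r t) (at t within {0..})"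
        using pos[OF t] r(2)[of t] q x
        by (auto intro!: derivative_eq_intros simp: field_simps)
      note d = this
      have e: "((\<lambda>t. exp (- t)) has_field_derivative - exp (- t)) (at t within {0..})"
        by (auto intro!: derivative_eq_intros)
      show ?thesis
        by (rule DERIV_mult'[OF e DERIV_diff[OF d DERIV_const], THEN DERIV_cong]) (simp add: algebra_simps)
    qed
    show "(?G \<longlongrightarrow> 0) at_top"
    proof (rule Lim_null_comparison)
      show "\<forall>\<^sub>F t in at_top. norm (?G t) \<le> exp (- t / 2) * (4 / x)"
        using eventually_ge_at_top[of 0] by eventually_elim (use bG in auto)
      have "filterlim (\<lambda>t::real. 1 / 2 * - t) at_bot at_top"
        by (rule filterlim_tendsto_pos_mult_at_bot[OF tendsto_const _ filterlim_uminus_at_bot_at_top]) simp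
      then have "((\<lambda>t::real. exp (- t / 2)) \<longlongrightarrow> 0) at_top"
        by (intro filterlim_compose[OF exp_at_bot]) simp
      then show "((\<lambda>t. exp (- t / 2) * (4 / x)) \<longlongrightarrow> 0) at_top"
        by (rule tendsto_mult_left_zero)
    qed
  qed
  moreover have "?G 0 = 0" using x by simp
  ultimately have "integral {0..} ?G = laplace_M0 x"
    unfolding laplace_M0_def using integral_diff[OF i0 iL] by simp
  then have "(?G has_integral laplace_M0 x) {0..}" using iL by (metis integrable_integral)
  moreover have "((\<lambda>t. exp (- t) * ln x) has_integral ln x) {0..}"
    using has_integral_mult_left[OF has_integral_exp_minus_to_infinity[of 1 0], of "ln x"] by simp
  ultimately have "((\<lambda>t. ?G t + exp (- t) * ln x) has_integral laplace_M0 x + ln x) {0..}"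
    by (rule has_integral_add)
  then have "((\<lambda>t. exp (- t) * ?L t) has_integral laplace_M0 x + ln x) {0..}"
    by (simp add: algebra_simps)
  then show ?thesis
    by (subst (asm) has_integral_spike_set_eq[where T = "{0<..}"])
      (auto intro: negligible_subset[of "{0}"])
qed


lemma laplace_M0_tendsto_at_0: "((\<lambda>x. laplace_M0 x + ln (x / 2)) \<longlongrightarrow> - euler_mascheroni) (at_right 0)"
proof (rule tendsto_at_right_sequentially[of 0 1])
  fix X :: "nat \<Rightarrow> real"
  assume X: "\<And>n. 0 < X n" "\<And>n. X n < 1" and X0: "X \<longlonglongrightarrow> 0"
  let ?f = "\<lambda>n t. exp (- t) * ln (t + sqrt ((X n)\<^sup>2 + t\<^sup>2))"
  have "(\<lambda>n. integral {0<..} (?f n)) \<longlonglongrightarrow> integral {0<..} (\<lambda>t. exp (- t) * ln (2 * t))"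
  proof (rule dominated_convergence(2)[OF _ log_dominant_integrable])
    show "?f n integrable_on {0<..}" for n
      using laplace_M0_by_parts[OF X(1)[of n]] by (auto simp: integrable_on_def)
    fix t :: real assume "t \<in> {0<..}"
    then have t: "t > 0" by simp
    show "norm (?f n t) \<le> log_dominant t" for n
    proof -
      let ?r = "sqrt ((X n)\<^sup>2 + t\<^sup>2)"
      have "t \<le> ?r" by (rule real_sqrt_sum_squares_ge2)
      moreover have "?r \<le> t + 1"
      proof (rule real_le_lsqrt)
        have "(X n)\<^sup>2 \<le> 1" using X[of n] by (intro power_le_one) auto
        then show "(X n)\<^sup>2 + t\<^sup>2 \<le> (t + 1)\<^sup>2" using t by (simp add: power2_eq_square algebra_simps)
      qed (use t in auto)
      ultimately have b: "t \<le> t + ?r" "t + ?r \<le> 2 * t + 1" using t by linarith+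
      have "ln t \<le> ln (t + ?r)" using b(1) t by (subst ln_le_cancel_iff) linarith+
      moreover have "ln (t + ?r) \<le> 2 * t"
        using ln_le_minus_one[of "t + ?r"] b t by linarith
      ultimately have "\<bar>ln (t + ?r)\<bar> \<le> 1 + 3 * t + 2 * t powr (- 1 / 2)"
        using abs_ln_le[OF t] t powr_ge_zero[of t "- 1 / 2"] by linarith
      from mult_left_mono[OF this, of "exp (- t)"] show ?thesis
        by (simp only: log_dominant_def real_norm_def abs_mult abs_exp_cancel exp_ge_zero)
    qed
    have "(\<lambda>n. ?f n t) \<longlonglongrightarrow> exp (- t) * ln (t + sqrt (0\<^sup>2 + t\<^sup>2))"
      using t by (intro tendsto_intros X0) auto
    then show "(\<lambda>n. ?f n t) \<longlonglongrightarrow> exp (- t) * ln (2 * t)" using t by simp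
  qed
  moreover have "((\<lambda>t::real. exp (- t) * ln (2 * t)) has_integral ln 2 - euler_mascheroni) {0<..}"
  proof -
    have "((\<lambda>t. ln 2 * (exp (- t) * t powr (1 - 1)) + exp (- t) * ln t) has_integral ln 2 * Gamma 1 + - euler_mascheroni) {0::real<..}"
      by (intro has_integral_add has_integral_mult_right Gamma_integrand_has_integral integral_exp_minus_ln) simp
    then show ?thesis
      by (rule has_integral_eq[rotated, THEN has_integral_eq_rhs]) (auto simp: ln_mult algebra_simps)
  qed
  ultimately have "(\<lambda>n. laplace_M0 (X n) + ln (X n)) \<longlonglongrightarrow> ln 2 - euler_mascheroni"
    using integral_unique[OF laplace_M0_by_parts[OF X(1)]] by (simp add: integral_unique)
  then have "(\<lambda>n. laplace_M0 (X n) + ln (X n) - ln 2) \<longlonglongrightarrow> ln 2 - euler_mascheroni - ln 2"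
    by (intro tendsto_intros)
  moreover have "laplace_M0 (X n) + ln (X n) - ln 2 = laplace_M0 (X n) + ln (X n / 2)" for n
    using X(1)[of n] by (simp add: ln_div)
  ultimately show "(\<lambda>n. laplace_M0 (X n) + ln (X n / 2)) \<longlonglongrightarrow> - euler_mascheroni" by simp
qed auto

text \<open>The phase covers three cases at once: \<open>\<phi> = 0\<close> gives
  \<open>pi * J_0\<close>, \<open>\<phi> = - pi / 2\<close> gives the sine integral in the formula
  for \<open>Y_0\<close>, and \<open>\<phi> = - pi\<close> gives \<open>- pi * J_0\<close>
  again.\<close>

definition trig_S0 :: "real \<Rightarrow> real \<Rightarrow> real" where
  "trig_S0 \<phi> x = integral {0..pi} (\<lambda>t. cos (x * sin t + \<phi>))"

definition trig_S1 :: "real \<Rightarrow> real \<Rightarrow> real" where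
  "trig_S1 \<phi> x = integral {0..pi} (\<lambda>t. sin t * sin (x * sin t + \<phi>))"

lemma has_field_derivative_trig_S0: "(trig_S0 \<phi> has_field_derivative - trig_S1 \<phi> x) (at x)"
proof -
  have "((\<lambda>x. integral (cbox 0 pi) (\<lambda>t. cos (x * sin t + \<phi>))) has_field_derivative
      integral (cbox 0 pi) (\<lambda>t. - (sin t * sin (x * sin t + \<phi>)))) (at x within UNIV)"
    by (rule leibniz_rule_field_derivative)
      (auto intro!: derivative_eq_intros continuous_intros integrable_continuous_interval simp: split_beta)
  then show ?thesis by (simp add: trig_S0_def[abs_def] trig_S1_def)
qed

text \<open>The inhomogeneity consists of the boundary values of
  \<open>cos t * sin (x * sin t + \<phi>)\<close>. It is zero for \<open>\<phi> = 0\<close>; for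
  \<open>\<phi> = - pi / 2\<close> it is \<open>- 2 / x\<close> and cancels the one produced by
  \<open>- 2 * laplace_M1\<close>.\<close>

lemma has_field_derivative_trig_S1:
  assumes x: "x > 0"
  shows "(trig_S1 \<phi> has_field_derivative trig_S0 \<phi> x - trig_S1 \<phi> x / x + 2 * sin \<phi> / x) (at x)"
proof -
  let ?u = "\<lambda>t. x * sin t + \<phi>"
  have "((\<lambda>x. integral (cbox 0 pi) (\<lambda>t. sin t * sin (x * sin t + \<phi>))) has_field_derivative
      integral (cbox 0 pi) (\<lambda>t. sin t * (sin t * cos (?u t)))) (at x within UNIV)"
    by (rule leibniz_rule_field_derivative)
      (auto intro!: derivative_eq_intros continuous_intros integrable_continuous_interval simp: split_beta)
  then have "(trig_S1 \<phi> has_field_derivative integral {0..pi} (\<lambda>t. sin t * (sin t * cos (?u t)))) (at x)"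
    by (simp add: trig_S1_def[abs_def])
  moreover have "integral {0..pi} (\<lambda>t. sin t * (sin t * cos (?u t))) = trig_S0 \<phi> x - trig_S1 \<phi> x / x + 2 * sin \<phi> / x"
  proof -
    have "((\<lambda>t. - (sin t * sin (?u t)) + x * (cos (?u t) - sin t * (sin t * cos (?u t)))) has_integral
        cos pi * sin (?u pi) - cos 0 * sin (?u 0)) {0..pi}"
    proof (rule fundamental_theorem_of_calculus)
      fix t :: real
      have c: "cos t * (cos t * y) = y - sin t * (sin t * y)" for y
      proof -
        have "cos t * cos t = 1 - sin t * sin t"
          using sin_cos_squared_add[of t] by (simp add: power2_eq_square)
        then have "cos t * cos t * y = (1 - sin t * sin t) * y" by simp
        then show ?thesis by (simp add: algebra_simps)
      qed
      show "((\<lambda>t. cos t * sin (?u t)) has_vector_derivative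
          - (sin t * sin (?u t)) + x * (cos (?u t) - sin t * (sin t * cos (?u t)))) (at t within {0..pi})"
        unfolding has_real_derivative_iff_has_vector_derivative[symmetric] c[symmetric]
        by (auto intro!: derivative_eq_intros)
    qed auto
    then have "integral {0..pi} (\<lambda>t. - (sin t * sin (?u t)) + x * (cos (?u t) - sin t * (sin t * cos (?u t))))
        = - 2 * sin \<phi>" by (simp add: integral_unique)
    moreover have "integral {0..pi} (\<lambda>t. - (sin t * sin (?u t)) + x * (cos (?u t) - sin t * (sin t * cos (?u t))))
        = - trig_S1 \<phi> x + x * (trig_S0 \<phi> x - integral {0..pi} (\<lambda>t. sin t * (sin t * cos (?u t))))"
      unfolding trig_S0_def trig_S1_def
      by (rule integral_unique, intro has_integral_add has_integral_neg has_integral_mult_right has_integral_diff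
          integrable_integral integrable_continuous_interval continuous_intros)
    ultimately show ?thesis using x by (simp add: field_simps)
  qed
  ultimately show ?thesis by simp
qed

text \<open>The difference has the amplitude \<open>sin t - 1 = - (cos t)^2 / (1 + sin t)\<close>,
  which vanishes at the stationary point \<open>pi / 2\<close> of the phase. One factor
  \<open>cos t\<close> makes \<open>sin (x * sin t + \<phi>)\<close> exact, so integration by parts
  gains \<open>1 / x\<close>; the boundary contributes 2 and the remaining integral
  \<open>pi\<close>.\<close>

lemma trig_S1_minus_trig_S0_bound:
  assumes x: "x > 0"
  shows "\<bar>trig_S1 \<phi> x - trig_S0 (\<phi> - pi / 2) x\<bar> \<le> (2 + pi) / x"
proof -
  let ?u = "\<lambda>t. x * sin t + \<phi>"
  let ?F = "\<lambda>t. cos t / (1 + sin t) * cos (?u t) / x"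
  let ?g = "\<lambda>t. cos (?u t) / (1 + sin t) / x"
  have s: "1 + sin t > 0" "1 / (1 + sin t) \<le> 1" if "t \<in> {0..pi}" for t
    using sin_ge_zero[of t] that by auto
  have i: "((\<lambda>t. - (?g t) - cos t * cos t / (1 + sin t) * sin (?u t)) has_integral ?F pi - ?F 0) {0..pi}"
  proof (rule fundamental_theorem_of_calculus)
    fix t :: real assume t: "t \<in> {0..pi}"
    have "((\<lambda>t. cos t / (1 + sin t)) has_field_derivative - (1 / (1 + sin t))) (at t within {0..pi})"
    proof (rule DERIV_cong)
      show "((\<lambda>t. cos t / (1 + sin t)) has_field_derivative
          (- sin t * (1 + sin t) - cos t * cos t) / ((1 + sin t) * (1 + sin t))) (at t within {0..pi})"
        using s[OF t] by (auto intro!: derivative_eq_intros)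
      have "- sin t * (1 + sin t) - cos t * cos t = - (1 + sin t)"
        using sin_cos_squared_add[of t] by (simp add: power2_eq_square algebra_simps)
      moreover have "- a / (a * a) = - (1 / a)" if "a > 0" for a :: real using that by simp
      from this[OF s(1)[OF t]] have "- (1 + sin t) / ((1 + sin t) * (1 + sin t)) = - (1 / (1 + sin t))" .
      ultimately show "(- sin t * (1 + sin t) - cos t * cos t) / ((1 + sin t) * (1 + sin t)) = - (1 / (1 + sin t))"
        by (simp only:)
    qed
    note d = this
    show "(?F has_vector_derivative - (?g t) - cos t * cos t / (1 + sin t) * sin (?u t)) (at t within {0..pi})"
      unfolding has_real_derivative_iff_has_vector_derivative[symmetric]
    proof (rule DERIV_cong[OF DERIV_cdivide[OF DERIV_mult'[OF d]]])
      show "((\<lambda>t. cos (?u t)) has_field_derivative - (x * cos t) * sin (?u t)) (at t within {0..pi})"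
        by (auto intro!: derivative_eq_intros)
      have "(c / r * (- (x * c) * S) + - (1 / r) * C) / x = - (C / r / x) - c * c / r * S" if "r > 0" for r c S C :: real
        using x that by (simp add: field_simps)
      from this[OF s(1)[OF t]]
      show "(cos t / (1 + sin t) * (- (x * cos t) * sin (?u t)) + - (1 / (1 + sin t)) * cos (?u t)) / x =
          - (?g t) - cos t * cos t / (1 + sin t) * sin (?u t)" .
    qed
  qed auto
  have g: "?g integrable_on {0..pi}"
    using s x by (intro integrable_continuous_interval continuous_intros) (auto simp: less_imp_neq[THEN not_sym])
  have c1: "(\<lambda>t. sin t * sin (?u t)) integrable_on {0..pi}" and c2: "(\<lambda>t. sin (?u t)) integrable_on {0..pi}"
    by (intro integrable_continuous_interval continuous_intros)+
  have "trig_S1 \<phi> x - trig_S0 (\<phi> - pi / 2) x = integral {0..pi} (\<lambda>t. sin t * sin (?u t) - sin (?u t))"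
  proof -
    have "cos (x * sin t + (\<phi> - pi / 2)) = sin (?u t)" for t
      by (simp add: cos_diff cos_add sin_add algebra_simps)
    then show ?thesis unfolding trig_S1_def trig_S0_def using integral_diff[OF c1 c2] by simp
  qed
  also have "\<dots> = integral {0..pi} (\<lambda>t. (- (?g t) - cos t * cos t / (1 + sin t) * sin (?u t)) + ?g t)"
  proof (rule integral_cong)
    fix t :: real assume t: "t \<in> {0..pi}"
    have "cos t * cos t = (1 - sin t) * (1 + sin t)"
      using sin_cos_squared_add[of t] by (simp add: power2_eq_square algebra_simps)
    then have "cos t * cos t / (1 + sin t) = 1 - sin t" using s[OF t] by simp
    then show "sin t * sin (?u t) - sin (?u t) = (- (?g t) - cos t * cos t / (1 + sin t) * sin (?u t)) + ?g t"
      by (simp only:) (simp add: algebra_simps)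
  qed
  also have "\<dots> = (?F pi - ?F 0) + integral {0..pi} ?g"
    using has_integral_add[OF i integrable_integral[OF g]] by (rule integral_unique)
  finally have e: "trig_S1 \<phi> x - trig_S0 (\<phi> - pi / 2) x = (?F pi - ?F 0) + integral {0..pi} ?g" .
  have "norm (integral {0..pi} ?g) \<le> integral {0..pi} (\<lambda>t. 1 / x)"
  proof (rule integral_norm_bound_integral[OF g])
    fix t :: real assume t: "t \<in> {0..pi}"
    have "\<bar>cos (?u t)\<bar> * (1 / (1 + sin t)) \<le> 1 * 1"
      using s[OF t] by (intro mult_mono) auto
    then have "\<bar>cos (?u t)\<bar> * (1 / (1 + sin t)) / x \<le> 1 / x"
      using x by (intro divide_right_mono) auto
    then show "norm (?g t) \<le> 1 / x" using x s(1)[OF t] by (simp add: abs_divide)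
  qed auto
  then have b: "\<bar>integral {0..pi} ?g\<bar> \<le> pi / x" by simp
  have "\<bar>?F pi - ?F 0\<bar> = 2 * \<bar>cos \<phi>\<bar> / x" using x by (simp add: abs_divide)
  also have "\<dots> \<le> 2 / x" using x by (intro divide_right_mono) auto
  finally have f: "\<bar>?F pi - ?F 0\<bar> \<le> 2 / x" .
  show ?thesis unfolding e add_divide_distrib using f b by linarith
qed

lemma trig_S0_at_0: "trig_S0 \<phi> 0 = pi * cos \<phi>"
  by (simp add: trig_S0_def)

lemma trig_S0_minus_pi: "trig_S0 (- pi) x = - trig_S0 0 x"
  by (simp add: trig_S0_def cos_diff)

section \<open>Integral representations of order zero\<close>

lemma eventually_at_right_0I:
  "(\<And>x. x > 0 \<Longrightarrow> P x) \<Longrightarrow> \<forall>\<^sub>F x in at_right (0::real). P x"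
  by (auto simp: eventually_at_filter)

lemma tendsto_at_rightI: "(f \<longlongrightarrow> l) (at a) \<Longrightarrow> (f \<longlongrightarrow> l) (at_right a)"
  by (rule tendsto_mono[OF at_le[OF subset_UNIV]])

lemma constant_on_pos:
  fixes f :: "real \<Rightarrow> real"
  assumes "\<And>x. x > 0 \<Longrightarrow> (f has_field_derivative 0) (at x)"
  obtains c where "\<And>x. x > 0 \<Longrightarrow> f x = c"
proof -
  have "\<exists>c. \<forall>x\<in>{0<..}. f x = c"
    by (rule has_field_derivative_zero_constant) (auto intro: assms has_field_derivative_at_within)
  then show thesis using that by auto
qed

section \<open>Wronskians and uniqueness for the order-zero equation\<close>

lemma wronskian_constant:
  fixes a0 a1 b0 b1 :: "real \<Rightarrow> real"
  assumes "\<And>x. x > 0 \<Longrightarrow> (a0 has_field_derivative - a1 x) (at x)"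
    "\<And>x. x > 0 \<Longrightarrow> (a1 has_field_derivative a0 x - a1 x / x) (at x)"
    "\<And>x. x > 0 \<Longrightarrow> (b0 has_field_derivative - b1 x) (at x)"
    "\<And>x. x > 0 \<Longrightarrow> (b1 has_field_derivative b0 x - b1 x / x) (at x)"
  obtains c where "\<And>x::real. x > 0 \<Longrightarrow> x * (a0 x * b1 x - a1 x * b0 x) = c"
proof (rule constant_on_pos)
  fix x :: real assume x: "x > 0"
  show "((\<lambda>x. x * (a0 x * b1 x - a1 x * b0 x)) has_field_derivative 0) (at x)"
    by (rule derivative_eq_intros refl assms x)+ (use x in \<open>simp add: field_simps\<close>)
qed (use that in blast)

lemma bessel_ser_at_0: "bessel_ser r p 0 = r (p + 1)"
proof -
  have "bessel_ser r p 0 = (\<Sum>m. if m = 0 then r (p + 1) else 0)"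
    unfolding bessel_ser_def by (intro suminf_cong) auto
  also have "\<dots> = r (p + 1)" using suminf_finite[of "{0::nat}" "\<lambda>m. if m = 0 then r (p + 1) else 0"] by simp
  finally show ?thesis .
qed

lemma tendsto_bessel_ser_sq_at_0:
  assumes "bounded_right r"
  shows "((\<lambda>x. bessel_ser r p (x\<^sup>2 / 4)) \<longlongrightarrow> r (p + 1)) (at_right 0)"
proof -
  have "isCont (\<lambda>x. bessel_ser r p (x\<^sup>2 / 4)) 0"
    by (rule DERIV_isCont[OF bessel_ser_sq_deriv[OF assms]])
  then show ?thesis
    unfolding isCont_def by (intro tendsto_at_rightI) (simp add: bessel_ser_at_0)
qed

lemma bessel_J_0_at_0: "(bessel_J_int 0 \<longlongrightarrow> 1) (at_right 0)"
proof (rule Lim_transform_eventually[OF tendsto_bessel_ser_sq_at_0[OF bounded_right_rGamma, of 0, simplified]])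
  show "\<forall>\<^sub>F x in at_right 0. bessel_ser rGamma 0 (x\<^sup>2 / 4) = bessel_J_int 0 x"
    by (rule eventually_at_right_0I) (simp add: bessel_J_eq)
qed

lemma x_ln_x_at_0: "((\<lambda>x::real. x * ln (x / 2)) \<longlongrightarrow> 0) (at_right 0)"
  by real_asymp

text \<open>As an even function, \<open>J_0\<close> has derivative 0 at the origin, so
  \<open>J_0 - 1\<close> is \<open>o(x)\<close> and outweighs the logarithm.\<close>

lemma bessel_J_0_minus_1_at_0: "((\<lambda>x. ln (x / 2) * (bessel_J_int 0 x - 1)) \<longlongrightarrow> 0) (at_right 0)"
proof -
  have v0: "bessel_ser rGamma 0 0 = 1"
    by (simp add: bessel_ser_at_0)
  have "((\<lambda>x. (bessel_ser rGamma 0 (x\<^sup>2 / 4) - 1) / x) \<longlongrightarrow> 0) (at 0)"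
    using bessel_ser_sq_deriv[OF bounded_right_rGamma, of 0 0] v0
    by (simp add: has_field_derivative_iff)
  then have "((\<lambda>x. (bessel_ser rGamma 0 (x\<^sup>2 / 4) - 1) / x) \<longlongrightarrow> 0) (at_right 0)"
    by (rule tendsto_at_rightI)
  from tendsto_mult[OF x_ln_x_at_0 this]
  have "((\<lambda>x. x * ln (x / 2) * ((bessel_ser rGamma 0 (x\<^sup>2 / 4) - 1) / x)) \<longlongrightarrow> 0) (at_right 0)" by simp
  then show ?thesis
    by (rule Lim_transform_eventually) (auto intro!: eventually_at_right_0I simp: bessel_J_eq)
qed

lemma bessel_Y_0_eq: "x > 0 \<Longrightarrow> pi / 2 * bessel_Y_int 0 x = bessel_Jh 0 x"
  unfolding bessel_Y_int_eq by (simp add: bessel_J_hat_eq)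

lemma bessel_Y_0_at_0: "((\<lambda>x. pi / 2 * bessel_Y_int 0 x - ln (x / 2)) \<longlongrightarrow> euler_mascheroni) (at_right 0)"
proof -
  have "((\<lambda>x. ln (x / 2) * (bessel_J_int 0 x - 1) + bessel_ser rGamma' 0 (x\<^sup>2 / 4)) \<longlongrightarrow> 0 + euler_mascheroni) (at_right 0)"
    using tendsto_bessel_ser_sq_at_0[OF bounded_right_rGamma', of 0]
    by (intro tendsto_add bessel_J_0_minus_1_at_0) (simp add: rGamma'_1)
  then show ?thesis
    by (rule Lim_transform_eventually[THEN tendsto_eq_rhs])
      (rule eventually_at_right_0I, unfold bessel_Y_0_eq bessel_Jh_def, simp_all add: algebra_simps)
qed

lemma ln_half_at_0: "filterlim (\<lambda>x::real. ln (x / 2)) at_bot (at_right 0)"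
  by real_asymp

lemma bessel_Y_0_at_bot: "filterlim (bessel_Y_int 0) at_bot (at_right 0)"
proof -
  have "filterlim (\<lambda>x::real. - ln (x / 2)) at_top (at_right 0)"
    using ln_half_at_0 by (simp add: filterlim_uminus_at_top)
  from filterlim_tendsto_add_at_top[OF tendsto_minus[OF bessel_Y_0_at_0] this]
  have "filterlim (\<lambda>x. pi / 2 * bessel_Y_int 0 x) at_bot (at_right 0)"
    by (simp add: filterlim_uminus_at_top)
  from filterlim_tendsto_pos_mult_at_bot[OF tendsto_const _ this, of "2 / pi"]
  show ?thesis by simp
qed

text \<open>The constant is evaluated in the limit at zero. The expression is first regrouped into
  factors with finite limits, such as \<open>x * ln (x / 2)\<close> and \<open>Y_0\<close> without
  its logarithm; the result is \<open>pi * c = - 2\<close>.\<close>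

lemma bessel_wronskian_nonzero:
  obtains c where "c \<noteq> 0" "\<And>x::real. x > 0 \<Longrightarrow> x * (bessel_J_int 0 x * bessel_Y_int 1 x - bessel_J_int 1 x * bessel_Y_int 0 x) = c"
proof -
  obtain c where c: "\<And>x::real. x > 0 \<Longrightarrow> x * (bessel_J_int 0 x * bessel_Y_int 1 x - bessel_J_int 1 x * bessel_Y_int 0 x) = c"
    using wronskian_constant[of "bessel_J_int 0" "bessel_J_int 1" "bessel_Y_int 0" "bessel_Y_int 1"]
      has_field_derivative_bessel_01 by blast
  have J1: "bessel_J_int 1 x = x / 2 * bessel_ser rGamma 1 (x\<^sup>2 / 4)" if "x > 0" for x
    using that by (simp add: bessel_J_eq)
  have Y1: "pi * bessel_Y_int 1 x = 2 * bessel_Jh 1 x - 2 / x * bessel_J_int 0 x" if "x > 0" for x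
    unfolding bessel_Y_int_eq[OF that]
    using bessel_J_hat_recurrence[OF that, of 0] that by (simp add: bessel_J_hat_eq)
  have lim1: "((\<lambda>x. bessel_ser rGamma 1 (x\<^sup>2 / 4)) \<longlongrightarrow> rGamma 2) (at_right 0)"
    using tendsto_bessel_ser_sq_at_0[OF bounded_right_rGamma, of 1] by simp
  have lim2: "((\<lambda>x. bessel_ser rGamma' 1 (x\<^sup>2 / 4)) \<longlongrightarrow> rGamma' 2) (at_right 0)"
    using tendsto_bessel_ser_sq_at_0[OF bounded_right_rGamma', of 1] by simp
  have x0: "((\<lambda>x::real. x) \<longlongrightarrow> 0) (at_right 0)" by (rule tendsto_ident_at)
  let ?\<Phi> = "\<lambda>x. bessel_ser rGamma 1 (x\<^sup>2 / 4)" and ?\<Psi> = "\<lambda>x. bessel_ser rGamma' 1 (x\<^sup>2 / 4)"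
  let ?e = "\<lambda>x. bessel_J_int 0 x * (x * (x * ln (x / 2)) * ?\<Phi> x + x * x * ?\<Psi> x - 2 * bessel_J_int 0 x)
      - x * ?\<Phi> x * (x * (pi / 2 * bessel_Y_int 0 x - ln (x / 2)) + x * ln (x / 2))"
  have "(?e \<longlongrightarrow> 1 * (0 * 0 * rGamma 2 + 0 * 0 * rGamma' 2 - 2 * 1) - 0 * rGamma 2 * (0 * euler_mascheroni + 0)) (at_right 0)"
    by (intro tendsto_intros bessel_J_0_at_0 x0 x_ln_x_at_0 lim1 lim2 bessel_Y_0_at_0)
  moreover have "\<forall>\<^sub>F x in at_right 0. ?e x = pi * c"
  proof -
    have "?e x = pi * c" if x: "x > 0" for x
    proof -
      have "pi * c = x * (bessel_J_int 0 x * (pi * bessel_Y_int 1 x) - bessel_J_int 1 x * (2 * (pi / 2 * bessel_Y_int 0 x)))"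
        unfolding c[OF x, symmetric] by (simp add: algebra_simps)
      also have "\<dots> = ?e x"
        unfolding Y1[OF x] bessel_Jh_def J1[OF x] using x
        by (simp add: J1[OF x, simplified] algebra_simps)
      finally show ?thesis by simp
    qed
    then show ?thesis by (rule eventually_at_right_0I)
  qed
  ultimately have "((\<lambda>x::real. pi * c) \<longlongrightarrow> -2) (at_right 0)"
    by (simp add: tendsto_cong)
  then have "pi * c = -2" by (simp add: tendsto_const_iff)
  then have "c \<noteq> 0" by auto
  then show thesis using c that by blast
qed

text \<open>A solution of the order-zero equation, written as a first-order system, is a combination
  of \<open>J_0\<close> and \<open>Y_0\<close>. Vanishing at zero excludes first the unbounded
  \<open>Y_0\<close> and then \<open>J_0\<close>, which tends to 1.\<close>

lemma bessel_order_0_unique: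
  fixes v v1 :: "real \<Rightarrow> real" and x :: real
  assumes v: "\<And>x. x > 0 \<Longrightarrow> (v has_field_derivative - v1 x) (at x)"
    "\<And>x. x > 0 \<Longrightarrow> (v1 has_field_derivative v x - v1 x / x) (at x)"
    and lim: "(v \<longlongrightarrow> 0) (at_right 0)" and x: "x > 0"
  shows "v x = 0"
proof -
  obtain c where c: "c \<noteq> 0" "\<And>x::real. x > 0 \<Longrightarrow> x * (bessel_J_int 0 x * bessel_Y_int 1 x - bessel_J_int 1 x * bessel_Y_int 0 x) = c"
    using bessel_wronskian_nonzero by metis
  obtain a where a: "\<And>x::real. x > 0 \<Longrightarrow> x * (v x * bessel_Y_int 1 x - v1 x * bessel_Y_int 0 x) = a"
    using wronskian_constant[of v v1 "bessel_Y_int 0" "bessel_Y_int 1"] v has_field_derivative_bessel_01 by blast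
  obtain b where b: "\<And>x::real. x > 0 \<Longrightarrow> x * (v x * bessel_J_int 1 x - v1 x * bessel_J_int 0 x) = b"
    using wronskian_constant[of v v1 "bessel_J_int 0" "bessel_J_int 1"] v has_field_derivative_bessel_01 by blast
  \<comment> \<open>Cramer's rule: \<open>a\<close> and \<open>b\<close> are the constant Wronskians
    of \<open>v\<close> with \<open>Y_0\<close> and with \<open>J_0\<close>.\<close>
  have e: "c * v x = a * bessel_J_int 0 x - b * bessel_Y_int 0 x" if "x > 0" for x
    unfolding a[OF that, symmetric] b[OF that, symmetric] c(2)[OF that, symmetric] by (simp add: algebra_simps)
  have "((\<lambda>x. (a * bessel_J_int 0 x - c * v x) / bessel_Y_int 0 x) \<longlongrightarrow> 0) (at_right 0)"
  proof (rule tendsto_divide_0)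
    show "((\<lambda>x. a * bessel_J_int 0 x - c * v x) \<longlongrightarrow> a * 1 - c * 0) (at_right 0)"
      by (intro tendsto_intros bessel_J_0_at_0 lim)
  qed (rule filterlim_mono[OF bessel_Y_0_at_bot at_bot_le_at_infinity order_refl])
  moreover have "\<forall>\<^sub>F x in at_right 0. (a * bessel_J_int 0 x - c * v x) / bessel_Y_int 0 x = b"
  proof -
    have "\<forall>\<^sub>F x in at_right 0. bessel_Y_int 0 x < 0"
      using bessel_Y_0_at_bot by (simp add: filterlim_at_bot_dense)
    moreover have "\<forall>\<^sub>F x in at_right 0. (0::real) < x" by (rule eventually_at_right_0I)
    ultimately show ?thesis
      by eventually_elim (auto simp: e)
  qed
  ultimately have "((\<lambda>x::real. b) \<longlongrightarrow> 0) (at_right 0)" by (simp add: tendsto_cong)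
  then have b0: "b = 0" by (simp add: tendsto_const_iff)
  have "((\<lambda>x. a * bessel_J_int 0 x - c * v x) \<longlongrightarrow> a * 1 - c * 0) (at_right 0)"
    by (intro tendsto_intros bessel_J_0_at_0 lim)
  moreover have "\<forall>\<^sub>F x in at_right 0. a * bessel_J_int 0 x - c * v x = 0"
    by (rule eventually_at_right_0I) (simp add: e b0)
  ultimately have "((\<lambda>x::real. 0) \<longlongrightarrow> a * 1 - c * 0) (at_right 0)"
    by (rule Lim_transform_eventually)
  then have "a = 0" by (simp add: tendsto_const_iff)
  then show ?thesis using e[OF x] b0 c(1) by simp
qed

lemma trig_S0_at_0_lim: "(trig_S0 \<phi> \<longlongrightarrow> pi * cos \<phi>) (at_right 0)"
proof -
  have "(trig_S0 \<phi> \<longlongrightarrow> trig_S0 \<phi> 0) (at 0)"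
    using DERIV_isCont[OF has_field_derivative_trig_S0, of 0 \<phi>] by (simp add: isCont_def)
  from tendsto_at_rightI[OF this] show ?thesis by (simp add: trig_S0_at_0)
qed

lemma bessel_J_0_integral:
  assumes x: "x > 0"
  shows "pi * bessel_J_int 0 x = trig_S0 0 x" "pi * bessel_J_int 1 x = trig_S1 0 x"
proof -
  have z: "trig_S0 0 x - pi * bessel_J_int 0 x = 0" if "x > 0" for x
  proof (rule bessel_order_0_unique[OF _ _ _ that, of _ "\<lambda>x. trig_S1 0 x - pi * bessel_J_int 1 x"])
    fix x :: real assume x: "x > 0"
    show "((\<lambda>x. trig_S0 0 x - pi * bessel_J_int 0 x) has_field_derivative - (trig_S1 0 x - pi * bessel_J_int 1 x)) (at x)"
      by (rule derivative_eq_intros refl has_field_derivative_trig_S0 has_field_derivative_bessel_01[OF x])+ simp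
    show "((\<lambda>x. trig_S1 0 x - pi * bessel_J_int 1 x) has_field_derivative
        trig_S0 0 x - pi * bessel_J_int 0 x - (trig_S1 0 x - pi * bessel_J_int 1 x) / x) (at x)"
      by (rule derivative_eq_intros refl has_field_derivative_trig_S1[OF x] has_field_derivative_bessel_01[OF x])+
        (use x in \<open>simp add: field_simps\<close>)
  next
    have "((\<lambda>x. trig_S0 0 x - pi * bessel_J_int 0 x) \<longlongrightarrow> pi * cos 0 - pi * 1) (at_right 0)"
      by (intro tendsto_intros trig_S0_at_0_lim bessel_J_0_at_0)
    then show "((\<lambda>x. trig_S0 0 x - pi * bessel_J_int 0 x) \<longlongrightarrow> 0) (at_right 0)" by simp
  qed
  show "pi * bessel_J_int 0 x = trig_S0 0 x" using z[OF x] by simp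
  have "((\<lambda>x. trig_S0 0 x - pi * bessel_J_int 0 x) has_field_derivative - (trig_S1 0 x - pi * bessel_J_int 1 x)) (at x)"
    by (rule derivative_eq_intros refl has_field_derivative_trig_S0 has_field_derivative_bessel_01[OF x])+ simp
  moreover have "((\<lambda>x. trig_S0 0 x - pi * bessel_J_int 0 x) has_field_derivative 0) (at x)"
    by (rule has_field_derivative_transform_within_open[of "\<lambda>_. 0" _ _ "{0<..}"]) (use x z in auto)
  ultimately show "pi * bessel_J_int 1 x = trig_S1 0 x" using DERIV_unique by fastforce
qed

text \<open>The \<open>1 / x\<close> inhomogeneities of the two integrals cancel, so the difference
  of both sides solves the homogeneous equation. Near zero the logarithms cancel and so do the two
  Euler-Mascheroni constants, so uniqueness applies.\<close>

lemma bessel_Y_0_integral: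
  assumes x: "x > 0"
  shows "pi * bessel_Y_int 0 x = trig_S0 (- pi / 2) x - 2 * laplace_M0 x" "pi * bessel_Y_int 1 x = trig_S1 (- pi / 2) x - 2 * laplace_M1 x"
proof -
  let ?v = "\<lambda>x. trig_S0 (- pi / 2) x - 2 * laplace_M0 x - pi * bessel_Y_int 0 x"
  let ?v1 = "\<lambda>x. trig_S1 (- pi / 2) x - 2 * laplace_M1 x - pi * bessel_Y_int 1 x"
  have d: "(?v has_field_derivative - ?v1 x) (at x)" if x: "x > 0" for x
    by (rule derivative_eq_intros refl has_field_derivative_trig_S0 has_field_derivative_laplace_M0[OF x]
        has_field_derivative_bessel_01[OF x])+ simp
  have z: "?v x = 0" if "x > 0" for x
  proof (rule bessel_order_0_unique[OF _ _ _ that, of ?v ?v1])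
    fix x :: real assume x: "x > 0"
    show "(?v has_field_derivative - ?v1 x) (at x)" by (rule d[OF x])
    show "(?v1 has_field_derivative ?v x - ?v1 x / x) (at x)"
      by (rule derivative_eq_intros refl has_field_derivative_trig_S1[OF x] has_field_derivative_laplace_M1[OF x]
          has_field_derivative_bessel_01[OF x])+
        (use x in \<open>simp add: field_simps\<close>)
  next
    have "((\<lambda>x. trig_S0 (- pi / 2) x - 2 * (laplace_M0 x + ln (x / 2)) - 2 * (pi / 2 * bessel_Y_int 0 x - ln (x / 2)))
        \<longlongrightarrow> pi * cos (- pi / 2) - 2 * - euler_mascheroni - 2 * euler_mascheroni) (at_right 0)"
      by (intro tendsto_intros trig_S0_at_0_lim bessel_Y_0_at_0 laplace_M0_tendsto_at_0)
    then show "(?v \<longlongrightarrow> 0) (at_right 0)" by (simp add: algebra_simps)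
  qed
  show "pi * bessel_Y_int 0 x = trig_S0 (- pi / 2) x - 2 * laplace_M0 x" using z[OF x] by simp
  have "(?v has_field_derivative 0) (at x)"
    by (rule has_field_derivative_transform_within_open[of "\<lambda>_. 0" _ _ "{0<..}"]) (use x z in auto)
  then show "pi * bessel_Y_int 1 x = trig_S1 (- pi / 2) x - 2 * laplace_M1 x" using DERIV_unique[OF d[OF x]] by fastforce
qed

text \<open>Shifting the phase by a quarter period exchanges \<open>trig_S1\<close> and
  \<open>trig_S0\<close> up to \<open>O(1 / x)\<close>: phase \<open>0\<close> leads to the first
  estimate, phase \<open>- pi / 2\<close> to the second.\<close>

lemma bessel_quadrature:
  assumes x: "x \<ge> 1"
  shows "\<bar>bessel_Y_int 0 x - bessel_J_int 1 x\<bar> \<le> 4 / x" "\<bar>bessel_Y_int 1 x + bessel_J_int 0 x\<bar> \<le> 4 / x"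
proof -
  have x0: "x > 0" using x by simp
  have laplace_M1_le: "\<bar>laplace_M1 x\<bar> \<le> 1 / x"
  proof (rule order_trans[OF laplace_M1_bound[OF x0]])
    show "1 / x\<^sup>2 \<le> 1 / x" using x by (intro divide_left_mono) (auto simp: power2_eq_square)
  qed
  \<comment> \<open>The estimates below give \<open>2 + pi\<close> from the quarter-period shift and
    2 from the Laplace integral; division by \<open>pi\<close> leaves at most 4.\<close>
  have b: "(4 + pi) / x \<le> pi * (4 / x)" using x0 pi_gt3 by (simp add: divide_right_mono)
  have "pi * (bessel_Y_int 0 x - bessel_J_int 1 x) = - (trig_S1 0 x - trig_S0 (0 - pi / 2) x) - 2 * laplace_M0 x"
    using bessel_Y_0_integral[OF x0] bessel_J_0_integral[OF x0] by (simp add: right_diff_distrib)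
  then have "pi * \<bar>bessel_Y_int 0 x - bessel_J_int 1 x\<bar> = \<bar>- (trig_S1 0 x - trig_S0 (0 - pi / 2) x) - 2 * laplace_M0 x\<bar>"
    by (metis abs_mult abs_of_pos pi_gt_zero)
  also have "\<dots> \<le> (2 + pi) / x + 2 * (1 / x)"
    using trig_S1_minus_trig_S0_bound[OF x0, of 0] laplace_M0_bound[OF x0] by linarith
  also have "\<dots> = (4 + pi) / x" by (simp add: add_divide_distrib)
  also note b
  finally show "\<bar>bessel_Y_int 0 x - bessel_J_int 1 x\<bar> \<le> 4 / x" by (subst (asm) mult_le_cancel_left_pos) auto
  have "trig_S0 (- pi / 2 - pi / 2) x = - trig_S0 0 x" using trig_S0_minus_pi[of x] by simp
  then have "pi * (bessel_Y_int 1 x + bessel_J_int 0 x) = (trig_S1 (- pi / 2) x - trig_S0 (- pi / 2 - pi / 2) x) - 2 * laplace_M1 x"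
    using bessel_Y_0_integral[OF x0] bessel_J_0_integral[OF x0] by (simp add: distrib_left)
  then have "pi * \<bar>bessel_Y_int 1 x + bessel_J_int 0 x\<bar> = \<bar>(trig_S1 (- pi / 2) x - trig_S0 (- pi / 2 - pi / 2) x) - 2 * laplace_M1 x\<bar>"
    by (metis abs_mult abs_of_pos pi_gt_zero)
  also have "\<dots> \<le> (2 + pi) / x + 2 * (1 / x)"
    using trig_S1_minus_trig_S0_bound[OF x0, of "- pi / 2"] laplace_M1_le by linarith
  also have "\<dots> = (4 + pi) / x" by (simp add: add_divide_distrib)
  also note b
  finally show "\<bar>bessel_Y_int 1 x + bessel_J_int 0 x\<bar> \<le> 4 / x" by (subst (asm) mult_le_cancel_left_pos) auto
qed

section \<open>Behaviour at infinity\<close>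

text \<open>The plain energy \<open>x (c0^2 + c1^2)\<close> has derivative
  \<open>c0^2 - c1^2\<close>, which has no sign and is too large to integrate. Subtracting
  \<open>c0 c1\<close> reduces the derivative to \<open>c0 c1 / x\<close>, while the energy stays at
  least half the plain one for \<open>x \<ge> 1\<close>.\<close>

lemma bessel_order_0_decay:
  fixes c0 c1 :: "real \<Rightarrow> real"
  assumes d: "\<And>x. x > 0 \<Longrightarrow> (c0 has_field_derivative - c1 x) (at x)"
    "\<And>x. x > 0 \<Longrightarrow> (c1 has_field_derivative c0 x - c1 x / x) (at x)"
  obtains K where "\<And>x. x \<ge> 1 \<Longrightarrow> \<bar>c0 x\<bar> \<le> K / sqrt x" "\<And>x. x \<ge> 1 \<Longrightarrow> \<bar>c1 x\<bar> \<le> K / sqrt x"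
proof -
  let ?E = "\<lambda>x. x * ((c0 x)\<^sup>2 + (c1 x)\<^sup>2) - c0 x * c1 x"
  \<comment> \<open>\<open>E' = c0 c1 / x \<le> E / x\<^sup>2\<close> for \<open>x \<ge> 1\<close>, hence \<open>E exp (1/x)\<close> does not increase.\<close>
  define h where "h = (\<lambda>x. ?E x * exp (1 / x))"
  have prod: "\<bar>a * b\<bar> \<le> (a\<^sup>2 + b\<^sup>2) / 2" for a b :: real
    using sum_squares_bound[of "\<bar>a\<bar>" "\<bar>b\<bar>"] by (simp add: abs_mult)
  have h_mono: "h x \<le> h 1" if "x \<ge> 1" for x
  proof (rule DERIV_nonpos_imp_nonincreasing[OF that])
    fix t :: real assume t: "1 \<le> t" "t \<le> x"
    then have t0: "t > 0" by simp
    let ?q = "(c0 t)\<^sup>2 + (c1 t)\<^sup>2"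
    have "(h has_field_derivative (c0 t * c1 t / t - ?E t / t\<^sup>2) * exp (1 / t)) (at t)"
    proof -
      have 1: "((\<lambda>x. exp (1 / x)) has_field_derivative - (exp (1 / t) / t\<^sup>2)) (at t)"
        using t0 by (auto intro!: derivative_eq_intros simp: power2_eq_square)
      have 2: "(?E has_field_derivative c0 t * c1 t / t) (at t)"
        by (rule derivative_eq_intros refl d t0)+ (use t0 in \<open>simp add: power2_eq_square field_simps\<close>)
      show ?thesis
        unfolding h_def by (rule DERIV_mult'[OF 2 1, THEN DERIV_cong])
          (simp add: algebra_simps add_divide_distrib diff_divide_distrib)
    qed
    moreover have "c0 t * c1 t / t - ?E t / t\<^sup>2 \<le> 0"
    proof -
      have "(t + 1) * (c0 t * c1 t) \<le> (t + 1) * \<bar>c0 t * c1 t\<bar>"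
        using t by (intro mult_left_mono) auto
      also have "\<dots> \<le> (2 * t) * (?q / 2)"
        using t prod[of "c0 t" "c1 t"] by (intro mult_mono) auto
      finally have "t * (c0 t * c1 t) \<le> ?E t" by (simp add: algebra_simps)
      then have "t * (c0 t * c1 t) / t\<^sup>2 \<le> ?E t / t\<^sup>2" by (intro divide_right_mono) auto
      then show ?thesis using t0 by (simp add: power2_eq_square)
    qed
    ultimately show "\<exists>y. (h has_field_derivative y) (at t) \<and> y \<le> 0"
      by (metis exp_ge_zero mult_nonpos_nonneg)
  qed
  define K where "K = sqrt (2 * h 1)"
  have main: "c\<^sup>2 \<le> 2 * h 1 / x" if x: "x \<ge> 1" and c: "c\<^sup>2 \<le> (c0 x)\<^sup>2 + (c1 x)\<^sup>2" for x c
  proof -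
    let ?q = "(c0 x)\<^sup>2 + (c1 x)\<^sup>2"
    have q: "x / 2 * ?q \<le> ?E x"
    proof -
      have "?q * 1 \<le> ?q * x" using x by (intro mult_left_mono) auto
      then show ?thesis using prod[of "c0 x" "c1 x"] by (simp add: algebra_simps)
    qed
    have E0: "0 \<le> ?E x" by (rule order_trans[OF _ q]) (use x in auto)
    have "?E x * 1 \<le> ?E x * exp (1 / x)" using E0 x by (intro mult_left_mono) auto
    then have "?E x \<le> h x" unfolding h_def by simp
    then have "x / 2 * ?q \<le> h 1" using h_mono[OF x] q by linarith
    moreover have "x / 2 * c\<^sup>2 \<le> x / 2 * ?q" using c x by (intro mult_left_mono) auto
    ultimately have "x / 2 * c\<^sup>2 \<le> h 1" by linarith
    then show ?thesis using x by (simp add: field_simps)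
  qed
  have "\<bar>c\<bar> \<le> K / sqrt x" if "x \<ge> 1" "c\<^sup>2 \<le> (c0 x)\<^sup>2 + (c1 x)\<^sup>2" for x c
    using real_sqrt_le_mono[OF main[OF that]] by (simp add: K_def real_sqrt_divide real_sqrt_mult)
  then show thesis using that[of K] by simp
qed

text \<open>For \<open>x \<ge> 1\<close> the coefficient \<open>2 k / x\<close> is bounded, so the
  recurrence carries the rate to all orders in both directions. The induction tracks two consecutive
  orders.\<close>

lemma bessel_decay_int:
  fixes C :: "int \<Rightarrow> real \<Rightarrow> real"
  assumes rec: "\<And>k x. x > 0 \<Longrightarrow> C (k - 1) x = 2 * of_int k / x * C k x - C (k + 1) x"
    and base: "\<And>x. x \<ge> 1 \<Longrightarrow> \<bar>C 0 x\<bar> \<le> K / sqrt x" "\<And>x. x \<ge> 1 \<Longrightarrow> \<bar>C 1 x\<bar> \<le> K / sqrt x"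
  obtains B where "\<And>x. x \<ge> 1 \<Longrightarrow> \<bar>C k x\<bar> \<le> B / sqrt x"
proof -
  have step: "\<bar>2 * of_int k / x * a - b\<bar> \<le> ((2 * \<bar>of_int k\<bar> + 1) * B) / sqrt x"
    if x: "x \<ge> 1" and ab: "\<bar>a\<bar> \<le> B / sqrt x" "\<bar>b\<bar> \<le> B / sqrt x" for k :: int and x a b B :: real
  proof -
    have B: "0 \<le> B / sqrt x" using ab(1) by linarith
    have "\<bar>2 * of_int k / x\<bar> \<le> 2 * \<bar>of_int k\<bar> / 1"
      unfolding abs_divide using x by (intro frac_le) (auto simp: abs_mult)
    then have "\<bar>2 * of_int k / x * a\<bar> \<le> (2 * \<bar>of_int k\<bar>) * (B / sqrt x)"
      unfolding abs_mult[of _ a] using ab(1) B by (intro mult_mono) auto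
    then have "\<bar>2 * of_int k / x * a - b\<bar> \<le> (2 * \<bar>of_int k\<bar>) * (B / sqrt x) + B / sqrt x"
      using ab(2) by linarith
    then show ?thesis by (simp add: add_divide_distrib distrib_right)
  qed
  let ?P = "\<lambda>k. \<exists>B. \<forall>x\<ge>1. \<bar>C k x\<bar> \<le> B / sqrt x \<and> \<bar>C (k + 1) x\<bar> \<le> B / sqrt x"
  have "?P k"
  proof (induction k rule: int_induct[where k = 0])
    case base
    show ?case using assms(2,3) by auto
  next
    case (step1 i)
    then obtain B where B: "\<And>x. x \<ge> 1 \<Longrightarrow> \<bar>C i x\<bar> \<le> B / sqrt x" "\<And>x. x \<ge> 1 \<Longrightarrow> \<bar>C (i + 1) x\<bar> \<le> B / sqrt x"
      by auto
    have "\<bar>C (i + 1) x\<bar> \<le> (\<bar>B\<bar> + (2 * \<bar>of_int (i + 1)\<bar> + 1) * \<bar>B\<bar>) / sqrt x \<and>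
        \<bar>C (i + 1 + 1) x\<bar> \<le> (\<bar>B\<bar> + (2 * \<bar>of_int (i + 1)\<bar> + 1) * \<bar>B\<bar>) / sqrt x" if x: "x \<ge> 1" for x
    proof -
      have "\<bar>C i x\<bar> \<le> \<bar>B\<bar> / sqrt x" "\<bar>C (i + 1) x\<bar> \<le> \<bar>B\<bar> / sqrt x"
        using B[OF x] x by (auto intro: order_trans[OF _ divide_right_mono])
      note b = this
      have "C (i + 1 + 1) x = 2 * of_int (i + 1) / x * C (i + 1) x - C i x"
        using rec[of x "i + 1"] x by simp
      then have "\<bar>C (i + 1 + 1) x\<bar> \<le> ((2 * \<bar>of_int (i + 1)\<bar> + 1) * \<bar>B\<bar>) / sqrt x"
        using step[OF x b(2,1), of "i + 1"] by (simp only:)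
      moreover note b(2)
      moreover have "0 \<le> ((2 * \<bar>of_int (i + 1)\<bar> + 1) * \<bar>B\<bar>) / sqrt x" "0 \<le> \<bar>B\<bar> / sqrt x" using x by auto
      ultimately show ?thesis unfolding add_divide_distrib by linarith
    qed
    then show ?case by blast
  next
    case (step2 i)
    then obtain B where B: "\<And>x. x \<ge> 1 \<Longrightarrow> \<bar>C i x\<bar> \<le> B / sqrt x" "\<And>x. x \<ge> 1 \<Longrightarrow> \<bar>C (i + 1) x\<bar> \<le> B / sqrt x"
      by auto
    have "\<bar>C (i - 1) x\<bar> \<le> (\<bar>B\<bar> + (2 * \<bar>of_int i\<bar> + 1) * \<bar>B\<bar>) / sqrt x \<and>
        \<bar>C (i - 1 + 1) x\<bar> \<le> (\<bar>B\<bar> + (2 * \<bar>of_int i\<bar> + 1) * \<bar>B\<bar>) / sqrt x" if x: "x \<ge> 1" for x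
    proof -
      have b: "\<bar>C i x\<bar> \<le> \<bar>B\<bar> / sqrt x" "\<bar>C (i + 1) x\<bar> \<le> \<bar>B\<bar> / sqrt x"
        using B[OF x] x by (auto intro: order_trans[OF _ divide_right_mono])
      have "C (i - 1) x = 2 * of_int i / x * C i x - C (i + 1) x"
        using rec[of x i] x by simp
      then have "\<bar>C (i - 1) x\<bar> \<le> ((2 * \<bar>of_int i\<bar> + 1) * \<bar>B\<bar>) / sqrt x"
        using step[OF x b, of i] by (simp only:)
      moreover have "0 \<le> ((2 * \<bar>of_int i\<bar> + 1) * \<bar>B\<bar>) / sqrt x" "0 \<le> \<bar>B\<bar> / sqrt x" using x by auto
      moreover have "i - 1 + 1 = i" by simp
      ultimately show ?thesis using b(1) unfolding add_divide_distrib by simp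
    qed
    then show ?case by blast
  qed
  then show thesis using that by blast
qed

lemma bessel_J_int_decay:
  obtains B where "\<And>x. x \<ge> 1 \<Longrightarrow> \<bar>bessel_J_int k x\<bar> \<le> B / sqrt x"
proof -
  obtain K where "\<And>x. x \<ge> 1 \<Longrightarrow> \<bar>bessel_J_int 0 x\<bar> \<le> K / sqrt x" "\<And>x. x \<ge> 1 \<Longrightarrow> \<bar>bessel_J_int 1 x\<bar> \<le> K / sqrt x"
    using bessel_order_0_decay[of "bessel_J_int 0" "bessel_J_int 1"] has_field_derivative_bessel_01(1,2) by metis
  from bessel_decay_int[of bessel_J_int, OF bessel_J_int_recurrence this] show thesis using that by metis
qed

lemma bessel_Y_int_decay:
  obtains B where "\<And>x. x \<ge> 1 \<Longrightarrow> \<bar>bessel_Y_int k x\<bar> \<le> B / sqrt x"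
proof -
  obtain K where "\<And>x. x \<ge> 1 \<Longrightarrow> \<bar>bessel_Y_int 0 x\<bar> \<le> K / sqrt x" "\<And>x. x \<ge> 1 \<Longrightarrow> \<bar>bessel_Y_int 1 x\<bar> \<le> K / sqrt x"
    using bessel_order_0_decay[of "bessel_Y_int 0" "bessel_Y_int 1"] has_field_derivative_bessel_01(3,4) by metis
  from bessel_decay_int[of bessel_Y_int, OF bessel_Y_int_recurrence this] show thesis using that by metis
qed

lemma bessel_f_decay:
  obtains B where "B \<ge> 0" "\<And>x. x \<ge> 1 \<Longrightarrow> \<bar>bessel_f \<mu> x\<bar> \<le> B / x"
proof -
  obtain a b c d where
    a: "\<And>x. x \<ge> 1 \<Longrightarrow> \<bar>bessel_Y_int \<mu> x\<bar> \<le> a / sqrt x" and b: "\<And>x. x \<ge> 1 \<Longrightarrow> \<bar>bessel_J_int 0 x\<bar> \<le> b / sqrt x" and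
    c: "\<And>x. x \<ge> 1 \<Longrightarrow> \<bar>bessel_J_int \<mu> x\<bar> \<le> c / sqrt x" and d: "\<And>x. x \<ge> 1 \<Longrightarrow> \<bar>bessel_Y_int 0 x\<bar> \<le> d / sqrt x"
    using bessel_Y_int_decay[of \<mu>] bessel_J_int_decay[of 0] bessel_J_int_decay[of \<mu>] bessel_Y_int_decay[of 0] by metis
  have m: "\<bar>u * v\<bar> \<le> (p * q) / x" if "\<bar>u\<bar> \<le> p / sqrt x" "\<bar>v\<bar> \<le> q / sqrt x" "x \<ge> 1" for u v p q x
  proof -
    have "\<bar>u\<bar> * \<bar>v\<bar> \<le> (p / sqrt x) * (q / sqrt x)"
      using that(1,2) by (intro mult_mono) (auto intro: order_trans[OF abs_ge_zero])
    then show ?thesis using that(3) by (simp add: abs_mult)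
  qed
  have "\<bar>bessel_f \<mu> x\<bar> \<le> \<bar>pi / 4 * (a * b + c * d)\<bar> / x" if x: "x \<ge> 1" for x
  proof -
    have "\<bar>bessel_Y_int \<mu> x * bessel_J_int 0 x + bessel_J_int \<mu> x * bessel_Y_int 0 x\<bar> \<le> (a * b + c * d) / x"
      using m[OF a[OF x] b[OF x] x] m[OF c[OF x] d[OF x] x] unfolding add_divide_distrib by linarith
    then have "\<bar>bessel_f \<mu> x\<bar> \<le> pi / 4 * ((a * b + c * d) / x)"
      unfolding bessel_f_def abs_mult by (intro mult_mono) auto
    also have "\<dots> \<le> \<bar>pi / 4 * (a * b + c * d)\<bar> / x" using x by (simp add: divide_right_mono)
    finally show ?thesis .
  qed
  then show thesis
    by (intro that[of "\<bar>pi / 4 * (a * b + c * d)\<bar>"]) auto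
qed

lemma continuous_on_bessel_f: "A \<subseteq> {0<..} \<Longrightarrow> continuous_on A (bessel_f \<mu>)"
  using has_field_derivative_bessel_f
  by (intro continuous_at_imp_continuous_on) (auto intro: DERIV_isCont)

lemma bessel_int_tendsto_0:
  "(bessel_J_int k \<longlongrightarrow> 0) at_top" "(bessel_Y_int k \<longlongrightarrow> 0) at_top"
proof -
  have *: "(f \<longlongrightarrow> 0) at_top" if "\<And>x. x \<ge> 1 \<Longrightarrow> \<bar>f x\<bar> \<le> B / sqrt x" for f :: "real \<Rightarrow> real" and B
  proof (rule Lim_null_comparison)
    show "\<forall>\<^sub>F x in at_top. norm (f x) \<le> B / sqrt x"
      using eventually_ge_at_top[of 1] by eventually_elim (use that in auto)
    show "((\<lambda>x. B / sqrt x) \<longlongrightarrow> 0) at_top" by real_asymp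
  qed
  show "(bessel_J_int k \<longlongrightarrow> 0) at_top" using bessel_J_int_decay[of k] * by metis
  show "(bessel_Y_int k \<longlongrightarrow> 0) at_top" using bessel_Y_int_decay[of k] * by metis
qed

text \<open>The bracket equals \<open>J_0 (Y_0 - J_1) + J_1 (Y_1 + J_0)\<close>, since the added
  products cancel. The quadrature estimates absorb the factor \<open>x\<close>, and what remains
  decays with \<open>J_0\<close> and \<open>J_1\<close>.\<close>

lemma bessel_omega_1_tendsto_0:
  "((\<lambda>x. x * (bessel_J_int 0 x * bessel_Y_int 0 x + bessel_J_int 1 x * bessel_Y_int 1 x)) \<longlongrightarrow> 0) at_top"
proof (rule Lim_null_comparison)
  show "\<forall>\<^sub>F x in at_top. norm (x * (bessel_J_int 0 x * bessel_Y_int 0 x + bessel_J_int 1 x * bessel_Y_int 1 x))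
      \<le> 4 * (\<bar>bessel_J_int 0 x\<bar> + \<bar>bessel_J_int 1 x\<bar>)"
    using eventually_ge_at_top[of 1]
  proof eventually_elim
    case (elim x)
    let ?e0 = "bessel_Y_int 0 x - bessel_J_int 1 x" and ?e1 = "bessel_Y_int 1 x + bessel_J_int 0 x"
    have x: "x > 0" using elim by simp
    have e: "\<bar>x * ?e0\<bar> \<le> 4" "\<bar>x * ?e1\<bar> \<le> 4"
      using bessel_quadrature[OF elim] x unfolding abs_mult by (simp_all add: pos_le_divide_eq mult.commute)
    have "\<bar>bessel_J_int 0 x * (x * ?e0) + bessel_J_int 1 x * (x * ?e1)\<bar>
        \<le> \<bar>bessel_J_int 0 x\<bar> * \<bar>x * ?e0\<bar> + \<bar>bessel_J_int 1 x\<bar> * \<bar>x * ?e1\<bar>"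
      unfolding abs_mult[symmetric] by (rule abs_triangle_ineq)
    also have "\<dots> \<le> \<bar>bessel_J_int 0 x\<bar> * 4 + \<bar>bessel_J_int 1 x\<bar> * 4"
      using e by (intro add_mono mult_left_mono) auto
    finally show ?case by (simp add: algebra_simps)
  qed
  have "((\<lambda>x. 4 * (\<bar>bessel_J_int 0 x\<bar> + \<bar>bessel_J_int 1 x\<bar>)) \<longlongrightarrow> 4 * (\<bar>0\<bar> + \<bar>0\<bar>)) at_top"
    by (intro tendsto_intros bessel_int_tendsto_0)
  then show "((\<lambda>x. 4 * (\<bar>bessel_J_int 0 x\<bar> + \<bar>bessel_J_int 1 x\<bar>)) \<longlongrightarrow> 0) at_top" by simp
qed

text \<open>The part of \<open>bessel_G\<close> that carries the factor \<open>x\<close>, for which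
  the decay rates alone give only boundedness.\<close>

definition bessel_omega :: "int \<Rightarrow> real \<Rightarrow> real" where
  "bessel_omega k x = x * (bessel_Y_int (k - 1) x * bessel_J_int 0 x + bessel_Y_int k x * bessel_J_int 1 x
     + bessel_J_int (k - 1) x * bessel_Y_int 0 x + bessel_J_int k x * bessel_Y_int 1 x)"

text \<open>Applying the three-term recurrence at \<open>k\<close> and \<open>k + 1\<close> shows
  that the sum of the values at \<open>k\<close> and \<open>k + 2\<close> consists of products
  without the factor \<open>x\<close>, which tend to zero. Hence the limit at two consecutive orders
  suffices.\<close>

lemma bessel_omega_tendsto_0: "(bessel_omega k \<longlongrightarrow> 0) at_top"
proof -
  let ?r = "\<lambda>k x. 2 * of_int k * (bessel_Y_int k x * bessel_J_int 0 x + bessel_J_int k x * bessel_Y_int 0 x)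
      + 2 * of_int (k + 1) * (bessel_Y_int (k + 1) x * bessel_J_int 1 x + bessel_J_int (k + 1) x * bessel_Y_int 1 x)"
  have rec: "bessel_omega (k + 2) x = ?r k x - bessel_omega k x" if x: "x > 0" for k x
  proof -
    have e: "k + 2 - 1 = k + 1" "k + 1 - 1 = k" "k + 1 + 1 = k + 2" by auto
    have mx: "x * a = 2 * q * b - x * c" if "a = 2 * q / x * b - c" for a b c q
      using that x by (simp add: right_diff_distrib)
    have "x * bessel_Y_int (k - 1) x = 2 * of_int k * bessel_Y_int k x - x * bessel_Y_int (k + 1) x"
      "x * bessel_J_int (k - 1) x = 2 * of_int k * bessel_J_int k x - x * bessel_J_int (k + 1) x"
      by (rule mx, rule bessel_Y_int_recurrence[OF x]) (rule mx, rule bessel_J_int_recurrence[OF x])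
    moreover have "x * bessel_Y_int k x = 2 * of_int (k + 1) * bessel_Y_int (k + 1) x - x * bessel_Y_int (k + 2) x"
      "x * bessel_J_int k x = 2 * of_int (k + 1) * bessel_J_int (k + 1) x - x * bessel_J_int (k + 2) x"
      using mx[OF bessel_Y_int_recurrence[OF x, of "k + 1"]] mx[OF bessel_J_int_recurrence[OF x, of "k + 1"]]
      unfolding e by simp_all
    ultimately show ?thesis unfolding bessel_omega_def e by algebra
  qed
  have r: "(?r k \<longlongrightarrow> 0) at_top" for k
  proof -
    have "(?r k \<longlongrightarrow> 2 * of_int k * (0 * 0 + 0 * 0) + 2 * of_int (k + 1) * (0 * 0 + 0 * 0)) at_top"
      by (intro tendsto_intros bessel_int_tendsto_0)
    then show ?thesis by simp
  qed
  have up: "(bessel_omega (k + 2) \<longlongrightarrow> 0) at_top" if "(bessel_omega k \<longlongrightarrow> 0) at_top" for k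
  proof -
    have "((\<lambda>x. ?r k x - bessel_omega k x) \<longlongrightarrow> 0) at_top" using tendsto_diff[OF r that] by simp
    then show ?thesis
      by (rule Lim_transform_eventually) (use eventually_gt_at_top[of 0] in eventually_elim, simp only: rec)
  qed
  have down: "(bessel_omega k \<longlongrightarrow> 0) at_top" if "(bessel_omega (k + 2) \<longlongrightarrow> 0) at_top" for k
  proof -
    have "((\<lambda>x. ?r k x - bessel_omega (k + 2) x) \<longlongrightarrow> 0) at_top" using tendsto_diff[OF r that] by simp
    then show ?thesis
      by (rule Lim_transform_eventually) (use eventually_gt_at_top[of 0] in eventually_elim, simp add: rec)
  qed
  have "(bessel_omega k \<longlongrightarrow> 0) at_top \<and> (bessel_omega (k + 1) \<longlongrightarrow> 0) at_top"
  proof (induction k rule: int_induct[where k = 0])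
    case base
    \<comment> \<open>By \<open>J_(-1) = - J_1\<close> and \<open>Y_(-1) = - Y_1\<close> the four
      products cancel in pairs, so only order 1 needs the quadrature estimate.\<close>
    have "bessel_omega 0 x = 0" if x: "x > 0" for x
      using bessel_Y_int_minus[OF x, of 1] bessel_J_minus_of_int[OF x, of 1] by (simp add: bessel_omega_def algebra_simps)
    then have "(bessel_omega 0 \<longlongrightarrow> 0) at_top"
      by (intro Lim_transform_eventually[OF tendsto_const]) (use eventually_gt_at_top[of 0] in eventually_elim, simp)
    moreover have "((\<lambda>x. 2 * (x * (bessel_J_int 0 x * bessel_Y_int 0 x + bessel_J_int 1 x * bessel_Y_int 1 x))) \<longlongrightarrow> 2 * 0) at_top"
      by (intro tendsto_mult tendsto_const bessel_omega_1_tendsto_0)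
    then have "(bessel_omega 1 \<longlongrightarrow> 0) at_top" by (simp add: bessel_omega_def[abs_def] algebra_simps)
    ultimately show ?case by simp
  next
    case (step1 i)
    then show ?case using up[of i] by (simp add: add.assoc)
  next
    case (step2 i)
    have "i - 1 + 2 = i + 1" "i - 1 + 1 = i" by auto
    then show ?case using down[of "i - 1"] step2 by (simp add: add.commute)
  qed
  then show ?thesis by simp
qed

lemma bessel_G_tendsto_0: "(bessel_G \<mu> \<longlongrightarrow> 0) at_top"
proof -
  have "((\<lambda>x. - (pi / 4) * (bessel_omega \<mu> x - of_int \<mu> * (bessel_Y_int \<mu> x * bessel_J_int 0 x + bessel_J_int \<mu> x * bessel_Y_int 0 x)))
      \<longlongrightarrow> - (pi / 4) * (0 - of_int \<mu> * (0 * 0 + 0 * 0))) at_top"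
    by (intro tendsto_intros bessel_omega_tendsto_0 bessel_int_tendsto_0)
  moreover have "bessel_G \<mu> = (\<lambda>x. - (pi / 4) * (bessel_omega \<mu> x - of_int \<mu> * (bessel_Y_int \<mu> x * bessel_J_int 0 x + bessel_J_int \<mu> x * bessel_Y_int 0 x)))"
    by (auto simp: bessel_G_def bessel_omega_def algebra_simps)
  ultimately show ?thesis by simp
qed

section \<open>Convergence of the integrals and assembly of the formula\<close>

lemma integrable_bessel_f_over_powers:
  assumes x: "x > 0"
  shows "set_integrable lborel {x..} (\<lambda>t. bessel_f \<mu> t / t)"
    and "set_integrable lborel {x..} (\<lambda>t. bessel_f \<mu> t / t\<^sup>2)"
    and "(\<lambda>t. bessel_f \<mu> t / t) absolutely_integrable_on {x..}"
proof -
  obtain B where B: "B \<ge> 0" "\<And>x. x \<ge> 1 \<Longrightarrow> \<bar>bessel_f \<mu> x\<bar> \<le> B / x" using bessel_f_decay by blast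
  obtain D where D: "\<And>t. t \<in> {x..max x 1} \<Longrightarrow> \<bar>bessel_f \<mu> t\<bar> \<le> D"
  proof -
    have "compact (bessel_f \<mu> ` {x..max x 1})"
      by (intro compact_continuous_image continuous_on_bessel_f) (use x in auto)
    then have "bounded (bessel_f \<mu> ` {x..max x 1})" by (rule compact_imp_bounded)
    then obtain M where M: "\<And>y. y \<in> bessel_f \<mu> ` {x..max x 1} \<Longrightarrow> norm y \<le> M"
      unfolding bounded_iff by blast
    show thesis by (rule that[of M]) (use M[OF imageI] in simp)
  qed
  \<comment> \<open>One constant for both integrands: \<open>f / t\<close> is compared with
    \<open>t powr (- 2)\<close> directly, and \<open>f / t\<^sup>2\<close> after trading one factor
    \<open>1 / t\<close> for \<open>1 / x\<close>.\<close>
  define c where "c = (B + \<bar>D\<bar>) * (1 + 1 / x)"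
  have f: "\<bar>bessel_f \<mu> t\<bar> \<le> (B + \<bar>D\<bar>) / t" if t: "t \<in> {x..}" for t
  proof (cases "t \<ge> 1")
    case True
    have "B / t \<le> (B + \<bar>D\<bar>) / t" using True by (intro divide_right_mono) auto
    then show ?thesis using B(2)[OF True] by linarith
  next
    case False
    have "\<bar>bessel_f \<mu> t\<bar> \<le> D" using False t by (intro D) auto
    also have "\<dots> \<le> (B + \<bar>D\<bar>) / 1" using B(1) by simp
    also have "\<dots> \<le> (B + \<bar>D\<bar>) / t" using False t x B(1) by (intro divide_left_mono) auto
    finally show ?thesis .
  qed
  have i: "(\<lambda>t. c * t powr (- 2)) integrable_on {x..}"
    using has_integral_powr_to_inf[of "- 2" x] x by (intro integrable_on_mult_right) (auto simp: integrable_on_def)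
  have pw: "t powr (- 2) = 1 / t\<^sup>2" if "t > 0" for t :: real
    using that by (simp add: powr_minus field_simps)
  have b1: "\<bar>bessel_f \<mu> t / t\<bar> \<le> c * t powr (- 2)" and b2: "\<bar>bessel_f \<mu> t / t\<^sup>2\<bar> \<le> c * t powr (- 2)" if t: "t \<in> {x..}" for t
  proof -
    have t0: "t > 0" using t x by simp
    have q: "\<bar>bessel_f \<mu> t\<bar> / t \<le> (B + \<bar>D\<bar>) / t\<^sup>2"
      using divide_right_mono[OF f[OF t], of t] t0 by (simp add: power2_eq_square)
    have "(B + \<bar>D\<bar>) * 1 \<le> c" "(B + \<bar>D\<bar>) * (1 / x) \<le> c"
      unfolding c_def using B(1) x by (intro mult_left_mono; simp)+
    then have c: "(B + \<bar>D\<bar>) / t\<^sup>2 \<le> c / t\<^sup>2" "(B + \<bar>D\<bar>) * (1 / x) / t\<^sup>2 \<le> c / t\<^sup>2"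
      by (auto intro!: divide_right_mono simp del: times_divide_eq_right)
    show "\<bar>bessel_f \<mu> t / t\<bar> \<le> c * t powr (- 2)" using q c(1) t0 by (simp add: pw abs_divide)
    have "\<bar>bessel_f \<mu> t\<bar> / t * (1 / t) \<le> (B + \<bar>D\<bar>) / t\<^sup>2 * (1 / x)"
      using q t t0 x B(1) by (intro mult_mono divide_left_mono) auto
    also have "\<dots> \<le> c / t\<^sup>2" using c(2) by (simp add: mult.commute)
    finally show "\<bar>bessel_f \<mu> t / t\<^sup>2\<bar> \<le> c * t powr (- 2)"
      using t0 by (simp add: pw abs_divide power2_eq_square)
  qed
  have cont: "continuous_on {x..} (\<lambda>t. bessel_f \<mu> t / t)" "continuous_on {x..} (\<lambda>t. bessel_f \<mu> t / t\<^sup>2)"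
    using x by (intro continuous_intros continuous_on_bessel_f; force)+
  show "set_integrable lborel {x..} (\<lambda>t. bessel_f \<mu> t / t)"
    by (rule set_integrable_continuous_dominated[OF cont(1) _ i b1]) auto
  show "set_integrable lborel {x..} (\<lambda>t. bessel_f \<mu> t / t\<^sup>2)"
    by (rule set_integrable_continuous_dominated[OF cont(2) _ i b2]) auto
  show "(\<lambda>t. bessel_f \<mu> t / t) absolutely_integrable_on {x..}"
    by (rule absolutely_integrable_continuous_dominated[OF cont(1) _ i b1]) auto
qed

text \<open>Integrates the derivative of \<open>G\<close> from \<open>x\<close> to infinity; the
  limit zero at infinity is what prevents an additional constant multiplied by \<open>x ^ 0\<close>
  in the final formula.\<close>

lemma bessel_G_integral:
  assumes x: "x > 0"
  shows "bessel_G \<mu> x = (of_int \<mu>)\<^sup>2 * (LBINT t:{x..}. bessel_f \<mu> t / t)"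
proof -
  have "integral {x..} (\<lambda>t. - ((of_int \<mu>)\<^sup>2 * (bessel_f \<mu> t / t))) = 0 - bessel_G \<mu> x"
  proof (rule integral_FTC_to_infinity[OF _ _ bessel_G_tendsto_0])
    show "(bessel_G \<mu> has_field_derivative - ((of_int \<mu>)\<^sup>2 * (bessel_f \<mu> t / t))) (at t within {x..})" if "t \<ge> x" for t
      by (rule has_field_derivative_at_within, rule has_field_derivative_bessel_G) (use x that in linarith)
    have "(\<lambda>t. (- (of_int \<mu>)\<^sup>2) * (bessel_f \<mu> t / t)) absolutely_integrable_on {x..}"
      by (intro set_integrable_mult_right) (simp add: integrable_bessel_f_over_powers[OF x])
    then show "(\<lambda>t. - ((of_int \<mu>)\<^sup>2 * (bessel_f \<mu> t / t))) absolutely_integrable_on {x..}" by simp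
  qed
  moreover have "integral {x..} (\<lambda>t. - ((of_int \<mu>)\<^sup>2 * (bessel_f \<mu> t / t))) =
      - ((of_int \<mu>)\<^sup>2 * integral {x..} (\<lambda>t. bessel_f \<mu> t / t))"
    by (simp only: integral_neg integral_mult_right)
  ultimately show ?thesis
    unfolding set_borel_integral_eq_integral(2)[OF integrable_bessel_f_over_powers(1)[OF x]] by linarith
qed

lemma set_integral_tail_split:
  fixes g :: "real \<Rightarrow> real"
  assumes "x \<le> y" "set_integrable lborel {x..} g"
  shows "(LBINT t:{x..}. g t) = integral {x..y} g + (LBINT t:{y..}. g t)"
proof -
  have s: "set_integrable lborel {x..y} g" "set_integrable lborel {y..} g"
    using assms by (auto intro: set_integrable_subset)
  have un: "{x..y} \<union> {y..} = {x..}" using assms(1) by auto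
  have "(g has_integral integral {x..y} g + integral {y..} g) ({x..y} \<union> {y..})"
    using s[THEN set_borel_integral_eq_integral(1)]
    by (intro has_integral_Un integrable_integral) (auto intro: negligible_subset[of "{y}"])
  then show ?thesis
    unfolding un set_borel_integral_eq_integral(2)[OF assms(2)] set_borel_integral_eq_integral(2)[OF s(2)]
    by (rule integral_unique)
qed

theorem mainTheorem1:
  fixes \<mu> :: int
  assumes "\<mu> \<noteq> 0"
  shows "\<exists>C::real. \<forall>x::real. x > 0 \<longrightarrow>
           summable (\<lambda>n. bessel_P_term \<mu> x (int (Suc n))) \<and>
           set_integrable lborel {x..} (\<lambda>t. bessel_f \<mu> t / t) \<and>
           set_integrable lborel {x..} (\<lambda>t. bessel_f \<mu> t / t\<^sup>2) \<and>
           bessel_P \<mu> x = (-1) powi \<mu> *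
             (- bessel_f \<mu> x
              + (of_int \<mu>)\<^sup>2 * (LBINT t:{x..}. bessel_f \<mu> t / t)
              + (1 - (of_int \<mu>)\<^sup>2) * x * (LBINT t:{x..}. bessel_f \<mu> t / t\<^sup>2)
              + C * x)"
proof -
  define s where "s = ((-1) powi \<mu> :: real)"
  have ss: "s * s = 1" by (simp add: s_def minus_one_powi)
  define m where "m = (1 - (of_int \<mu>)\<^sup>2 :: real)"
  define \<Theta> where "\<Theta> = (\<lambda>x. s * bessel_P \<mu> x / x + (bessel_f \<mu> x - bessel_G \<mu> x) / x)"
  define I where "I = (\<lambda>x. LBINT t:{x..}. bessel_f \<mu> t / t\<^sup>2)"
  \<comment> \<open>The derivative of \<open>\<Theta>\<close> is \<open>- m * f / t\<^sup>2\<close>,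
    the same as that of \<open>m * I\<close>; their constant difference becomes the integration
    constant, normalised at 1 below. It appears as \<open>C * x\<close> because
    \<open>\<Theta>\<close> contains \<open>P\<close> divided by \<open>x\<close>.\<close>
  have step: "\<Theta> x - m * I x = \<Theta> y - m * I y" if x: "0 < x" and xy: "x \<le> y" for x y
  proof -
    have "((\<lambda>t. - (m * (bessel_f \<mu> t / t\<^sup>2))) has_integral \<Theta> y - \<Theta> x) {x..y}"
    proof (rule fundamental_theorem_of_calculus[OF xy])
      fix t assume "t \<in> {x..y}"
      then have "t > 0" using x by auto
      from has_field_derivative_bessel_Theta[OF this assms]
      show "(\<Theta> has_vector_derivative - (m * (bessel_f \<mu> t / t\<^sup>2))) (at t within {x..y})"
        unfolding \<Theta>_def m_def s_def has_real_derivative_iff_has_vector_derivative[symmetric]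
        by (rule has_field_derivative_at_within)
    qed
    from integral_unique[OF this]
    have "- (m * integral {x..y} (\<lambda>t. bessel_f \<mu> t / t\<^sup>2)) = \<Theta> y - \<Theta> x"
      by (simp only: integral_neg integral_mult_right)
    then show ?thesis
      unfolding I_def set_integral_tail_split[OF xy integrable_bessel_f_over_powers(2)[OF x]]
      by (simp add: algebra_simps)
  qed
  define C where "C = \<Theta> 1 - m * I 1"
  have C: "\<Theta> x = C + m * I x" if "x > 0" for x
    using step[of x 1] step[of 1 x] that unfolding C_def by (cases "x \<le> 1") auto
  have "bessel_P \<mu> x = s * (- bessel_f \<mu> x + (of_int \<mu>)\<^sup>2 * (LBINT t:{x..}. bessel_f \<mu> t / t) + m * x * I x + C * x)"
    if x: "x > 0" for x
  proof -
    have "s * bessel_P \<mu> x + bessel_f \<mu> x - bessel_G \<mu> x = x * \<Theta> x"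
      using x by (simp add: \<Theta>_def field_simps)
    then have "s * bessel_P \<mu> x = - bessel_f \<mu> x + bessel_G \<mu> x + m * x * I x + C * x"
      unfolding C[OF x] by (simp add: algebra_simps)
    from arg_cong[OF this, of "(*) s"] show ?thesis
      unfolding bessel_G_integral[OF x] by (simp add: ss flip: mult.assoc)
  qed
  then show ?thesis
    using summable_bessel_P integrable_bessel_f_over_powers(1,2)
    unfolding s_def m_def I_def by blast
qed

end
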